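(* Let $X=\bigcup_{v\in V}X_v$ be a graph-directed Bedford–McMullen $(\times m,\times n)$-carpet generated by $(V,E,\{\psi_e\})$, and let $H_1,\dots,H_r$ be the irreducible components of $G=(V,E)$. Then $$\dim_A X=\max_{1\le i\le r}\Big\{\sup_{y\in\pi\mathcal I_{H_i}}\frac{h_{\mathrm{top}}(\pi^{-1}(y)\cap\mathcal I_{H_i})}{\log n}+\max_{j\in\{i\}^+}\frac{h_{\mathrm{top}}(\pi\mathcal I_{H_j})}{\log m}\Big\}.$$ Moreover, $\dim_B X=\dim_A X$ if and only if there exists $i\in\{1,\dots,r\}$ such that all three of the following hold: - $\dim_B X=\dfrac{h_{\mathrm{top}}(\mathcal I_{H_i})}{\log n}+h_{\mathrm{top}}(\pi\mathcal I_{H_i})\Big(\dfrac1{\log m}-\dfrac1{\log n}\Big)$; - $\dim_A X=\sup_{y\in\pi\mathcal I_{H_i}}\dfrac{h_{\mathrm{top}}(\pi^{-1}(y)\cap\mathcal I_{H_i})}{\log n}+\dfrac{h_{\mathrm{top}}(\pi\mathcal I_{H_i})}{\log m}$; - $h_{\mathrm{top}}(\mathcal I_{H_i})=\sup_{y\in\pi\mathcal I_{H_i}}h_{\mathrm{top}}(\pi^{-1}(y)\cap\mathcal I_{H_i})+h_{\mathrm{top}}(\pi\mathcal I_{H_i})$. Furthermore, if $\dim_B X=\dim_A X$, then $\dim_H X=\dim_B X=\dim_A X$.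
   Context: Let $G=(V,E)$ be a finite directed graph (loops and multiple edges allowed). For $e\in E$ let $i(e)$, $t(e)$ be its initial and terminal vertex. Assume every vertex has an outgoing edge. Fix positive integers $n>m$ and for each $e\in E$ a pair $(x_e,y_e)\in\{0,\dots,n-1\}\times\{0,\dots,m-1\}$. Let $\psi_e(\xi_1,\xi_2)=((\xi_1+x_e)/n,(\xi_2+y_e)/m)$. Then $\{X_v\}$ is the unique family of nonempty compact subsets of $[0,1]^2$ with $X_v=\bigcup_{e:\,i(e)=v}\psi_e(X_{t(e)})$. No separation condition is assumed. The box dimension $\dim_B X$ exists. A directed graph is irreducible if its adjacency matrix $A$ (with $A(v,v')$ the number of edges from $v$ to $v'$) satisfies: $\sum_{j\ge1}A^j$ is positive. An irreducible component of $G$ is a maximal subgraph $H$ of $G$ that is irreducible. Let $H_i=(V_i,E_i)$, $i=1,\dots,r$, be all irreducible components. $\{i\}^+$ is the set of $j\in\{1,\dots,r\}$ such that there is a directed path from some vertex of $V_i$ to some vertex of $V_j$. For a subgraph $H=(V_H,E_H)$, let $E_H^k$ be the set of admissible words $w=w_1\cdots w_k$ with $w_j\in E_H$ and $t(w_j)=i(w_{j+1})$. Let $E_H^\infty$ be the set of infinite such words. Write $x_w=x_{w_1}\cdots x_{w_k}$ and $y_w=y_{w_1}\cdots y_{w_k}$. Define - $\mathcal I_H=\{(x_{\omega_1},y_{\omega_1})(x_{\omega_2},y_{\omega_2})\cdots:\omega\in E_H^\infty\}$, - $\pi\mathcal I_H=\{y_{\omega_1}y_{\omega_2}\cdots:\omega\in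 E_H^\infty\}$, - $\pi\big((x_1,y_1)(x_2,y_2)\cdots\big)=y_1y_2\cdots$. Topological entropies: - $h_{\mathrm{top}}(\mathcal I_H)=\lim_{k\to\infty}\frac1k\log\#\{(x_{w_1},y_{w_1})\cdots(x_{w_k},y_{w_k}):w\in E_H^k\}$; - $h_{\mathrm{top}}(\pi\mathcal I_H)=\lim_{k\to\infty}\frac1k\log\#\{y_w:w\in E_H^k\}$; - for $y\in\pi\mathcal I_H$, $h_{\mathrm{top}}(\pi^{-1}(y)\cap\mathcal I_H)=\limsup_{k\to\infty}\frac1k\log\#\{x_w:w\in E_H^k,\ y_w=y|_k\}$, where $y|_k$ is the length-$k$ prefix of $y$. $\dim_H,\dim_B,\dim_A$ denote Hausdorff, box and Assouad dimensions. *)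

theory Defs
  imports "HOL-Analysis.Analysis"
begin

section \<open>Fractal dimensions\<close>

text \<open>Contribution of a covering set to the s-dimensional Hausdorff sum:
  diam(U)^s, with the conventions diam(emptyset)^s = 0 and diam(U)^0 = 1 for U nonempty.\<close>
definition d_pow :: "real \<Rightarrow> 'a::metric_space set \<Rightarrow> real" where
  "d_pow s U = (if U = {} then 0 else if s = 0 then 1 else diameter U powr s)"

definition hausdorff_pre :: "real \<Rightarrow> real \<Rightarrow> 'a::metric_space set \<Rightarrow> ennreal" where
  "hausdorff_pre s \<delta> F =
     (INF U \<in> {U :: nat \<Rightarrow> 'a set. F \<subseteq> (\<Union>j. U j) \<and> (\<forall>j. bounded (U j) \<and> diameter (U j) \<le> \<delta>)}.
        (\<Sum>j. ennreal (d_pow s (U j))))"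

definition hausdorff_measure :: "real \<Rightarrow> 'a::metric_space set \<Rightarrow> ennreal" where
  "hausdorff_measure s F = (SUP \<delta> \<in> {0<..}. hausdorff_pre s \<delta> F)"

definition hausdorff_dim :: "'a::metric_space set \<Rightarrow> real" where
  "hausdorff_dim F = Inf {s. 0 \<le> s \<and> hausdorff_measure s F = 0}"

text \<open>N_delta(F): least number of sets of diameter at most delta covering F.\<close>
definition cover_num :: "real \<Rightarrow> 'a::metric_space set \<Rightarrow> nat" where
  "cover_num \<delta> F = (LEAST k. \<exists>U :: nat \<Rightarrow> 'a set.
      F \<subseteq> (\<Union>j<k. U j) \<and> (\<forall>j<k. bounded (U j) \<and> diameter (U j) \<le> \<delta>))"

text \<open>Box dimension: the limit of log N_delta(F) / (- log delta) as delta tends to 0.\<close>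
definition box_dim :: "'a::metric_space set \<Rightarrow> real" where
  "box_dim F = Lim (at_right 0) (\<lambda>\<delta>. ln (real (cover_num \<delta> F)) / (- ln \<delta>))"

definition assouad_dim :: "'a::metric_space set \<Rightarrow> real" where
  "assouad_dim F = Inf {s. 0 \<le> s \<and> (\<exists>C>0. \<forall>x\<in>F. \<forall>r R. 0 < r \<and> r < R \<longrightarrow>
       real (cover_num r (cball x R \<inter> F)) \<le> C * (R / r) powr s)}"

section \<open>Graphs\<close>

text \<open>Edges have initial vertex ini e and terminal vertex ter e.\<close>

definition is_subgraph :: "'v set \<Rightarrow> 'e set \<Rightarrow> ('e \<Rightarrow> 'v) \<Rightarrow> ('e \<Rightarrow> 'v) \<Rightarrow> 'v set \<Rightarrow> 'e set \<Rightarrow> bool" where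
  "is_subgraph V E ini ter VH EH \<longleftrightarrow> VH \<subseteq> V \<and> EH \<subseteq> E \<and> (\<forall>e\<in>EH. ini e \<in> VH \<and> ter e \<in> VH)"

definition adj :: "('e \<Rightarrow> 'v) \<Rightarrow> ('e \<Rightarrow> 'v) \<Rightarrow> 'e set \<Rightarrow> 'v \<Rightarrow> 'v \<Rightarrow> nat" where
  "adj ini ter EH v v' = card {e \<in> EH. ini e = v \<and> ter e = v'}"

text \<open>Entries of the j-th power of the adjacency matrix (indexed by VH).\<close>
fun adj_pow :: "('e \<Rightarrow> 'v) \<Rightarrow> ('e \<Rightarrow> 'v) \<Rightarrow> 'v set \<Rightarrow> 'e set \<Rightarrow> nat \<Rightarrow> 'v \<Rightarrow> 'v \<Rightarrow> nat" where
  "adj_pow ini ter VH EH 0 v v' = (if v = v' then 1 else 0)"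
| "adj_pow ini ter VH EH (Suc j) v v' = (\<Sum>u\<in>VH. adj ini ter EH v u * adj_pow ini ter VH EH j u v')"

text \<open>Irreducible: sum over j >= 1 of A^j is a positive matrix.\<close>
definition irreducible_graph :: "('e \<Rightarrow> 'v) \<Rightarrow> ('e \<Rightarrow> 'v) \<Rightarrow> 'v set \<Rightarrow> 'e set \<Rightarrow> bool" where
  "irreducible_graph ini ter VH EH \<longleftrightarrow>
     (\<forall>v\<in>VH. \<forall>v'\<in>VH. \<exists>j\<ge>1. adj_pow ini ter VH EH j v v' > 0)"

definition irr_component :: "'v set \<Rightarrow> 'e set \<Rightarrow> ('e \<Rightarrow> 'v) \<Rightarrow> ('e \<Rightarrow> 'v) \<Rightarrow> 'v set \<Rightarrow> 'e set \<Rightarrow> bool" where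
  "irr_component V E ini ter VH EH \<longleftrightarrow>
     is_subgraph V E ini ter VH EH \<and> irreducible_graph ini ter VH EH \<and>
     (\<forall>VH' EH'. is_subgraph V E ini ter VH' EH' \<and> irreducible_graph ini ter VH' EH' \<and>
        VH \<subseteq> VH' \<and> EH \<subseteq> EH' \<longrightarrow> VH' = VH \<and> EH' = EH)"

text \<open>Directed path (possibly of length 0) in G from some vertex of VH to some vertex of VH'.\<close>
definition reaches :: "'e set \<Rightarrow> ('e \<Rightarrow> 'v) \<Rightarrow> ('e \<Rightarrow> 'v) \<Rightarrow> 'v set \<Rightarrow> 'v set \<Rightarrow> bool" where
  "reaches E ini ter VH VH' \<longleftrightarrow>
     (\<exists>v\<in>VH. \<exists>v'\<in>VH'. (v, v') \<in> {(ini e, ter e) | e. e \<in> E}\<^sup>*)"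

definition adm_words :: "('e \<Rightarrow> 'v) \<Rightarrow> ('e \<Rightarrow> 'v) \<Rightarrow> 'e set \<Rightarrow> nat \<Rightarrow> 'e list set" where
  "adm_words ini ter EH k =
     {w. length w = k \<and> set w \<subseteq> EH \<and> (\<forall>j. Suc j < k \<longrightarrow> ter (w ! j) = ini (w ! Suc j))}"

definition inf_words :: "('e \<Rightarrow> 'v) \<Rightarrow> ('e \<Rightarrow> 'v) \<Rightarrow> 'e set \<Rightarrow> (nat \<Rightarrow> 'e) set" where
  "inf_words ini ter EH = {\<omega>. \<forall>j. \<omega> j \<in> EH \<and> ter (\<omega> j) = ini (\<omega> (Suc j))}"

section \<open>Symbolic spaces and topological entropies\<close>

text \<open>pi I_H: the set of y-digit sequences of infinite admissible words.\<close>
definition piI :: "('e \<Rightarrow> 'v) \<Rightarrow> ('e \<Rightarrow> 'v) \<Rightarrow> ('e \<Rightarrow> nat) \<Rightarrow> 'e set \<Rightarrow> (nat \<Rightarrow> nat) set" where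
  "piI ini ter dy EH = {(\<lambda>j. dy (\<omega> j)) | \<omega>. \<omega> \<in> inf_words ini ter EH}"

definition h_top_I :: "('e \<Rightarrow> 'v) \<Rightarrow> ('e \<Rightarrow> 'v) \<Rightarrow> ('e \<Rightarrow> nat) \<Rightarrow> ('e \<Rightarrow> nat) \<Rightarrow> 'e set \<Rightarrow> real" where
  "h_top_I ini ter dx dy EH =
     lim (\<lambda>k. ln (real (card ((\<lambda>w. map (\<lambda>e. (dx e, dy e)) w) ` adm_words ini ter EH k))) / real k)"

definition h_top_piI :: "('e \<Rightarrow> 'v) \<Rightarrow> ('e \<Rightarrow> 'v) \<Rightarrow> ('e \<Rightarrow> nat) \<Rightarrow> 'e set \<Rightarrow> real" where
  "h_top_piI ini ter dy EH =
     lim (\<lambda>k. ln (real (card ((\<lambda>w. map dy w) ` adm_words ini ter EH k))) / real k)"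

text \<open>h_top(pi^{-1}(y) cap I_H) for a y-digit sequence yy.\<close>
definition h_top_fib :: "('e \<Rightarrow> 'v) \<Rightarrow> ('e \<Rightarrow> 'v) \<Rightarrow> ('e \<Rightarrow> nat) \<Rightarrow> ('e \<Rightarrow> nat) \<Rightarrow> 'e set \<Rightarrow> (nat \<Rightarrow> nat) \<Rightarrow> real" where
  "h_top_fib ini ter dx dy EH yy = real_of_ereal (limsup (\<lambda>k. ereal (
     ln (real (card {map dx w | w. w \<in> adm_words ini ter EH k \<and> map dy w = map yy [0..<k]})) / real k)))"

definition sup_fib :: "('e \<Rightarrow> 'v) \<Rightarrow> ('e \<Rightarrow> 'v) \<Rightarrow> ('e \<Rightarrow> nat) \<Rightarrow> ('e \<Rightarrow> nat) \<Rightarrow> 'e set \<Rightarrow> real" where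
  "sup_fib ini ter dx dy EH = Sup (h_top_fib ini ter dx dy EH ` piI ini ter dy EH)"

section \<open>The maps psi_e\<close>

definition psi :: "nat \<Rightarrow> nat \<Rightarrow> nat \<Rightarrow> nat \<Rightarrow> real \<times> real \<Rightarrow> real \<times> real" where
  "psi n m a b = (\<lambda>(\<xi>1, \<xi>2). ((\<xi>1 + real a) / real n, (\<xi>2 + real b) / real m))"

end

theory Submission
  imports Defs "HOL-Probability.Infinite_Product_Measure"
begin

text \<open>
  All entropies are growth rates of one kind of submultiplicative quantity: the largest number of
  digit words that can be read off a set of paths once another digit word has been prescribed.
  An approximate square of side \<open>n\<^sup>-\<^sup>k\<close> fixes k digits x and about \<open>k log n / log m\<close> digits y, so passing
  to a finer scale means counting first a fibre, then pairs of digits, then y-digits alone. A path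
  visits the components in the order of reachability, and the entropy of pairs is at most fibre
  entropy plus y-entropy; this gives the upper bounds, while loops inside components joined by
  connecting paths give the matching lower bounds. Comparing the resulting formulas for the box and
  the Assouad dimension, equality forces one component in which pair entropy equals fibre entropy
  plus y-entropy. In such a component the uniform Bernoulli measure on long loop words gives all
  approximate squares of a given scale mass at most a power of the side length, up to an arbitrarily
  small loss in the exponent, so the Hausdorff dimension is not smaller.
\<close>

section \<open>Counting words with a constraint\<close>

text \<open>No separation is available: different paths may carry the same digits, and neighbouring
  cells touch. Hence digit words are counted instead of paths, and cells are compared with covering
  sets only up to the constant 49, the number of positions in a 7 by 7 block of grid cells. A
  maximum over prescribed words is taken because it is submultiplicative, whereas the fibres over
  one fixed sequence y need not be; periodic sequences show that the supremum over y attains the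
  same rate. Words can be joined only if end vertices match. Fixing the end vertices costs a factor
  \<open>(card V)^2\<close> and connecting them costs boundedly many letters, so neither changes an
  exponential rate. For the equality case: since 1/log m > 1/log n, a pair (u, u') maximizing the
  box formula has y-entropy at u' at least as large as at u. Equality of the dimensions turns this
  into an equality, and u alone then realizes both formulas.\<close>

definition cnt :: "('e \<Rightarrow> 'a) \<Rightarrow> ('e \<Rightarrow> 'b) \<Rightarrow> 'e list set \<Rightarrow> nat" where
  "cnt ob cn W = Max (insert 0 ((\<lambda>ys. card (map ob ` {w\<in>W. map cn w = ys})) ` (map cn ` W)))"

lemma cnt_fibre_le:
  assumes "finite W"
  shows "card (map ob ` {w\<in>W. map cn w = ys}) \<le> cnt ob cn W"
proof (cases "ys \<in> map cn ` W")
  case True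
  then show ?thesis unfolding cnt_def using assms by (intro Max_ge) auto
next
  case False
  then have "{w\<in>W. map cn w = ys} = {}" by auto
  then show ?thesis by (metis card.empty image_empty le0)
qed

lemma cnt_leI:
  assumes "finite W" "\<And>ys. card (map ob ` {w\<in>W. map cn w = ys}) \<le> K"
  shows "cnt ob cn W \<le> K"
  unfolding cnt_def using assms by (subst Max_le_iff) auto

lemma cnt_attained:
  assumes "finite W" "W \<noteq> {}"
  obtains ys where "cnt ob cn W = card (map ob ` {w\<in>W. map cn w = ys})"
proof -
  let ?S = "insert 0 ((\<lambda>ys. card (map ob ` {w\<in>W. map cn w = ys})) ` (map cn ` W))"
  have "Max ?S \<in> ?S" using assms by (intro Max_in) auto
  then consider "cnt ob cn W = 0" | ys where "cnt ob cn W = card (map ob ` {w\<in>W. map cn w = ys})"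
    unfolding cnt_def by auto
  then show ?thesis
  proof cases
    case 1
    then have "cnt ob cn W = card (map ob ` {w\<in>W. map cn w = ys})" for ys
      using cnt_fibre_le[OF assms(1), of ob cn ys] by simp
    then show ?thesis using that by blast
  qed (use that in blast)
qed

lemma cnt_empty [simp]: "cnt ob cn {} = 0"
  by (simp add: cnt_def)

lemma cnt_mono:
  assumes "finite W'" "W \<subseteq> W'"
  shows "cnt ob cn W \<le> cnt ob cn W'"
proof (rule cnt_leI)
  show "finite W" using assms finite_subset by blast
  fix ys
  have "card (map ob ` {w\<in>W. map cn w = ys}) \<le> card (map ob ` {w\<in>W'. map cn w = ys})"
    using assms by (intro card_mono) auto
  then show "card (map ob ` {w\<in>W. map cn w = ys}) \<le> cnt ob cn W'"
    using cnt_fibre_le[OF assms(1), of ob cn ys] by linarith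
qed

lemma cnt_UN:
  assumes "finite I" "\<And>i. i \<in> I \<Longrightarrow> finite (A i)"
  shows "cnt ob cn (\<Union>i\<in>I. A i) \<le> (\<Sum>i\<in>I. cnt ob cn (A i))"
proof (rule cnt_leI)
  show "finite (\<Union>i\<in>I. A i)" using assms by auto
  fix ys
  have "map ob ` {w \<in> (\<Union>i\<in>I. A i). map cn w = ys} = (\<Union>i\<in>I. map ob ` {w\<in>A i. map cn w = ys})"
    by auto
  also have "card \<dots> \<le> (\<Sum>i\<in>I. card (map ob ` {w\<in>A i. map cn w = ys}))"
    by (rule card_UN_le[OF assms(1)])
  also have "\<dots> \<le> (\<Sum>i\<in>I. cnt ob cn (A i))"
    by (intro sum_mono cnt_fibre_le assms)
  finally show "card (map ob ` {w \<in> (\<Union>i\<in>I. A i). map cn w = ys}) \<le> (\<Sum>i\<in>I. cnt ob cn (A i))" .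
qed

text \<open>All words of \<open>A\<close> have length \<open>k\<close>, so a prescribed word splits
  into \<open>take k ys\<close> and \<open>drop k ys\<close>, and its fibre lies among
  concatenations of one fibre of \<open>A\<close> with one fibre of \<open>B\<close>.
  Submultiplicativity comes from here.\<close>

lemma cnt_append:
  assumes "finite A" "finite B" "\<And>w. w \<in> A \<Longrightarrow> length w = k"
    "W \<subseteq> {u @ w | u w. u \<in> A \<and> w \<in> B}"
  shows "cnt ob cn W \<le> cnt ob cn A * cnt ob cn B"
proof -
  let ?P = "{u @ w | u w. u \<in> A \<and> w \<in> B}"
  have P: "?P = (\<lambda>(u,w). u @ w) ` (A \<times> B)" by auto
  have finP: "finite ?P" unfolding P using assms by auto
  show ?thesis
  proof (rule cnt_leI)
    show "finite W" using finP assms(4) finite_subset by blast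
    fix ys
    let ?X = "map ob ` {u\<in>A. map cn u = take k ys} \<times> map ob ` {w\<in>B. map cn w = drop k ys}"
    have "map ob ` {w\<in>W. map cn w = ys} \<subseteq> (\<lambda>(a,b). a @ b) ` ?X"
    proof
      fix z assume "z \<in> map ob ` {w\<in>W. map cn w = ys}"
      then obtain u w where *: "u \<in> A" "w \<in> B" "map cn (u @ w) = ys" "z = map ob (u @ w)"
        using assms(4) by auto
      have "length u = k" using * assms(3) by blast
      then have "map cn u = take k ys" "map cn w = drop k ys" using *(3) by auto
      then have "(map ob u, map ob w) \<in> ?X" using * by auto
      then show "z \<in> (\<lambda>(a,b). a @ b) ` ?X" using *(4)
        by (auto intro!: rev_image_eqI[of "(map ob u, map ob w)"])
    qed
    then have "card (map ob ` {w\<in>W. map cn w = ys}) \<le> card ((\<lambda>(a,b). a @ b) ` ?X)"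
      using assms by (intro card_mono) auto
    also have "\<dots> \<le> card ?X" using assms by (intro card_image_le) auto
    also have "\<dots> \<le> cnt ob cn A * cnt ob cn B"
      unfolding card_cartesian_product by (intro mult_mono cnt_fibre_le assms) auto
    finally show "card (map ob ` {w\<in>W. map cn w = ys}) \<le> cnt ob cn A * cnt ob cn B" .
  qed
qed

lemma cnt_pos:
  assumes "finite W" "W \<noteq> {}"
  shows "1 \<le> cnt ob cn W"
proof -
  obtain w where w: "w \<in> W" using assms by auto
  then have "map ob ` {v\<in>W. map cn v = map cn w} \<noteq> {}" by auto
  then have "1 \<le> card (map ob ` {v\<in>W. map cn v = map cn w})"
    using assms by (simp add: Suc_le_eq card_gt_0_iff)
  then show ?thesis using cnt_fibre_le[OF assms(1), of ob cn "map cn w"] by linarith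
qed

lemma cnt_le_card:
  assumes "finite W"
  shows "cnt ob cn W \<le> card W"
proof (rule cnt_leI[OF assms])
  fix ys
  have "card (map ob ` {w\<in>W. map cn w = ys}) \<le> card {w\<in>W. map cn w = ys}"
    using assms by (intro card_image_le) auto
  also have "\<dots> \<le> card W" using assms by (intro card_mono) auto
  finally show "card (map ob ` {w\<in>W. map cn w = ys}) \<le> card W" .
qed

text \<open>A fixed prefix and suffix act injectively on observed words and change the prescribed
  word in a fixed way, so connecting paths can be attached in lower bounds without loss.\<close>

lemma cnt_extend:
  assumes "finite W'" "(\<lambda>w. p @ w @ s) ` W \<subseteq> W'"
  shows "cnt ob cn W \<le> cnt ob cn W'"
proof -
  have inj: "inj_on (\<lambda>w. p @ w @ s) W" by (auto simp: inj_on_def)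
  have finW: "finite W" using assms inj finite_imageD finite_subset by blast
  show ?thesis
  proof (rule cnt_leI[OF finW])
    fix ys
    let ?e = "\<lambda>w. map ob p @ w @ map ob s"
    have "card (map ob ` {w\<in>W. map cn w = ys}) = card (?e ` map ob ` {w\<in>W. map cn w = ys})"
      by (rule card_image[symmetric]) (auto simp: inj_on_def)
    also have "\<dots> \<le> card (map ob ` {w\<in>W'. map cn w = map cn p @ ys @ map cn s})"
    proof (rule card_mono)
      show "finite (map ob ` {w \<in> W'. map cn w = map cn p @ ys @ map cn s})" using assms by auto
      show "?e ` map ob ` {w\<in>W. map cn w = ys} \<subseteq> map ob ` {w\<in>W'. map cn w = map cn p @ ys @ map cn s}"
      proof clarify
        fix w assume "w \<in> W"
        then have "p @ w @ s \<in> W'" using assms(2) by auto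
        then show "map ob p @ map ob w @ map ob s
            \<in> map ob ` {v \<in> W'. map cn v = map cn p @ map cn w @ map cn s}"
          by (intro image_eqI[of _ _ "p @ w @ s"]) auto
      qed
    qed
    also have "\<dots> \<le> cnt ob cn W'" by (rule cnt_fibre_le[OF assms(1)])
    finally show "card (map ob ` {w\<in>W. map cn w = ys}) \<le> cnt ob cn W'" .
  qed
qed

abbreviation triv :: "'e \<Rightarrow> unit" where "triv \<equiv> \<lambda>_. ()"

text \<open>A unit-valued constraint records only the length, so words of one length form a single
  fibre. Unconstrained counting thus becomes a case of \<open>cnt\<close>.\<close>

lemma cnt_triv:
  assumes "finite W" "\<And>w. w \<in> W \<Longrightarrow> length w = k"
  shows "cnt ob triv W = card (map ob ` W)"
proof (rule antisym)
  show "cnt ob triv W \<le> card (map ob ` W)"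
    using assms by (intro cnt_leI card_mono image_mono) auto
  have "{w\<in>W. map triv w = replicate k ()} = W"
    using assms(2) by (auto simp: map_replicate_const)
  then show "card (map ob ` W) \<le> cnt ob triv W"
    using cnt_fibre_le[OF assms(1), of ob triv "replicate k ()"] by simp
qed

text \<open>The chain rule for entropy in counting form: grouped by the \<open>g\<close>-word, pair
  words are determined by their \<open>f\<close>-words, being zips of the two.\<close>

lemma cnt_pair_le:
  assumes "finite W" "\<And>w. w \<in> W \<Longrightarrow> length w = k"
  shows "cnt (\<lambda>e. (f e, g e)) triv W \<le> cnt g triv W * cnt f g W"
proof -
  let ?F = "\<lambda>ys. map (\<lambda>e. (f e, g e)) ` {w\<in>W. map g w = ys}"
  have "map (\<lambda>e. (f e, g e)) ` W = (\<Union>ys\<in>map g ` W. ?F ys)" by auto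
  then have "cnt (\<lambda>e. (f e, g e)) triv W \<le> (\<Sum>ys\<in>map g ` W. card (?F ys))"
    using assms card_UN_le[of "map g ` W" ?F] by (simp add: cnt_triv)
  also have "\<dots> \<le> (\<Sum>ys\<in>map g ` W. cnt f g W)"
  proof (rule sum_mono)
    fix ys
    have "map (\<lambda>e. (f e, g e)) w = zip (map f w) (map g w)" for w by (induction w) auto
    then have eq: "?F ys = (\<lambda>xs. zip xs ys) ` map f ` {w\<in>W. map g w = ys}"
      by (auto simp: image_image intro!: image_eqI)
    have fin: "finite (map f ` {w\<in>W. map g w = ys})" using assms(1) by auto
    have "card (?F ys) \<le> card (map f ` {w\<in>W. map g w = ys})"
      unfolding eq by (rule card_image_le[OF fin])
    then show "card (?F ys) \<le> cnt f g W"
      using cnt_fibre_le[OF assms(1), of f g ys] by linarith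
  qed
  also have "\<dots> = cnt g triv W * cnt f g W" using assms by (simp add: cnt_triv)
  finally show ?thesis .
qed

section \<open>Growth rates\<close>

text \<open>Fekete's subadditive lemma. The limit is the infimum of \<open>a k / k\<close> over
  positive \<open>k\<close>, so \<open>real k * L \<le> a k\<close> holds for every
  \<open>k\<close>; lower bounds for counts therefore carry no error term.\<close>

lemma fekete:
  fixes a :: "nat \<Rightarrow> real"
  assumes nn: "\<And>k. 0 \<le> a k" and sub: "\<And>k l. a (k + l) \<le> a k + a l"
  obtains L where "(\<lambda>k. a k / real k) \<longlonglongrightarrow> L" "\<And>k. real k * L \<le> a k" "0 \<le> L"
proof -
  define L where "L = Inf ((\<lambda>k. a k / real k) ` {1..})"
  have bdd: "bdd_below ((\<lambda>k. a k / real k) ` {1..})"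
    using nn by (intro bdd_belowI[of _ 0]) auto
  have L_le: "L \<le> a k / real k" if "k \<ge> 1" for k
    unfolding L_def using bdd that by (intro cInf_lower) auto
  have mult: "a (q * k + r) \<le> real q * a k + a r" for q k r
  proof (induction q)
    case (Suc q)
    have "a (Suc q * k + r) \<le> a k + a (q * k + r)" using sub[of k "q * k + r"] by (simp add: add.assoc)
    then show ?case using Suc by (simp add: algebra_simps)
  qed simp
  have "(\<lambda>k. a k / real k) \<longlonglongrightarrow> L"
  proof (rule LIMSEQ_I)
    fix e :: real assume "e > 0"
    have "\<exists>x\<in>(\<lambda>k. a k / real k) ` {1..}. x < L + e / 2"
      unfolding L_def using bdd \<open>e > 0\<close>
      by (intro cInf_lessD[of _ "Inf ((\<lambda>k. a k / real k) ` {1..}) + e/2"]) auto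
    then obtain p where p: "p \<ge> 1" "a p / real p < L + e / 2" by auto
    define M where "M = Max (a ` {..<p})"
    have M: "a r \<le> M" if "r < p" for r unfolding M_def using that by (intro Max_ge) auto
    have M0: "0 \<le> M" using M[of 0] nn[of 0] p by auto
    obtain N where N: "real N > 2 * M / e" using reals_Archimedean2 by blast
    have "norm (a k / real k - L) < e" if k: "k \<ge> max N 1" for k
    proof -
      have k0: "real k > 0" using k by auto
      have "a k = a ((k div p) * p + k mod p)" by simp
      also have "\<dots> \<le> real (k div p) * a p + a (k mod p)" by (rule mult)
      also have "\<dots> \<le> real (k div p) * a p + M" using M[of "k mod p"] p by simp
      also have "real (k div p) * a p \<le> real k / real p * a p"
        using of_nat_div_le_of_nat[of k p, where 'a=real] nn[of p] by (intro mult_right_mono) auto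
      finally have "a k \<le> real k * (a p / real p) + M" by simp
      then have "a k / real k \<le> (real k * (a p / real p) + M) / real k"
        using k0 by (intro divide_right_mono) auto
      also have "\<dots> = a p / real p + M / real k" using k0 by (simp add: field_simps)
      also have "M / real k \<le> e / 2"
      proof -
        have "2 * M / e \<le> real k" using N k by linarith
        then show ?thesis using k0 \<open>e > 0\<close> by (simp add: field_simps)
      qed
      finally have "a k / real k < L + e" using p by linarith
      moreover have "L \<le> a k / real k" using L_le k by simp
      ultimately show ?thesis using \<open>e > 0\<close> by simp
    qed
    then show "\<exists>no. \<forall>k\<ge>no. norm (a k / real k - L) < e" by blast
  qed
  moreover have "real k * L \<le> a k" for k
  proof (cases "k = 0")
    case False
    then show ?thesis using L_le[of k] by (simp add: field_simps)
  qed (use nn in simp)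
  moreover have "0 \<le> L" unfolding L_def using nn by (intro cINF_greatest) auto
  ultimately show ?thesis using that by blast
qed

text \<open>The convention \<open>ln 0 = 0\<close> enters here: an empty count contributes growth 0
  instead of minus infinity, so growth rates are nonnegative for every finite edge set.\<close>

lemma ln_nat_nonneg: "0 \<le> ln (real k)"
  by (cases "k = 0") auto

lemma finite_adm_words: "finite F \<Longrightarrow> finite (adm_words ini ter F k)"
  by (rule finite_subset[OF _ finite_lists_length_eq[of F k]]) (auto simp: adm_words_def)

lemma adm_words_length: "w \<in> adm_words ini ter F k \<Longrightarrow> length w = k"
  by (simp add: adm_words_def)

lemma adm_words_appendD:
  assumes "u @ w \<in> adm_words ini ter F k"
  shows "u \<in> adm_words ini ter F (length u)" "w \<in> adm_words ini ter F (length w)"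
proof -
  have *: "ter ((u @ w) ! j) = ini ((u @ w) ! Suc j)" if "Suc j < length (u @ w)" for j
    using assms that unfolding adm_words_def by auto
  have "ter (u ! j) = ini (u ! Suc j)" if "Suc j < length u" for j
    using *[of j] that by (simp add: nth_append)
  moreover have "ter (w ! j) = ini (w ! Suc j)" if "Suc j < length w" for j
    using *[of "length u + j"] that by (simp add: nth_append)
  ultimately show "u \<in> adm_words ini ter F (length u)" "w \<in> adm_words ini ter F (length w)"
    using assms unfolding adm_words_def by auto
qed

text \<open>\<open>ob\<close> is the digit that is counted and \<open>cn\<close> the digit that is
  prescribed. The instances are \<open>dx\<close> over \<open>dy\<close> (largest fibre entropy),
  pairs over \<open>triv\<close> (\<open>h_top_I\<close>) and \<open>dy\<close> over
  \<open>triv\<close> (\<open>h_top_piI\<close>).\<close>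

definition grow :: "('e \<Rightarrow> 'v) \<Rightarrow> ('e \<Rightarrow> 'v) \<Rightarrow> ('e \<Rightarrow> 'a) \<Rightarrow> ('e \<Rightarrow> 'b) \<Rightarrow> 'e set \<Rightarrow> real" where
  "grow ini ter ob cn F = lim (\<lambda>k. ln (real (cnt ob cn (adm_words ini ter F k))) / real k)"

lemma cnt_adm_submult:
  assumes "finite F"
  shows "cnt ob cn (adm_words ini ter F (k + l))
    \<le> cnt ob cn (adm_words ini ter F k) * cnt ob cn (adm_words ini ter F l)"
proof (rule cnt_append)
  show "adm_words ini ter F (k + l)
    \<subseteq> {u @ w |u w. u \<in> adm_words ini ter F k \<and> w \<in> adm_words ini ter F l}"
  proof
    fix w assume w: "w \<in> adm_words ini ter F (k + l)"
    then have "take k w @ drop k w \<in> adm_words ini ter F (k + l)" by simp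
    from adm_words_appendD[OF this] have "take k w \<in> adm_words ini ter F k"
      "drop k w \<in> adm_words ini ter F l"
      using adm_words_length[OF w] by auto
    then show "w \<in> {u @ w |u w. u \<in> adm_words ini ter F k \<and> w \<in> adm_words ini ter F l}"
      using append_take_drop_id[of k w] by (metis (mono_tags, lifting) mem_Collect_eq)
  qed
qed (use assms finite_adm_words adm_words_length in auto)

lemma grow_facts:
  assumes "finite F"
  shows grow_lim: "(\<lambda>k. ln (real (cnt ob cn (adm_words ini ter F k))) / real k) \<longlonglongrightarrow> grow ini ter ob cn F"
    and grow_le: "real k * grow ini ter ob cn F \<le> ln (real (cnt ob cn (adm_words ini ter F k)))"
    and grow_nonneg: "0 \<le> grow ini ter ob cn F"
proof -
  let ?c = "\<lambda>k. cnt ob cn (adm_words ini ter F k)"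
  have sub: "ln (real (?c (k + l))) \<le> ln (real (?c k)) + ln (real (?c l))" for k l
  \<comment> \<open>A nonzero count at \<open>k + l\<close> forces both factors to be positive, so
    logarithms may be taken; the zero case rests on \<open>ln 0 = 0\<close>.\<close>
  proof (cases "?c (k + l) = 0")
    case True
    then show ?thesis using ln_nat_nonneg[of "?c k"] ln_nat_nonneg[of "?c l"] by simp
  next
    case False
    have le: "?c (k + l) \<le> ?c k * ?c l" by (rule cnt_adm_submult[OF assms])
    then have pos: "?c k > 0" "?c l > 0" using False by (auto intro: gr0I)
    have "ln (real (?c (k + l))) \<le> ln (real (?c k * ?c l))"
      using le False pos by (subst ln_le_cancel_iff) (auto simp flip: of_nat_mult)
    also have "\<dots> = ln (real (?c k)) + ln (real (?c l))" using pos by (simp add: ln_mult)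
    finally show ?thesis .
  qed
  obtain L where L: "(\<lambda>k. ln (real (?c k)) / real k) \<longlonglongrightarrow> L" "\<And>k. real k * L \<le> ln (real (?c k))" "0 \<le> L"
    using fekete[of "\<lambda>k. ln (real (?c k))"] sub ln_nat_nonneg by blast
  have "grow ini ter ob cn F = L" unfolding grow_def using L(1) by (rule limI)
  then show "(\<lambda>k. ln (real (?c k)) / real k) \<longlonglongrightarrow> grow ini ter ob cn F"
    "real k * grow ini ter ob cn F \<le> ln (real (?c k))" "0 \<le> grow ini ter ob cn F"
    using L by auto
qed

text \<open>The constant absorbs the finitely many lengths at which the quotient may still exceed
  its limit by \<open>\<epsilon>\<close>.\<close>

lemma grow_upper:
  assumes "finite F" "\<epsilon> > 0"
  obtains C where "C > 0" "\<And>k. real (cnt ob cn (adm_words ini ter F k))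
    \<le> C * exp (real k * (grow ini ter ob cn F + \<epsilon>))"
proof -
  let ?c = "\<lambda>k. cnt ob cn (adm_words ini ter F k)" and ?g = "grow ini ter ob cn F"
  have "eventually (\<lambda>k. ln (real (?c k)) / real k < ?g + \<epsilon>) sequentially"
    using grow_lim[OF assms(1), of ob cn ini ter] assms(2) by (intro order_tendstoD) auto
  then obtain N where N: "\<And>k. k \<ge> N \<Longrightarrow> ln (real (?c k)) / real k < ?g + \<epsilon>"
    unfolding eventually_sequentially by blast
  define C where "C = 1 + (\<Sum>k\<le>N. real (?c k))"
  have C1: "C \<ge> 1" unfolding C_def by (simp add: sum_nonneg)
  have g0: "?g \<ge> 0" by (rule grow_nonneg[OF assms(1)])
  have "real (?c k) \<le> C * exp (real k * (?g + \<epsilon>))" for k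
  proof (cases "k \<le> N")
    case True
    have "real (?c k) \<le> (\<Sum>k\<le>N. real (?c k))" using True by (intro member_le_sum) auto
    then have "real (?c k) \<le> C * 1" unfolding C_def by simp
    also have "\<dots> \<le> C * exp (real k * (?g + \<epsilon>))"
      using C1 g0 assms(2) by (intro mult_left_mono) auto
    finally show ?thesis .
  next
    case False
    show ?thesis
    proof (cases "?c k = 0")
      case False
      have "ln (real (?c k)) \<le> real k * (?g + \<epsilon>)" using N[of k] \<open>\<not> k \<le> N\<close>
        by (simp add: field_simps)
      then have "real (?c k) \<le> exp (real k * (?g + \<epsilon>))"
        using False by (metis exp_le_cancel_iff exp_ln of_nat_0_less_iff gr0I)
      also have "\<dots> \<le> C * exp (real k * (?g + \<epsilon>))" using C1 by simp
      finally show ?thesis .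
    qed (use C1 in simp)
  qed
  then show ?thesis using that[of C] C1 by auto
qed

lemma grow_lower:
  assumes "finite F" "adm_words ini ter F k \<noteq> {}"
  shows "exp (real k * grow ini ter ob cn F) \<le> real (cnt ob cn (adm_words ini ter F k))"
proof -
  have "0 < real (cnt ob cn (adm_words ini ter F k))"
    using cnt_pos[OF finite_adm_words[OF assms(1)] assms(2)] by (metis of_nat_0_less_iff less_le_trans zero_less_one)
  then show ?thesis using grow_le[OF assms(1), of k ini ter ob cn]
    by (metis exp_le_cancel_iff exp_ln)
qed

text \<open>Assigns growth 0 to the class of a vertex on no cycle, so the upper bounds can treat all
  vertices alike.\<close>

lemma grow_empty [simp]: "grow ini ter ob cn {} = 0"
proof -
  have "eventually (\<lambda>k. ln (real (cnt ob cn (adm_words ini ter {} k))) / real k = 0) sequentially"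
    using eventually_gt_at_top[of 0]
  proof eventually_elim
    case (elim k)
    then have "adm_words ini ter {} k = {}" unfolding adm_words_def by auto
    then show ?case by simp
  qed
  then have "(\<lambda>k. ln (real (cnt ob cn (adm_words ini ter {} k))) / real k) \<longlonglongrightarrow> 0"
    by (rule tendsto_eventually)
  then show ?thesis unfolding grow_def by (rule limI)
qed

lemma grow_pair_le:
  assumes "finite F"
  shows "grow ini ter (\<lambda>e. (f e, g e)) triv F \<le> grow ini ter g triv F + grow ini ter f g F"
proof (rule LIMSEQ_le[OF grow_lim[OF assms] tendsto_add[OF grow_lim[OF assms] grow_lim[OF assms]]])
  have "ln (real (cnt (\<lambda>e. (f e, g e)) triv (adm_words ini ter F k))) / real k \<le>
    ln (real (cnt g triv (adm_words ini ter F k))) / real k + ln (real (cnt f g (adm_words ini ter F k))) / real k" for k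
  proof (cases "adm_words ini ter F k = {}")
    case False
    note fin = finite_adm_words[OF assms, of ini ter k]
    have pos: "0 < real (cnt ob cn (adm_words ini ter F k))" for ob :: "_ \<Rightarrow> 'x" and cn :: "_ \<Rightarrow> 'y"
      using cnt_pos[OF fin False, of ob cn] by (metis of_nat_0_less_iff less_le_trans zero_less_one)
    have "real (cnt (\<lambda>e. (f e, g e)) triv (adm_words ini ter F k))
        \<le> real (cnt g triv (adm_words ini ter F k)) * real (cnt f g (adm_words ini ter F k))"
      unfolding of_nat_mult[symmetric] of_nat_le_iff
      by (rule cnt_pair_le[OF fin adm_words_length])
    then have "ln (real (cnt (\<lambda>e. (f e, g e)) triv (adm_words ini ter F k)))
        \<le> ln (real (cnt g triv (adm_words ini ter F k)) * real (cnt f g (adm_words ini ter F k)))"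
      using pos[of "\<lambda>e. (f e, g e)" triv] pos[of g triv] pos[of f g] by (subst ln_le_cancel_iff) auto
    also have "\<dots> = ln (real (cnt g triv (adm_words ini ter F k))) + ln (real (cnt f g (adm_words ini ter F k)))"
      using pos[of g triv] pos[of f g] by (simp add: ln_mult)
    finally show ?thesis by (simp add: divide_right_mono flip: add_divide_distrib)
  qed simp
  then show "\<exists>N. \<forall>k\<ge>N. ln (real (cnt (\<lambda>e. (f e, g e)) triv (adm_words ini ter F k))) / real k \<le>
    ln (real (cnt g triv (adm_words ini ter F k))) / real k + ln (real (cnt f g (adm_words ini ter F k))) / real k"
    by blast
qed

section \<open>Paths and strongly connected components\<close>

text \<open>Admissible words do not record where they start and end, and an empty word has no vertex
  at all. Paths with both end vertices are needed for concatenation.\<close>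

fun pth :: "('e \<Rightarrow> 'v) \<Rightarrow> ('e \<Rightarrow> 'v) \<Rightarrow> 'e set \<Rightarrow> 'v \<Rightarrow> 'e list \<Rightarrow> 'v \<Rightarrow> bool" where
  "pth ini ter F v [] v' \<longleftrightarrow> v = v'"
| "pth ini ter F v (e # w) v' \<longleftrightarrow> e \<in> F \<and> ini e = v \<and> pth ini ter F (ter e) w v'"

definition wset :: "('e \<Rightarrow> 'v) \<Rightarrow> ('e \<Rightarrow> 'v) \<Rightarrow> 'e set \<Rightarrow> 'v \<Rightarrow> 'v \<Rightarrow> nat \<Rightarrow> 'e list set" where
  "wset ini ter F v v' k = {w. length w = k \<and> pth ini ter F v w v'}"

lemma pth_append: "pth ini ter F v (u @ w) v' \<longleftrightarrow> (\<exists>x. pth ini ter F v u x \<and> pth ini ter F x w v')"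
  by (induction u arbitrary: v) auto

lemma pth_mono: "pth ini ter F v w v' \<Longrightarrow> F \<subseteq> F' \<Longrightarrow> pth ini ter F' v w v'"
  by (induction w arbitrary: v) auto

lemma pth_set: "pth ini ter F v w v' \<Longrightarrow> set w \<subseteq> F"
  by (induction w arbitrary: v) auto

lemma pth_adm: "pth ini ter F v w v' \<Longrightarrow> w \<in> adm_words ini ter F (length w)"
proof (induction w arbitrary: v)
  case (Cons e w)
  then have IH: "w \<in> adm_words ini ter F (length w)" and e: "e \<in> F" "pth ini ter F (ter e) w v'" by auto
  have hd: "w \<noteq> [] \<Longrightarrow> ini (w ! 0) = ter e" using e(2) by (cases w) auto
  have "ter ((e # w) ! j) = ini ((e # w) ! Suc j)" if "Suc j < Suc (length w)" for j
    using that hd IH unfolding adm_words_def by (cases j) auto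
  then show ?case using IH e(1) unfolding adm_words_def by auto
qed (simp add: adm_words_def)

lemma adm_pth: "w \<in> adm_words ini ter F k \<Longrightarrow> w \<noteq> [] \<Longrightarrow> pth ini ter F (ini (hd w)) w (ter (last w))"
proof (induction w arbitrary: k)
  case (Cons e w)
  have e: "e \<in> F" using Cons.prems unfolding adm_words_def by auto
  show ?case
  proof (cases "w = []")
    case False
    have "[e] @ w \<in> adm_words ini ter F k" using Cons.prems by simp
    from adm_words_appendD(2)[OF this] have "pth ini ter F (ini (hd w)) w (ter (last w))"
      using Cons.IH False by blast
    moreover have "ter e = ini (hd w)" using Cons.prems False unfolding adm_words_def
      by (auto simp: hd_conv_nth dest!: spec[of _ 0])
    ultimately show ?thesis using e False by simp
  qed (use e in simp)
qed simp

lemma adm_cover: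
  assumes "S \<noteq> {}" "\<And>e. e \<in> F \<Longrightarrow> ini e \<in> S \<and> ter e \<in> S"
  shows "adm_words ini ter F k \<subseteq> (\<Union>(v,v')\<in>S \<times> S. wset ini ter F v v' k)"
proof
  fix w assume w: "w \<in> adm_words ini ter F k"
  have len: "length w = k" and sub: "set w \<subseteq> F" using w unfolding adm_words_def by auto
  show "w \<in> (\<Union>(v,v')\<in>S \<times> S. wset ini ter F v v' k)"
  proof (cases "w = []")
    case True
    \<comment> \<open>The empty word has no end vertices of its own; any element of \<open>S\<close>
      serves as both.\<close>
    then show ?thesis using assms(1) len by (auto simp: wset_def)
  next
    case False
    then have "ini (hd w) \<in> S" "ter (last w) \<in> S" using assms(2) sub by (auto simp: subset_iff)
    then show ?thesis using adm_pth[OF w False] len by (auto simp: wset_def)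
  qed
qed

lemma wset_adm: "wset ini ter F v v' k \<subseteq> adm_words ini ter F k"
  using pth_adm by (auto simp: wset_def)

lemma finite_wset: "finite F \<Longrightarrow> finite (wset ini ter F v v' k)"
  by (rule finite_subset[OF wset_adm finite_adm_words])

lemma wset_mono: "F \<subseteq> F' \<Longrightarrow> wset ini ter F v v' k \<subseteq> wset ini ter F' v v' k"
  unfolding wset_def using pth_mono[of ini ter F v _ v' F'] by blast

lemma wset_append: "u \<in> wset ini ter F v x k \<Longrightarrow> w \<in> wset ini ter F x v' l \<Longrightarrow> u @ w \<in> wset ini ter F v v' (k + l)"
  unfolding wset_def by (auto simp: pth_append)

lemma wset_split:
  assumes "w \<in> wset ini ter F v v' (k + l)"
  obtains x where "take k w \<in> wset ini ter F v x k" "drop k w \<in> wset ini ter F x v' l"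
proof -
  have "length w = k + l" "pth ini ter F v (take k w @ drop k w) v'" using assms by (auto simp: wset_def)
  then show ?thesis using that unfolding pth_append wset_def by auto
qed

lemma adj_pow_pos:
  assumes "finite VH" "finite EH" "\<forall>e\<in>EH. ini e \<in> VH \<and> ter e \<in> VH"
  shows "adj_pow ini ter VH EH j v v' > 0 \<longleftrightarrow> (\<exists>w. length w = j \<and> pth ini ter EH v w v')"
proof (induction j arbitrary: v)
  case 0
  then show ?case by simp
next
  case (Suc j)
  have adj: "adj ini ter EH v u > 0 \<longleftrightarrow> (\<exists>e\<in>EH. ini e = v \<and> ter e = u)" for u
    unfolding adj_def using assms(2) by (auto simp: card_gt_0_iff)
  have "adj_pow ini ter VH EH (Suc j) v v' > 0 \<longleftrightarrow>
      (\<exists>u\<in>VH. adj ini ter EH v u > 0 \<and> adj_pow ini ter VH EH j u v' > 0)"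
    using assms(1) by (simp add: sum_eq_0_iff flip: neq0_conv)
  also have "\<dots> \<longleftrightarrow> (\<exists>u\<in>VH. \<exists>e\<in>EH. \<exists>w. ini e = v \<and> ter e = u \<and> length w = j \<and> pth ini ter EH u w v')"
    unfolding adj Suc by blast
  also have "\<dots> \<longleftrightarrow> (\<exists>w. length w = Suc j \<and> pth ini ter EH v w v')"
  proof
    assume "\<exists>u\<in>VH. \<exists>e\<in>EH. \<exists>w. ini e = v \<and> ter e = u \<and> length w = j \<and> pth ini ter EH u w v'"
    then obtain e w where "e \<in> EH" "ini e = v" "length w = j" "pth ini ter EH (ter e) w v'" by auto
    then show "\<exists>w. length w = Suc j \<and> pth ini ter EH v w v'" by (intro exI[of _ "e # w"]) auto
  next
    assume "\<exists>w. length w = Suc j \<and> pth ini ter EH v w v'"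
    then obtain w where w: "length w = Suc j" "pth ini ter EH v w v'" by auto
    then show "\<exists>u\<in>VH. \<exists>e\<in>EH. \<exists>w. ini e = v \<and> ter e = u \<and> length w = j \<and> pth ini ter EH u w v'"
      using assms(3) by (cases w) auto
  qed
  finally show ?case .
qed

text \<open>Absorbs into the exponent the linear factor that counts the positions at which a path
  can leave a class.\<close>

lemma poly_exp_bound:
  fixes \<epsilon> :: real
  assumes "\<epsilon> > 0"
  shows "1 + real k \<le> (1 + 1 / \<epsilon>) * exp (real k * \<epsilon>)"
proof -
  have "1 + real k * \<epsilon> \<le> exp (real k * \<epsilon>)" by (rule exp_ge_add_one_self)
  moreover have "1 + real k \<le> (1 + 1 / \<epsilon>) * (1 + real k * \<epsilon>)"
    using assms by (simp add: field_simps)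
  ultimately show ?thesis using assms
    by (smt (verit, best) divide_pos_pos mult_left_mono)
qed

section \<open>Reachability classes of a finite directed graph\<close>

locale digraph =
  fixes V :: "'v set" and E :: "'e set" and ini ter :: "'e \<Rightarrow> 'v"
  assumes finV: "finite V" and V_ne: "V \<noteq> {}" and finE: "finite E"
    and ends: "\<forall>e\<in>E. ini e \<in> V \<and> ter e \<in> V"
    and out: "\<forall>v\<in>V. \<exists>e\<in>E. ini e = v"
begin

definition reach :: "'v \<Rightarrow> 'v \<Rightarrow> bool" where
  "reach v v' \<longleftrightarrow> (v, v') \<in> {(ini e, ter e) | e. e \<in> E}\<^sup>*"

definition scc :: "'v \<Rightarrow> 'v set" where
  "scc u = {v\<in>V. reach u v \<and> reach v u}"

definition Eu :: "'v \<Rightarrow> 'e set" where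
  "Eu u = {e\<in>E. ini e \<in> scc u \<and> ter e \<in> scc u}"

text \<open>A class without internal edges is a single vertex on no cycle. It must be singled out
  because irreducibility asks for paths of positive length.\<close>

definition cyc :: "'v \<Rightarrow> bool" where
  "cyc u \<longleftrightarrow> u \<in> V \<and> Eu u \<noteq> {}"

lemma reach_refl [simp]: "reach v v" unfolding reach_def by simp

lemma reach_trans [trans]: "reach a b \<Longrightarrow> reach b c \<Longrightarrow> reach a c"
  unfolding reach_def by (rule rtrancl_trans)

lemma reach_edge: "e \<in> E \<Longrightarrow> reach (ini e) (ter e)"
  unfolding reach_def by auto

lemma pth_reach: "pth ini ter E v w v' \<Longrightarrow> reach v v'"
  by (induction w arbitrary: v) (auto intro: reach_trans reach_edge)

lemma reach_pth:
  assumes "reach v v'"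
  obtains w where "pth ini ter E v w v'"
proof -
  have "\<exists>w. pth ini ter E v w v'"
    using assms unfolding reach_def
  proof (induction rule: converse_rtrancl_induct)
    case base
    then show ?case by (intro exI[of _ "[]"]) simp
  next
    case (step y z)
    then obtain e w where "e \<in> E" "y = ini e" "z = ter e" "pth ini ter E z w v'" by auto
    then show ?case by (intro exI[of _ "e # w"]) simp
  qed
  then show ?thesis using that by blast
qed

lemma pth_in_V: "pth ini ter E v w v' \<Longrightarrow> v \<in> V \<Longrightarrow> v' \<in> V"
  using ends by (induction w arbitrary: v) auto

lemma reach_in_V: "reach v v' \<Longrightarrow> v \<in> V \<Longrightarrow> v' \<in> V"
  using pth_in_V reach_pth by metis

lemma Eu_sub: "Eu u \<subseteq> E" unfolding Eu_def by auto

lemma finite_Eu: "finite (Eu u)" using Eu_sub finE finite_subset by blast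

lemma scc_sub: "scc u \<subseteq> V" unfolding scc_def by auto

lemma finite_scc: "finite (scc u)" using scc_sub finV finite_subset by blast

lemma scc_refl: "u \<in> V \<Longrightarrow> u \<in> scc u" unfolding scc_def by simp

lemma scc_reach: "v \<in> scc u \<Longrightarrow> v' \<in> scc u \<Longrightarrow> reach v v'"
  unfolding scc_def by (auto intro: reach_trans)

lemma scc_between: "v \<in> scc u \<Longrightarrow> v' \<in> scc u \<Longrightarrow> reach v x \<Longrightarrow> reach x v' \<Longrightarrow> x \<in> scc u"
  unfolding scc_def by (auto intro: reach_trans reach_in_V)

text \<open>Every vertex on a path between two points of a class is reachable from the class and
  reaches it, so the path never leaves.\<close>

lemma pth_scc: "pth ini ter E v w v' \<Longrightarrow> v \<in> scc u \<Longrightarrow> v' \<in> scc u \<Longrightarrow> pth ini ter (Eu u) v w v'"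
proof (induction w arbitrary: v)
  case (Cons e w)
  then have e: "e \<in> E" "ini e = v" "pth ini ter E (ter e) w v'" by auto
  then have "ter e \<in> scc u" using Cons.prems scc_between pth_reach reach_edge by metis
  then show ?case using Cons e unfolding Eu_def by auto
qed simp

text \<open>Finitely many pairs of vertices give one bound \<open>J\<close>, so joining two paths
  costs boundedly many letters and nothing in the exponential rate.\<close>

lemma short_paths:
  obtains J where "\<And>v v'. v \<in> V \<Longrightarrow> reach v v' \<Longrightarrow> \<exists>w. pth ini ter E v w v' \<and> length w \<le> J"
proof -
  define l where "l = (\<lambda>(v, v'). length (SOME w. pth ini ter E v w v'))"
  have "\<exists>w. pth ini ter E v w v' \<and> length w \<le> Max (l ` (V \<times> V))" if "v \<in> V" "reach v v'" for v v'
  proof (intro exI[of _ "SOME w. pth ini ter E v w v'"] conjI)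
    show "pth ini ter E v (SOME w. pth ini ter E v w v') v'" using reach_pth[OF that(2)] by (metis someI)
    have "l (v, v') \<le> Max (l ` (V \<times> V))"
      using that reach_in_V finV by (intro Max_ge) auto
    then show "length (SOME w. pth ini ter E v w v') \<le> Max (l ` (V \<times> V))" by (simp add: l_def)
  qed
  then show ?thesis using that by blast
qed

text \<open>Used to pad a word to a prescribed length; it rests on every vertex having an outgoing
  edge.\<close>

lemma pth_forward: "v \<in> V \<Longrightarrow> \<exists>w v'. v' \<in> V \<and> w \<in> wset ini ter E v v' k"
proof (induction k arbitrary: v)
  case 0
  then show ?case by (intro exI[of _ "[]"] exI[of _ v]) (simp add: wset_def)
next
  case (Suc k)
  obtain e where e: "e \<in> E" "ini e = v" using out Suc by auto
  then obtain w v' where "v' \<in> V" "w \<in> wset ini ter E (ter e) v' k" using Suc.IH[of "ter e"] ends by blast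
  then show ?case using e by (intro exI[of _ "e # w"] exI[of _ v']) (simp add: wset_def)
qed

text \<open>A closed walk from \<open>v\<close> through some internal edge and back stays in the
  class; its first and last edges are the ones wanted.\<close>

lemma cyc_edges:
  assumes "cyc u" "v \<in> scc u"
  shows "\<exists>e\<in>Eu u. ini e = v" "\<exists>e\<in>Eu u. ter e = v"
proof -
  obtain e where e: "e \<in> Eu u" using assms(1) unfolding cyc_def by auto
  then have s: "ini e \<in> scc u" "ter e \<in> scc u" "e \<in> E" unfolding Eu_def by auto
  obtain p where p: "pth ini ter E v p (ini e)" using scc_reach[OF assms(2) s(1)] reach_pth by blast
  obtain q where q: "pth ini ter E (ter e) q v" using scc_reach[OF s(2) assms(2)] reach_pth by blast
  have "pth ini ter E v (p @ e # q) v" using p q s by (auto simp: pth_append)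
  then have w: "pth ini ter (Eu u) v (p @ e # q) v" using assms(2) pth_scc by blast
  show "\<exists>e\<in>Eu u. ini e = v" using w by (cases "p @ e # q") auto
  show "\<exists>e\<in>Eu u. ter e = v" using w
    by (cases "p @ e # q" rule: rev_cases) (auto simp: pth_append)
qed

lemma cyc_forward:
  assumes "cyc u" "v \<in> scc u"
  shows "\<exists>w v'. v' \<in> scc u \<and> w \<in> wset ini ter (Eu u) v v' k"
  using assms(2)
proof (induction k arbitrary: v)
  case 0
  then show ?case by (intro exI[of _ "[]"] exI[of _ v]) (simp add: wset_def)
next
  case (Suc k)
  obtain e where e: "e \<in> Eu u" "ini e = v" using cyc_edges(1)[OF assms(1) Suc.prems] by auto
  then obtain w v' where "v' \<in> scc u" "w \<in> wset ini ter (Eu u) (ter e) v' k"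
    using Suc.IH[of "ter e"] unfolding Eu_def by blast
  then show ?case using e by (intro exI[of _ "e # w"] exI[of _ v']) (simp add: wset_def)
qed

text \<open>Allows a fibre of the class to be placed at an arbitrary depth below the start of a
  path.\<close>

lemma cyc_backward:
  assumes "cyc u" "v \<in> scc u"
  shows "\<exists>w v'. v' \<in> scc u \<and> w \<in> wset ini ter (Eu u) v' v k"
  using assms(2)
proof (induction k arbitrary: v)
  case 0
  then show ?case by (intro exI[of _ "[]"] exI[of _ v]) (simp add: wset_def)
next
  case (Suc k)
  obtain e where e: "e \<in> Eu u" "ter e = v" using cyc_edges(2)[OF assms(1) Suc.prems] by auto
  then obtain w v' where "v' \<in> scc u" "w \<in> wset ini ter (Eu u) v' (ini e) k"
    using Suc.IH[of "ini e"] unfolding Eu_def by blast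
  then show ?case using e by (intro exI[of _ "w @ [e]"] exI[of _ v']) (auto simp: wset_def pth_append)
qed

lemma cyc_V: "cyc u \<Longrightarrow> u \<in> V" unfolding cyc_def by simp

lemma cyc_scc: "cyc u \<Longrightarrow> u \<in> scc u" using cyc_V scc_refl by blast

lemma adm_Eu_ne: "cyc u \<Longrightarrow> adm_words ini ter (Eu u) k \<noteq> {}"
  using cyc_forward[OF _ cyc_scc] wset_adm by (metis empty_iff subsetD)

lemma adm_Eu_cover:
  assumes "u \<in> V"
  shows "adm_words ini ter (Eu u) k \<subseteq> (\<Union>(v,v')\<in>scc u \<times> scc u. wset ini ter (Eu u) v v' k)"
  using assms scc_refl by (intro adm_cover) (auto simp: Eu_def)

text \<open>At most \<open>(card V)^2\<close> pairs of end vertices occur, so some pair carries at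
  least that fraction of the count. Fixing end vertices does not change the growth rate.\<close>

lemma pigeonhole_words:
  assumes "u \<in> V"
  obtains v v' where "v \<in> scc u" "v' \<in> scc u"
    "cnt ob cn (adm_words ini ter (Eu u) k) \<le> (card V)\<^sup>2 * cnt ob cn (wset ini ter (Eu u) v v' k)"
proof -
  let ?c = "\<lambda>p. cnt ob cn (wset ini ter (Eu u) (fst p) (snd p) k)"
  let ?S = "scc u \<times> scc u"
  have fin: "finite ?S" and ne: "?S \<noteq> {}" using finite_scc scc_refl[OF assms] by auto
  have "Max (?c ` ?S) \<in> ?c ` ?S" using fin ne by (intro Max_in) auto
  then obtain p where p: "p \<in> ?S" "?c p = Max (?c ` ?S)" by auto
  have "cnt ob cn (adm_words ini ter (Eu u) k) \<le> cnt ob cn (\<Union>p\<in>?S. wset ini ter (Eu u) (fst p) (snd p) k)"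
    using adm_Eu_cover[OF assms, of k] fin finite_wset[OF finite_Eu]
    by (intro cnt_mono) (auto simp: case_prod_beta)
  also have "\<dots> \<le> (\<Sum>p\<in>?S. ?c p)"
    using fin finite_wset[OF finite_Eu] by (intro cnt_UN) auto
  also have "\<dots> \<le> (\<Sum>q\<in>?S. ?c p)"
    unfolding p(2) using fin by (intro sum_mono Max_ge) auto
  also have "\<dots> = (card (scc u))\<^sup>2 * ?c p" by (simp add: card_cartesian_product power2_eq_square)
  also have "\<dots> \<le> (card V)\<^sup>2 * ?c p"
    using card_mono[OF finV scc_sub] by (intro mult_right_mono power_mono) auto
  finally show ?thesis using that p(1) by auto
qed

text \<open>Take a vertex \<open>v\<close> with the fewest reachable vertices. After an outgoing
  edge the reachable set cannot be smaller, so it still contains \<open>v\<close>, and the edge lies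
  on a cycle.\<close>

lemma cyc_exists: "\<exists>u. cyc u"
proof -
  define R where "R v = {v'. reach v v'}" for v
  have RV: "R v \<subseteq> V" if "v \<in> V" for v unfolding R_def using that reach_in_V by blast
  obtain v where v: "v \<in> V" "\<And>x. x \<in> V \<Longrightarrow> card (R v) \<le> card (R x)"
    using arg_min_if_finite(1)[OF finV V_ne, of "\<lambda>v. card (R v)"]
      arg_min_least[OF finV V_ne, of _ "\<lambda>v. card (R v)"] by blast
  obtain e where e: "e \<in> E" "ini e = v" using out v by auto
  have t: "ter e \<in> V" using ends e by auto
  have "R (ter e) \<subseteq> R v" unfolding R_def using reach_edge[OF e(1)] e(2) reach_trans by blast
  then have "R (ter e) = R v"
    using card_seteq[OF finite_subset[OF RV[OF v(1)] finV]] v(2)[OF t] by blast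
  moreover have "v \<in> R v" unfolding R_def by simp
  ultimately have "v \<in> R (ter e)" by simp
  then have "reach (ter e) v" unfolding R_def by simp
  then have "e \<in> Eu v" unfolding Eu_def scc_def using e v t reach_edge[OF e(1)] by auto
  then show ?thesis using v unfolding cyc_def by auto
qed

section \<open>Irreducible components are exactly the classes that carry a cycle\<close>

lemma component_of_cyc:
  assumes "cyc u"
  shows "irreducible_graph ini ter (scc u) (Eu u)" "is_subgraph V E ini ter (scc u) (Eu u)"
proof -
  show "is_subgraph V E ini ter (scc u) (Eu u)"
    unfolding is_subgraph_def using scc_sub Eu_sub by (auto simp: Eu_def)
  have "\<exists>j\<ge>1. adj_pow ini ter (scc u) (Eu u) j v v' > 0" if v: "v \<in> scc u" "v' \<in> scc u" for v v'
  proof -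
    obtain e where e: "e \<in> Eu u" "ini e = v" using cyc_edges(1)[OF assms v(1)] by auto
    then have t: "ter e \<in> scc u" unfolding Eu_def by auto
    obtain w where "pth ini ter E (ter e) w v'" using scc_reach[OF t v(2)] reach_pth by blast
    then have "pth ini ter (Eu u) v (e # w) v'" using e t v pth_scc by auto
    moreover have "\<forall>e\<in>Eu u. ini e \<in> scc u \<and> ter e \<in> scc u" unfolding Eu_def by auto
    ultimately have "adj_pow ini ter (scc u) (Eu u) (length (e # w)) v v' > 0"
      by (subst adj_pow_pos[OF finite_scc finite_Eu]) blast+
    then show ?thesis by (intro exI[of _ "length (e # w)"]) (simp del: adj_pow.simps)
  qed
  then show "irreducible_graph ini ter (scc u) (Eu u)" unfolding irreducible_graph_def by blast
qed

text \<open>Vertices of an irreducible subgraph reach one another, so it lies in a single class.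
  Since its paths can be chosen of positive length, it has an edge, whence
  \<open>cyc u\<close>.\<close>

lemma irreducible_in_scc:
  assumes "irreducible_graph ini ter VH EH" "is_subgraph V E ini ter VH EH" "u \<in> VH"
  shows "VH \<subseteq> scc u" "EH \<subseteq> Eu u" "cyc u"
proof -
  have sub: "VH \<subseteq> V" "EH \<subseteq> E" "\<forall>e\<in>EH. ini e \<in> VH \<and> ter e \<in> VH"
    using assms(2) unfolding is_subgraph_def by auto
  have fin: "finite VH" "finite EH"
    using finite_subset[OF sub(1) finV] finite_subset[OF sub(2) finE] by auto
  have path: "\<exists>w. w \<noteq> [] \<and> pth ini ter EH v w v'" if "v \<in> VH" "v' \<in> VH" for v v'
  proof -
    obtain j where "j \<ge> 1" "adj_pow ini ter VH EH j v v' > 0"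
      using assms(1) \<open>v \<in> VH\<close> \<open>v' \<in> VH\<close> unfolding irreducible_graph_def by blast
    then show ?thesis using adj_pow_pos[OF fin sub(3)] by (metis list.size(3) not_one_le_zero)
  qed
  have reach: "reach v v'" if vv: "v \<in> VH" "v' \<in> VH" for v v'
  proof -
    obtain w where "pth ini ter EH v w v'" using path[OF vv] by auto
    from pth_reach[OF pth_mono[OF this sub(2)]] show ?thesis .
  qed
  show VH: "VH \<subseteq> scc u" unfolding scc_def using reach assms(3) sub by auto
  then show EH: "EH \<subseteq> Eu u" unfolding Eu_def using sub by auto
  obtain w where "w \<noteq> []" "pth ini ter EH u w u" using path assms(3) by blast
  then have "EH \<noteq> {}" using pth_set by fastforce
  then show "cyc u" unfolding cyc_def using EH sub assms(3) by auto
qed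

lemma irr_component_iff:
  "irr_component V E ini ter VH EH \<longleftrightarrow> (\<exists>u. cyc u \<and> VH = scc u \<and> EH = Eu u)"
proof
  assume c: "irr_component V E ini ter VH EH"
  then have 1: "is_subgraph V E ini ter VH EH" "irreducible_graph ini ter VH EH"
    and max: "\<And>VH' EH'. is_subgraph V E ini ter VH' EH' \<Longrightarrow> irreducible_graph ini ter VH' EH' \<Longrightarrow>
      VH \<subseteq> VH' \<Longrightarrow> EH \<subseteq> EH' \<Longrightarrow> VH' = VH \<and> EH' = EH"
    unfolding irr_component_def by blast+
  obtain u0 where u0: "cyc u0" using cyc_exists by auto
  \<comment> \<open>The empty subgraph is vacuously irreducible. It fails to be maximal because
    \<open>cyc_exists\<close> provides a larger irreducible subgraph.\<close>
  have "VH \<noteq> {}"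
  proof
    assume "VH = {}"
    then have "EH = {}" using 1(1) unfolding is_subgraph_def by auto
    then have "scc u0 = VH" using max[OF component_of_cyc(2,1)[OF u0]] \<open>VH = {}\<close> by auto
    then show False using cyc_scc[OF u0] \<open>VH = {}\<close> by auto
  qed
  then obtain u where u: "u \<in> VH" by auto
  note * = irreducible_in_scc[OF 1(2,1) u]
  then show "\<exists>u. cyc u \<and> VH = scc u \<and> EH = Eu u" using max[OF component_of_cyc(2,1)[OF *(3)]] by blast
next
  assume "\<exists>u. cyc u \<and> VH = scc u \<and> EH = Eu u"
  then obtain u where u: "cyc u" "VH = scc u" "EH = Eu u" by auto
  have "VH' = VH \<and> EH' = EH" if sub: "is_subgraph V E ini ter VH' EH'" and irr: "irreducible_graph ini ter VH' EH'"
    and le: "VH \<subseteq> VH'" "EH \<subseteq> EH'" for VH' EH'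
  proof -
    have "u \<in> VH'" using le u cyc_scc by auto
    from irreducible_in_scc[OF irr sub this] le u show ?thesis by auto
  qed
  then show "irr_component V E ini ter VH EH"
    unfolding irr_component_def using component_of_cyc[OF u(1)] u by blast
qed

lemma reaches_iff:
  assumes "cyc u" "cyc u'"
  shows "reaches E ini ter (scc u) (scc u') \<longleftrightarrow> reach u u'"
proof
  assume "reaches E ini ter (scc u) (scc u')"
  then obtain v v' where "v \<in> scc u" "v' \<in> scc u'" "reach v v'"
    unfolding reaches_def reach_def by blast
  then show "reach u u'" using scc_reach assms cyc_scc reach_trans by meson
next
  assume "reach u u'"
  then show "reaches E ini ter (scc u) (scc u')"
    unfolding reaches_def reach_def using assms cyc_scc by blast
qed

section \<open>Exponential upper bounds for paths through several classes\<close>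

lemma path_split:
  assumes "pth ini ter E x w v'" "x \<in> scc v"
  shows "pth ini ter (Eu v) x w v' \<or>
    (\<exists>w1 e w2. w = w1 @ e # w2 \<and> w1 \<in> adm_words ini ter (Eu v) (length w1) \<and> e \<in> E \<and> ini e \<in> scc v
       \<and> ter e \<notin> scc v \<and> pth ini ter E (ter e) w2 v')"
proof -
  have "pth ini ter (Eu v) x w v' \<or>
    (\<exists>w1 e w2. w = w1 @ e # w2 \<and> pth ini ter (Eu v) x w1 (ini e) \<and> e \<in> E \<and> ini e \<in> scc v
       \<and> ter e \<notin> scc v \<and> pth ini ter E (ter e) w2 v')"
    using assms
  proof (induction w arbitrary: x)
    case (Cons e w)
    then have e: "e \<in> E" "ini e = x" "pth ini ter E (ter e) w v'" by auto
    show ?case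
    proof (cases "ter e \<in> scc v")
      case True
      then have eE: "e \<in> Eu v" using e Cons.prems unfolding Eu_def by auto
      from Cons.IH[OF e(3) True] show ?thesis
      proof
        assume "\<exists>w1 e' w2. w = w1 @ e' # w2 \<and> pth ini ter (Eu v) (ter e) w1 (ini e') \<and> e' \<in> E \<and> ini e' \<in> scc v
          \<and> ter e' \<notin> scc v \<and> pth ini ter E (ter e') w2 v'"
        then obtain w1 e' w2 where "w = w1 @ e' # w2" "pth ini ter (Eu v) (ter e) w1 (ini e')" "e' \<in> E"
          "ini e' \<in> scc v" "ter e' \<notin> scc v" "pth ini ter E (ter e') w2 v'" by blast
        then show ?thesis using eE e
          by (intro disjI2 exI[of _ "e # w1"] exI[of _ e'] exI[of _ w2]) auto
      qed (use eE e in auto)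
    next
      case False
      then show ?thesis using e Cons.prems
        by (intro disjI2 exI[of _ "[]"] exI[of _ e] exI[of _ w]) auto
    qed
  qed simp
  then show ?thesis using pth_adm by metis
qed

text \<open>A path is cut at its first exit from the class of \<open>v\<close>, and the induction
  hypothesis is applied to the rest. One half of \<open>\<epsilon>\<close> is spent on the growth
  bounds, the other on the linear number of exit positions.\<close>

lemma cnt_wset_upper:
  assumes "v \<in> V" "\<epsilon> > 0" "\<And>u. u \<in> V \<Longrightarrow> reach v u \<Longrightarrow> reach u v' \<Longrightarrow> grow ini ter ob cn (Eu u) \<le> \<theta>"
  shows "\<exists>C>0. \<forall>k. real (cnt ob cn (wset ini ter E v v' k)) \<le> C * exp (real k * (\<theta> + \<epsilon>))"
  using assms
proof (induction "card {y. reach v y}" arbitrary: v \<epsilon> rule: less_induct)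
  case less
  note vV = less.prems(1) and eps = less.prems(2) and th = less.prems(3)
  show ?case
  proof (cases "reach v v'")
    case False
    then have "wset ini ter E v v' k = {}" for k using pth_reach unfolding wset_def by auto
    then show ?thesis by (intro exI[of _ 1]) simp
  next
    case True
    have th0: "0 \<le> \<theta>" using th[OF vV _ True] grow_nonneg[OF finite_Eu] by (meson order_trans reach_refl)
    obtain C0 where C0: "C0 > 0" "\<And>k. real (cnt ob cn (adm_words ini ter (Eu v) k))
        \<le> C0 * exp (real k * (grow ini ter ob cn (Eu v) + \<epsilon> / 2))"
      using grow_upper[OF finite_Eu, of "\<epsilon> / 2"] eps by (metis half_gt_zero)
    have C0': "real (cnt ob cn (adm_words ini ter (Eu v) k)) \<le> C0 * exp (real k * (\<theta> + \<epsilon> / 2))" for k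
    proof -
      have "grow ini ter ob cn (Eu v) \<le> \<theta>" using th[OF vV _ True] by simp
      then have "C0 * exp (real k * (grow ini ter ob cn (Eu v) + \<epsilon> / 2)) \<le> C0 * exp (real k * (\<theta> + \<epsilon> / 2))"
        using C0(1) by (intro mult_left_mono) (auto intro!: mult_left_mono)
      then show ?thesis using C0(2)[of k] by linarith
    qed
    define X where "X = {e\<in>E. ini e \<in> scc v \<and> ter e \<notin> scc v}"
    have finX: "finite X" unfolding X_def using finE by auto
    have "\<exists>C>0. \<forall>k. real (cnt ob cn (wset ini ter E (ter e) v' k)) \<le> C * exp (real k * (\<theta> + \<epsilon> / 2))"
      if "e \<in> X" for e
    proof (rule less.hyps)
      have e: "e \<in> E" "ini e \<in> scc v" "ter e \<notin> scc v" using that unfolding X_def by auto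
      have r: "reach v (ter e)" using e reach_edge[OF e(1)] scc_reach[OF scc_refl[OF vV] e(2)] reach_trans by blast
      \<comment> \<open>Leaving a class is irreversible: a return to \<open>v\<close> would put
        \<open>ter e\<close> into it. The set of reachable vertices therefore loses
        \<open>v\<close>, and the induction measure drops.\<close>
      have nr: "\<not> reach (ter e) v" using r e ends unfolding scc_def by auto
      show "card {y. reach (ter e) y} < card {y. reach v y}"
      proof (rule psubset_card_mono)
        show "finite {y. reach v y}"
          by (rule finite_subset[OF _ finV]) (use reach_in_V[OF _ vV] in auto)
        show "{y. reach (ter e) y} \<subset> {y. reach v y}" using r nr reach_trans by auto
      qed
      show "ter e \<in> V" using e ends by auto
      show "grow ini ter ob cn (Eu u) \<le> \<theta>" if "u \<in> V" "reach (ter e) u" "reach u v'" for u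
        using th that r reach_trans by blast
    qed (use eps in simp)
    then obtain D where D: "\<And>e. e \<in> X \<Longrightarrow> D e > 0"
      "\<And>e k. e \<in> X \<Longrightarrow> real (cnt ob cn (wset ini ter E (ter e) v' k)) \<le> D e * exp (real k * (\<theta> + \<epsilon> / 2))"
      by metis
    define C1 where "C1 = C0 + C0 * (\<Sum>e\<in>X. D e)"
    have sD: "0 \<le> (\<Sum>e\<in>X. D e)" using D(1) by (intro sum_nonneg) (simp add: less_imp_le)
    have C1: "C1 > 0" "C0 \<le> C1" "C0 * (\<Sum>e\<in>X. D e) \<le> C1" unfolding C1_def using C0(1) sD
      by (auto intro: add_pos_nonneg)
    let ?A = "adm_words ini ter (Eu v)"
    let ?x = "\<lambda>k. exp (real k * (\<theta> + \<epsilon> / 2))"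
    have bound: "real (cnt ob cn (wset ini ter E v v' k)) \<le> C1 * (1 + real k) * ?x k" for k
    proof -
      \<comment> \<open>\<open>a\<close> is the exit position and \<open>e\<close> the exit edge;
        the remaining path has length \<open>k - a - 1\<close>.\<close>
      let ?B = "\<lambda>(a, e). {w1 @ w2 |w1 w2. w1 \<in> ?A a \<and>
         w2 \<in> {[e] @ w3 | w3. w3 \<in> wset ini ter E (ter e) v' (k - a - 1)}}"
      have finB2: "finite {[e] @ w3 | w3. w3 \<in> wset ini ter E (ter e) v' j}" for e j
        using finite_wset[OF finE, of ini ter "ter e" v' j] by simp
      have finB: "finite (?B p)" for p
      proof -
        obtain a e where p: "p = (a, e)" by (cases p)
        have "?B p = (\<lambda>(x,y). x @ y) ` (?A a \<times> {[e] @ w3 | w3. w3 \<in> wset ini ter E (ter e) v' (k - a - 1)})"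
          unfolding p by auto
        then show ?thesis
          by (simp only:) (intro finite_imageI finite_cartesian_product finB2 finite_adm_words[OF finite_Eu])
      qed
      have sub: "wset ini ter E v v' k \<subseteq> ?A k \<union> (\<Union>p\<in>{..<k} \<times> X. ?B p)"
      proof
        fix w assume "w \<in> wset ini ter E v v' k"
        then have w: "length w = k" "pth ini ter E v w v'" by (auto simp: wset_def)
        from path_split[OF w(2) scc_refl[OF vV]] show "w \<in> ?A k \<union> (\<Union>p\<in>{..<k} \<times> X. ?B p)"
        proof
          assume "pth ini ter (Eu v) v w v'"
          then show ?thesis using pth_adm[of ini ter "Eu v" v w v'] w by simp
        next
          assume "\<exists>w1 e w2. w = w1 @ e # w2 \<and> w1 \<in> ?A (length w1) \<and> e \<in> E \<and> ini e \<in> scc v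
            \<and> ter e \<notin> scc v \<and> pth ini ter E (ter e) w2 v'"
          then obtain w1 e w2 where s: "w = w1 @ e # w2" "w1 \<in> ?A (length w1)" "e \<in> X"
            "pth ini ter E (ter e) w2 v'" unfolding X_def by blast
          then have "w2 \<in> wset ini ter E (ter e) v' (k - length w1 - 1)" "length w1 < k"
            using w by (auto simp: wset_def)
          then have "w \<in> ?B (length w1, e)" "(length w1, e) \<in> {..<k} \<times> X" using s by auto
          then show ?thesis by blast
        qed
      qed
      have each: "real (cnt ob cn (?B p)) \<le> C0 * D (snd p) * ?x k" if pin: "p \<in> {..<k} \<times> X" for p
      proof -
        obtain a e where p: "p = (a, e)" "a < k" "e \<in> X" using pin by (cases p) auto
        let ?W = "wset ini ter E (ter e) v' (k - a - 1)"
        let ?W' = "{[e] @ w3 | w3. w3 \<in> ?W}"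
        have 1: "cnt ob cn (?B p) \<le> cnt ob cn (?A a) * cnt ob cn ?W'"
          unfolding p by (rule cnt_append[where k=a]) (use finB2 finite_adm_words[OF finite_Eu] adm_words_length in auto)
        have 2: "cnt ob cn ?W' \<le> cnt ob cn {[e]} * cnt ob cn ?W"
          by (rule cnt_append[where k=1]) (use finite_wset[OF finE] in auto)
        have "cnt ob cn {[e]} \<le> 1" using cnt_le_card[of "{[e]}" ob cn] by simp
        then have 3: "cnt ob cn ?W' \<le> cnt ob cn ?W"
          using order.trans[OF 2 mult_le_mono1] by fastforce
        have "cnt ob cn (?B p) \<le> cnt ob cn (?A a) * cnt ob cn ?W"
          by (rule order.trans[OF 1 mult_le_mono2[OF 3]])
        then have "real (cnt ob cn (?B p)) \<le> real (cnt ob cn (?A a)) * real (cnt ob cn ?W)"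
          unfolding of_nat_mult[symmetric] of_nat_le_iff .
        also have "\<dots> \<le> (C0 * ?x a) * (D e * ?x (k - a - 1))"
          using C0' C0(1) D(2)[OF p(3)] by (intro mult_mono) auto
        also have "\<dots> = C0 * D e * exp (real (a + (k - a - 1)) * (\<theta> + \<epsilon> / 2))"
          by (simp add: exp_add algebra_simps)
        \<comment> \<open>The exit edge contributes one observed word, so only \<open>k - 1\<close>
          letters are charged; the rate \<open>\<theta> + \<epsilon> / 2\<close> is
          nonnegative.\<close>
        also have "\<dots> \<le> C0 * D e * ?x k"
          using C0(1) D(1)[OF p(3)] th0 eps p(2)
          by (intro mult_left_mono) (auto intro!: mult_right_mono)
        finally show ?thesis using p by simp
      qed
      have "cnt ob cn (wset ini ter E v v' k) \<le> cnt ob cn (?A k \<union> (\<Union>p\<in>{..<k} \<times> X. ?B p))"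
        using finB finX finite_adm_words[OF finite_Eu] sub by (intro cnt_mono) auto
      also have "?A k \<union> (\<Union>p\<in>{..<k} \<times> X. ?B p)
          = (\<Union>i\<in>{True, False}. if i then ?A k else (\<Union>p\<in>{..<k} \<times> X. ?B p))" by auto
      also have "cnt ob cn \<dots> \<le> (\<Sum>i\<in>{True, False}. cnt ob cn (if i then ?A k else (\<Union>p\<in>{..<k} \<times> X. ?B p)))"
        using finB finX finite_adm_words[OF finite_Eu] by (intro cnt_UN) auto
      also have "\<dots> = cnt ob cn (?A k) + cnt ob cn (\<Union>p\<in>{..<k} \<times> X. ?B p)" by simp
      also have "cnt ob cn (\<Union>p\<in>{..<k} \<times> X. ?B p) \<le> (\<Sum>p\<in>{..<k} \<times> X. cnt ob cn (?B p))"
        using finB finX by (intro cnt_UN) auto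
      finally have le: "cnt ob cn (wset ini ter E v v' k)
          \<le> cnt ob cn (?A k) + (\<Sum>p\<in>{..<k} \<times> X. cnt ob cn (?B p))" by linarith
      have "real (cnt ob cn (wset ini ter E v v' k))
          \<le> real (cnt ob cn (?A k)) + (\<Sum>p\<in>{..<k} \<times> X. real (cnt ob cn (?B p)))"
        unfolding of_nat_sum[symmetric] of_nat_add[symmetric] by (rule of_nat_mono[OF le])
      also have "\<dots> \<le> C0 * ?x k + (\<Sum>p\<in>{..<k} \<times> X. C0 * D (snd p) * ?x k)"
        using C0' each by (intro add_mono sum_mono) auto
      also have "(\<Sum>p\<in>{..<k} \<times> X. C0 * D (snd p) * ?x k) = (\<Sum>a<k. \<Sum>e\<in>X. C0 * D e * ?x k)"
        unfolding sum.cartesian_product case_prod_beta ..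
      also have "\<dots> = real k * (C0 * (\<Sum>e\<in>X. D e) * ?x k)"
        by (simp add: sum_distrib_left sum_distrib_right)
      also have "C0 * ?x k + real k * (C0 * (\<Sum>e\<in>X. D e) * ?x k) \<le> C1 * ?x k + real k * (C1 * ?x k)"
        using C1 by (intro add_mono mult_left_mono mult_right_mono) auto
      finally show ?thesis by (simp add: algebra_simps)
    qed
    have "real (cnt ob cn (wset ini ter E v v' k)) \<le> C1 * (1 + 1 / (\<epsilon>/2)) * exp (real k * (\<theta> + \<epsilon>))" for k
    proof -
      have "C1 * (1 + real k) * ?x k \<le> C1 * ((1 + 1 / (\<epsilon>/2)) * exp (real k * (\<epsilon>/2))) * ?x k"
        using C1(1) poly_exp_bound[of "\<epsilon>/2" k] eps by (intro mult_right_mono mult_left_mono) auto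
      also have "\<dots> = C1 * (1 + 1 / (\<epsilon>/2)) * exp (real k * (\<theta> + \<epsilon>))"
      proof -
        have "real k * (\<epsilon>/2) + real k * (\<theta> + \<epsilon>/2) = real k * (\<theta> + \<epsilon>)" by (simp add: field_simps)
        then have "exp (real k * (\<epsilon>/2)) * ?x k = exp (real k * (\<theta> + \<epsilon>))" by (simp flip: exp_add)
        then show ?thesis by (simp add: mult.assoc)
      qed
      finally show ?thesis using bound[of k] by linarith
    qed
    moreover have "C1 * (1 + 1 / (\<epsilon>/2)) > 0" using C1(1) eps by (simp add: add_pos_pos)
    ultimately show ?thesis by blast
  qed
qed

text \<open>\<open>u\<close> is a vertex between \<open>v\<close> and \<open>v'\<close> of maximal
  growth. Returning it with both reachability facts is essential: for consecutive pieces of a path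
  the chosen vertices are then ordered by reachability.\<close>

lemma cnt_wset_uniform:
  assumes "\<epsilon> > 0"
  obtains C where "C > 0" "\<And>v v'. v \<in> V \<Longrightarrow> reach v v' \<Longrightarrow>
    \<exists>u\<in>V. reach v u \<and> reach u v' \<and> (\<forall>k. real (cnt ob cn (wset ini ter E v v' k)) \<le> C * exp (real k * (grow ini ter ob cn (Eu u) + \<epsilon>)))"
proof -
  have "\<exists>C u. C > 0 \<and> u \<in> V \<and> reach v u \<and> reach u v' \<and>
      (\<forall>k. real (cnt ob cn (wset ini ter E v v' k)) \<le> C * exp (real k * (grow ini ter ob cn (Eu u) + \<epsilon>)))"
    if v: "v \<in> V" "reach v v'" for v v'
  proof -
    let ?g = "\<lambda>u. grow ini ter ob cn (Eu u)"
    let ?S = "{u\<in>V. reach v u \<and> reach u v'}"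
    have "Max (?g ` ?S) \<in> ?g ` ?S" using finV v reach_refl[of v]
      by (intro Max_in) (simp, force)
    then obtain u where u: "u \<in> ?S" "?g u = Max (?g ` ?S)" by auto
    have "?g x \<le> ?g u" if "x \<in> V" "reach v x" "reach x v'" for x
      unfolding u(2) using that finV by (intro Max_ge) auto
    then have "\<exists>C>0. \<forall>k. real (cnt ob cn (wset ini ter E v v' k)) \<le> C * exp (real k * (?g u + \<epsilon>))"
      by (intro cnt_wset_upper[OF v(1) assms])
    then show ?thesis using u(1) by blast
  qed
  then obtain C u where C: "\<And>v v'. v \<in> V \<Longrightarrow> reach v v' \<Longrightarrow> C v v' > 0 \<and> u v v' \<in> V \<and> reach v (u v v') \<and> reach (u v v') v' \<and>
      (\<forall>k. real (cnt ob cn (wset ini ter E v v' k)) \<le> C v v' * exp (real k * (grow ini ter ob cn (Eu (u v v')) + \<epsilon>)))"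
    by metis
  define M where "M = Max (insert 1 ((\<lambda>(v,v'). C v v') ` (V \<times> V)))"
  have M1: "1 \<le> M" unfolding M_def using finV by (intro Max_ge) auto
  have MC: "C v v' \<le> M" if "v \<in> V" "v' \<in> V" for v v'
    unfolding M_def using that finV by (intro Max_ge) auto
  show ?thesis
  proof (rule that[of M])
    show "M > 0" using M1 by simp
    fix v v' assume v: "v \<in> V" "reach v v'"
    note c = C[OF v]
    have "real (cnt ob cn (wset ini ter E v v' k)) \<le> M * exp (real k * (grow ini ter ob cn (Eu (u v v')) + \<epsilon>))" for k
    proof -
      have "C v v' * exp (real k * (grow ini ter ob cn (Eu (u v v')) + \<epsilon>)) \<le> M * exp (real k * (grow ini ter ob cn (Eu (u v v')) + \<epsilon>))"
        using MC[OF v(1) reach_in_V[OF v(2,1)]] by (intro mult_right_mono) auto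
      then show ?thesis using c by (meson order_trans)
    qed
    then show "\<exists>u\<in>V. reach v u \<and> reach u v' \<and> (\<forall>k. real (cnt ob cn (wset ini ter E v v' k)) \<le> M * exp (real k * (grow ini ter ob cn (Eu u) + \<epsilon>)))"
      using c by blast
  qed
qed

end

section \<open>The largest fibre entropy is a growth rate\<close>

text \<open>Lets the length tend to infinity in a count comparison, which removes the bounded error
  \<open>c\<close>.\<close>

lemma linear_dominated:
  fixes a b c :: real
  assumes "\<And>k::nat. real k * a \<le> real k * b + c"
  shows "a \<le> b"
proof (rule ccontr)
  assume "\<not> a \<le> b"
  then have "a - b > 0" by simp
  then obtain k :: nat where "real k * (a - b) > c" using reals_Archimedean3 by blast
  then show False using assms[of k] by (simp add: algebra_simps)
qed

lemma periodic_inf_word: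
  assumes b: "b \<in> wset ini ter F v v P" and "P > 0"
  shows "(\<lambda>i. b ! (i mod P)) \<in> inf_words ini ter F"
proof -
  have len: "length b = P" using b by (simp add: wset_def)
  \<comment> \<open>Doubling the loop supplies the admissibility condition at the seam between
    consecutive periods.\<close>
  have "b @ b \<in> adm_words ini ter F (P + P)" using subsetD[OF wset_adm wset_append[OF b b]] .
  then have adm: "ter ((b @ b) ! j) = ini ((b @ b) ! Suc j)" if "Suc j < P + P" for j
    using that unfolding adm_words_def by blast
  have "b ! (i mod P) \<in> F" for i
    using b assms(2) len pth_set by (fastforce simp: wset_def)
  moreover have "ter (b ! (i mod P)) = ini (b ! (Suc i mod P))" for i
  proof -
    have "i mod P < P" using assms(2) by simp
    then show ?thesis using adm[of "i mod P"] len by (auto simp: nth_append mod_Suc)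
  qed
  ultimately show ?thesis unfolding inf_words_def by blast
qed

text \<open>Repeating a full fibre, closed up by a fixed return path, yields a periodic digit sequence
  whose fibres grow at least as fast as that fibre.\<close>
lemma periodic_fibre:
  assumes F: "finite F" and p: "p \<in> wset ini ter F v' v j" and pos: "k + j > 0"
    and w0: "w0 \<in> wset ini ter F v v' k" "map dy w0 = ys"
    and M: "M = card (map dx ` {w\<in>wset ini ter F v v' k. map dy w = ys})"
  defines "y \<equiv> \<lambda>i. dy ((w0 @ p) ! (i mod (k + j)))"
  shows "y \<in> piI ini ter dy F"
    and "M ^ t \<le> card (map dx ` {w\<in>adm_words ini ter F (t * (k + j)). map dy w = map y [0..<t * (k + j)]})"
proof -
  let ?P = "k + j" and ?A = "\<lambda>k. adm_words ini ter F k"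
  let ?Fib = "{w\<in>wset ini ter F v v' k. map dy w = ys}"
  have b: "w0 @ p \<in> wset ini ter F v v ?P" using wset_append[OF w0(1) p] .
  show "y \<in> piI ini ter dy F"
    unfolding piI_def y_def using periodic_inf_word[OF b pos] by auto
  have lenb: "length (w0 @ p) = ?P" using b by (simp add: wset_def)
  have block: "map y [t * ?P..<t * ?P + ?P] = map dy (w0 @ p)" for t
  proof (rule nth_equalityI)
    fix i assume "i < length (map y [t * ?P..<t * ?P + ?P])"
    then have i: "i < ?P" by simp
    then have m: "(t * ?P + i) mod ?P = i" by simp
    have "map y [t * ?P..<t * ?P + ?P] ! i = y (t * ?P + i)" using i by simp
    also have "\<dots> = dy ((w0 @ p) ! i)" unfolding y_def m ..
    finally show "map y [t * ?P..<t * ?P + ?P] ! i = map dy (w0 @ p) ! i"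
      using i lenb by (simp only: nth_map)
  qed (use lenb in simp)
  \<comment> \<open>\<open>B\<close> consists of loops of \<open>t\<close> blocks, each an arbitrary
    element of the fibre followed by \<open>p\<close>. All blocks have the same y-word and equal
    length, so the x-choices multiply without collisions.\<close>
  have "\<exists>B. B \<subseteq> wset ini ter F v v (t * ?P) \<and> (\<forall>w\<in>B. map dy w = map y [0..<t * ?P]) \<and> M ^ t \<le> card (map dx ` B)"
  proof (induction t)
    case 0
    show ?case by (intro exI[of _ "{[]}"]) (simp add: wset_def)
  next
    case (Suc t)
    then obtain B where B: "B \<subseteq> wset ini ter F v v (t * ?P)" "\<forall>w\<in>B. map dy w = map y [0..<t * ?P]"
      "M ^ t \<le> card (map dx ` B)" by blast
    let ?B = "(\<lambda>(u, w). u @ (w @ p)) ` (B \<times> ?Fib)"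
    have 1: "?B \<subseteq> wset ini ter F v v (Suc t * ?P)"
    proof clarify
      fix u w assume "u \<in> B" and w: "w \<in> wset ini ter F v v' k"
      then have "u @ (w @ p) \<in> wset ini ter F v v (t * ?P + ?P)"
        using B(1) wset_append[OF _ wset_append[OF w p]] by blast
      then show "u @ w @ p \<in> wset ini ter F v v (Suc t * (k + j))" by (simp add: algebra_simps)
    qed
    have 2: "\<forall>w\<in>?B. map dy w = map y [0..<Suc t * ?P]"
    proof -
      have "[0..<Suc t * ?P] = [0..<t * ?P] @ [t * ?P..<t * ?P + ?P]"
        using upt_add_eq_append[of 0 "t * ?P" ?P] by (simp add: add.commute)
      then show ?thesis using B(2) block[of t] w0(2) by auto
    qed
    let ?g = "\<lambda>(a, c). a @ (c @ map dx p)"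
    have im: "map dx ` ?B = ?g ` (map dx ` B \<times> map dx ` ?Fib)"
      by (force simp: image_iff)
    have inj: "inj_on ?g (map dx ` B \<times> map dx ` ?Fib)"
    proof (rule inj_onI, clarify)
      fix u w u' w'
      assume "u \<in> B" "u' \<in> B" and e: "map dx u @ (map dx w @ map dx p) = map dx u' @ (map dx w' @ map dx p)"
      then have "u \<in> wset ini ter F v v (t * (k + j))" "u' \<in> wset ini ter F v v (t * (k + j))"
        using B(1) by blast+
      then have "length u = length u'" by (simp add: wset_def)
      then show "map dx u = map dx u' \<and> map dx w = map dx w'" using e by simp
    qed
    have "M ^ Suc t \<le> card (map dx ` B) * M" using B(3) by (simp add: mult.commute)
    also have "\<dots> = card (map dx ` ?B)"
      unfolding im card_image[OF inj] card_cartesian_product M ..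
    finally show ?case using 1 2 by blast
  qed
  then obtain B where B: "B \<subseteq> wset ini ter F v v (t * ?P)" "\<forall>w\<in>B. map dy w = map y [0..<t * ?P]"
      "M ^ t \<le> card (map dx ` B)" by blast
  have "card (map dx ` B) \<le> card (map dx ` {w\<in>?A (t * ?P). map dy w = map y [0..<t * ?P]})"
  proof (rule card_mono)
    show "finite (map dx ` {w\<in>?A (t * ?P). map dy w = map y [0..<t * ?P]})"
      by (intro finite_imageI finite_subset[OF _ finite_adm_words[OF F]]) auto
  qed (use B(1,2) wset_adm[of ini ter F v v "t * ?P"] in auto)
  then show "M ^ t \<le> card (map dx ` {w\<in>?A (t * ?P). map dy w = map y [0..<t * ?P]})"
    using B(3) by linarith
qed

lemma cnt_triv_adm:
  "finite F \<Longrightarrow> cnt ob triv (adm_words ini ter F k) = card (map ob ` adm_words ini ter F k)"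
  by (rule cnt_triv[where k=k, OF finite_adm_words]) (auto dest: adm_words_length)

context digraph
begin

lemma wset_Eu: "w \<in> wset ini ter (Eu u) v v' k \<Longrightarrow> w \<in> wset ini ter E v v' k"
  by (rule subsetD[OF wset_mono[OF Eu_sub]])

lemma many_words:
  assumes "cyc u"
  obtains v v' where "v \<in> scc u" "v' \<in> scc u"
    "exp (real k * grow ini ter ob cn (Eu u)) \<le> (real (card V))\<^sup>2 * real (cnt ob cn (wset ini ter (Eu u) v v' k))"
proof -
  obtain v v' where v: "v \<in> scc u" "v' \<in> scc u"
    "cnt ob cn (adm_words ini ter (Eu u) k) \<le> (card V)\<^sup>2 * cnt ob cn (wset ini ter (Eu u) v v' k)"
    by (rule pigeonhole_words[OF cyc_V[OF assms]])
  have "exp (real k * grow ini ter ob cn (Eu u)) \<le> real (cnt ob cn (adm_words ini ter (Eu u) k))"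
    by (rule grow_lower[OF finite_Eu adm_Eu_ne[OF assms]])
  also have "\<dots> \<le> real ((card V)\<^sup>2 * cnt ob cn (wset ini ter (Eu u) v v' k))" by (rule of_nat_mono[OF v(3)])
  finally show ?thesis using that v by simp
qed

lemma cardV_pos: "1 \<le> real (card V)"
  using finV V_ne by (simp add: Suc_le_eq card_gt_0_iff)

text \<open>Each fibre over a prefix of y is bounded by \<open>cnt\<close>, giving one inequality.
  For the other, a maximal fibre of length \<open>k\<close> between fixed vertices is closed by a
  return path of length at most \<open>J\<close> and repeated; the loss \<open>a\<close> from the
  pigeonhole and the period \<open>k + J\<close> are negligible as \<open>k\<close> grows.\<close>

lemma sup_fib_eq_grow:
  fixes dx dy :: "'e \<Rightarrow> nat"
  assumes u: "cyc u"
  shows "sup_fib ini ter dx dy (Eu u) = grow ini ter dx dy (Eu u)"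
proof -
  let ?F = "Eu u"
  let ?A = "\<lambda>k. adm_words ini ter ?F k"
  let ?g = "grow ini ter dx dy ?F"
  let ?N = "\<lambda>yy k. card (map dx ` {w\<in>?A k. map dy w = map yy [0..<k]})"
  let ?q = "\<lambda>yy k. ln (real (?N yy k)) / real k"
  let ?h = "h_top_fib ini ter dx dy ?F"
  have fin: "finite (?A k)" for k by (rule finite_adm_words[OF finite_Eu])
  have h_def: "?h yy = real_of_ereal (limsup (\<lambda>k. ereal (?q yy k)))" for yy
  proof -
    have "{map dx w | w. w \<in> ?A k \<and> map dy w = map yy [0..<k]} = map dx ` {w\<in>?A k. map dy w = map yy [0..<k]}" for k
      by auto
    then show ?thesis unfolding h_top_fib_def by simp
  qed
  have q_le: "?q yy k \<le> ln (real (cnt dx dy (?A k))) / real k" for yy k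
  proof (cases "?N yy k = 0")
    case True
    then show ?thesis using ln_nat_nonneg by simp
  next
    case False
    then show ?thesis using cnt_fibre_le[OF fin[of k], of dx dy "map yy [0..<k]"]
      by (intro divide_right_mono) (auto simp: ln_le_cancel_iff)
  qed
  have lim_le: "limsup (\<lambda>k. ereal (?q yy k)) \<le> ereal ?g" for yy
  proof -
    have "limsup (\<lambda>k. ereal (?q yy k)) \<le> limsup (\<lambda>k. ereal (ln (real (cnt dx dy (?A k))) / real k))"
      using q_le by (intro Limsup_mono) auto
    also have "\<dots> = ereal ?g"
      using grow_lim[OF finite_Eu[of u], of dx dy ini ter] by (intro lim_imp_Limsup) auto
    finally show ?thesis .
  qed
  have lim_ge: "0 \<le> limsup (\<lambda>k. ereal (?q yy k))" for yy
    by (intro le_Limsup) (auto simp: ln_nat_nonneg)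
  \<comment> \<open>The two bounds make the limsup finite, so \<open>real_of_ereal\<close> in the
    definition of the fibre entropy returns its true value.\<close>
  have h_ereal: "ereal (?h yy) = limsup (\<lambda>k. ereal (?q yy k))" for yy
    using lim_le[of yy] lim_ge[of yy] unfolding h_def
    by (cases "limsup (\<lambda>k. ereal (?q yy k))") auto
  have h_le: "?h yy \<le> ?g" for yy using h_ereal[of yy] lim_le[of yy] by (metis ereal_less_eq(3))
  obtain J where J: "\<And>v v'. v \<in> V \<Longrightarrow> reach v v' \<Longrightarrow> \<exists>w. pth ini ter E v w v' \<and> length w \<le> J"
    using short_paths by blast
  define a where "a = ln (real ((card V)\<^sup>2))"
  have a0: "0 \<le> a" unfolding a_def by (rule ln_nat_nonneg)
  have ex: "\<exists>y\<in>piI ini ter dy ?F. real k * ?g - a \<le> ?h y * (real k + real J)" if k: "k > 0" for k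
  proof -
    obtain v v' where v: "v \<in> scc u" "v' \<in> scc u"
      and le: "cnt dx dy (?A k) \<le> (card V)\<^sup>2 * cnt dx dy (wset ini ter ?F v v' k)"
      using pigeonhole_words[OF cyc_V[OF u]] by metis
    let ?W = "wset ini ter ?F v v' k"
    have finW: "finite ?W" by (rule finite_wset[OF finite_Eu])
    have c1: "1 \<le> cnt dx dy (?A k)" by (rule cnt_pos[OF fin adm_Eu_ne[OF u]])
    then have W1: "1 \<le> cnt dx dy ?W" using le by (cases "cnt dx dy ?W") auto
    then have "?W \<noteq> {}" by auto
    from cnt_attained[OF finW this] obtain ys where
      ys: "cnt dx dy ?W = card (map dx ` {w\<in>?W. map dy w = ys})" by blast
    define M where "M = cnt dx dy ?W"
    have "{w\<in>?W. map dy w = ys} \<noteq> {}" using W1 unfolding ys by (metis card.empty image_empty not_one_le_zero)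
    then obtain w0 where w0: "w0 \<in> ?W" "map dy w0 = ys" by auto
    obtain p where p: "pth ini ter E v' p v" "length p \<le> J"
      using J[of v' v] v scc_sub scc_reach by blast
    have p': "p \<in> wset ini ter ?F v' v (length p)" using pth_scc[OF p(1) v(2,1)] by (simp add: wset_def)
    let ?P = "k + length p"
    have P0: "?P > 0" using k by simp
    define y where "y = (\<lambda>i. dy ((w0 @ p) ! (i mod (k + length p))))"
    note per = periodic_fibre[OF finite_Eu p' P0 w0 M_def[unfolded ys], folded y_def]
    have "ln (real M) / real ?P \<le> ?q y (Suc t * ?P)" for t
    proof -
      have "real M ^ Suc t \<le> real (?N y (Suc t * ?P))"
        unfolding of_nat_power[symmetric] of_nat_le_iff by (rule per(2))
      moreover have "0 < real M ^ Suc t" using W1 unfolding M_def by (intro zero_less_power) simp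
      ultimately have "ln (real M ^ Suc t) \<le> ln (real (?N y (Suc t * ?P)))"
        by (intro ln_mono) auto
      then have "real (Suc t) * ln (real M) \<le> ln (real (?N y (Suc t * ?P)))"
        using W1 M_def by (simp only: ln_realpow)
      then have "real (Suc t) * ln (real M) / real (Suc t * ?P) \<le> ?q y (Suc t * ?P)"
        by (intro divide_right_mono) auto
      moreover have "real (Suc t) * ln (real M) / real (Suc t * ?P) = ln (real M) / real ?P"
        unfolding of_nat_mult by (rule mult_divide_mult_cancel_left) simp
      ultimately show ?thesis by linarith
    qed
    \<comment> \<open>Only lengths that are multiples of the period are controlled; for a limsup
      such a subsequence suffices.\<close>
    then have "ereal (ln (real M) / real ?P) \<le> limsup ((\<lambda>k. ereal (?q y k)) \<circ> (\<lambda>t. Suc t * ?P))"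
      by (intro le_Limsup) auto
    also have "\<dots> \<le> limsup (\<lambda>k. ereal (?q y k))"
      using P0 by (intro limsup_subseq_mono) (auto simp: strict_mono_def)
    finally have hM: "ln (real M) / real ?P \<le> ?h y" unfolding h_ereal[symmetric] by simp
    have "real k * ?g \<le> ln (real (cnt dx dy (?A k)))" by (rule grow_le[OF finite_Eu])
    also have "\<dots> \<le> ln (real ((card V)\<^sup>2) * real M)"
      using c1 le M_def by (subst ln_le_cancel_iff) (auto simp flip: of_nat_mult of_nat_power intro: gr0I)
    also have "\<dots> = a + ln (real M)" unfolding a_def using W1 M_def finV V_ne by (simp add: ln_mult card_gt_0_iff)
    finally have "real k * ?g - a \<le> ln (real M)" by simp
    also have "\<dots> \<le> ?h y * real ?P" using hM P0 by (simp add: field_simps)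
    also have "\<dots> \<le> ?h y * (real k + real J)"
    proof (rule mult_left_mono)
      have "0 \<le> ln (real M) / real ?P" using ln_nat_nonneg by simp
      then show "0 \<le> ?h y" using hM by linarith
    qed (use p in simp)
    finally show ?thesis using per(1) by blast
  qed
  have ne: "piI ini ter dy ?F \<noteq> {}" using ex[of 1] by auto
  have bdd: "bdd_above (?h ` piI ini ter dy ?F)" using h_le by (intro bdd_aboveI[of _ ?g]) auto
  show ?thesis
  proof (rule antisym)
    show "sup_fib ini ter dx dy ?F \<le> ?g"
      unfolding sup_fib_def using ne h_le by (intro cSup_least) auto
    let ?S = "sup_fib ini ter dx dy ?F"
    \<comment> \<open>The error \<open>a + real J * \<bar>?S\<bar>\<close> is independent of
      \<open>k\<close>, as \<open>linear_dominated\<close> requires.\<close>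
    have "real k * ?g \<le> real k * ?S + (a + real J * \<bar>?S\<bar>)" for k
    proof (cases "k = 0")
      case False
      then obtain y where y: "y \<in> piI ini ter dy ?F" "real k * ?g - a \<le> ?h y * (real k + real J)"
        using ex by blast
      have "?h y \<le> ?S" unfolding sup_fib_def using y(1) bdd by (intro cSup_upper) auto
      then have "?h y * (real k + real J) \<le> ?S * (real k + real J)" by (intro mult_right_mono) auto
      moreover have "?S * real J \<le> \<bar>?S\<bar> * real J" by (intro mult_right_mono) auto
      ultimately show ?thesis using y(2) by (simp add: algebra_simps)
    qed (use a0 in simp)
    then show "?g \<le> ?S" by (rule linear_dominated)
  qed
qed

lemma h_top_eq_grow:
  "h_top_I ini ter dx dy F = grow ini ter (\<lambda>e. (dx e, dy e)) triv F" if "finite F" for F :: "'e set"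
  unfolding h_top_I_def grow_def cnt_triv_adm[OF that] ..

lemma h_top_pi_eq_grow:
  "h_top_piI ini ter dy F = grow ini ter dy triv F" if "finite F" for F :: "'e set"
  unfolding h_top_piI_def grow_def cnt_triv_adm[OF that] ..

end

section \<open>Geometry of the carpet\<close>

text \<open>The most significant digit comes first, so \<open>num n\<close> of \<open>k\<close>
  digits divided by \<open>n ^ k\<close> is the left end of their n-adic interval.\<close>

fun num :: "nat \<Rightarrow> nat list \<Rightarrow> nat" where
  "num b [] = 0"
| "num b (d # ds) = d * b ^ length ds + num b ds"

lemma num_lt: "\<forall>d\<in>set ds. d < b \<Longrightarrow> num b ds < b ^ length ds"
proof (induction ds)
  case (Cons d ds)
  then have "num b ds < b ^ length ds" "Suc d \<le> b" by auto
  then have "num b (d # ds) < Suc d * b ^ length ds" by simp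
  also have "\<dots> \<le> b * b ^ length ds" using \<open>Suc d \<le> b\<close> by (rule mult_le_mono1)
  finally show ?case by simp
qed simp

lemma num_inj:
  assumes "length ds = length es" "\<forall>d\<in>set ds. d < b" "\<forall>d\<in>set es. d < b" "num b ds = num b es"
  shows "ds = es"
  using assms
proof (induction ds es rule: list_induct2)
  case (Cons d ds e es)
  let ?B = "b ^ length ds"
  have lt: "num b ds < ?B" "num b es < ?B" using Cons.prems num_lt[of ds b] num_lt[of es b] Cons.hyps by auto
  have eq: "d * ?B + num b ds = e * ?B + num b es" using Cons.prems Cons.hyps by simp
  then have "(d * ?B + num b ds) div ?B = (e * ?B + num b es) div ?B" by simp
  then have "d = e" using lt by (metis add_cancel_right_right div_less div_mult_self3 not_less_zero)
  then show ?case using Cons eq by simp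
qed simp

text \<open>Apply the invariance at an extremal point. If \<open>f\<close> is maximal at
  \<open>x\<close>, then \<open>f x * b \<le> f x + (b - 1)\<close>, whence
  \<open>f x \<le> 1\<close>; the minimum gives the bound from below in the same way.\<close>

lemma attractor_coordinate_bounds:
  fixes f :: "'a::metric_space \<Rightarrow> real"
  assumes "compact K" "continuous_on K f" "2 \<le> b"
    and step: "\<And>z. z \<in> K \<Longrightarrow> \<exists>z'\<in>K. \<exists>d<b. f z = (f z' + real d) / real b"
    and "z \<in> K"
  shows "0 \<le> f z" "f z \<le> 1"
proof -
  have ne: "K \<noteq> {}" using assms(5) by auto
  obtain x where x: "x \<in> K" "\<forall>y\<in>K. f y \<le> f x"
    using continuous_attains_sup[OF assms(1) ne assms(2)] by blast
  obtain x' d where "x' \<in> K" "d < b" "f x = (f x' + real d) / real b" using step[OF x(1)] by blast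
  then have "f x * real b \<le> f x + (real b - 1)" using x(2) assms(3) by (auto simp: field_simps)
  then have "(f x - 1) * (real b - 1) \<le> 0" by (simp add: algebra_simps)
  then have "f x \<le> 1" using assms(3) by (auto simp: mult_le_0_iff)
  then show "f z \<le> 1" using x(2) assms(5) by force
  obtain x where x: "x \<in> K" "\<forall>y\<in>K. f x \<le> f y"
    using continuous_attains_inf[OF assms(1) ne assms(2)] by blast
  obtain x' d where "x' \<in> K" "d < b" "f x = (f x' + real d) / real b" using step[OF x(1)] by blast
  then have "f x * real b \<ge> f x" using x(2) assms(3) by (auto simp: field_simps add_increasing2)
  then have "f x * (real b - 1) \<ge> 0" by (simp add: algebra_simps)
  then have "f x \<ge> 0" using assms(3) by (auto simp: zero_le_mult_iff)
  then show "0 \<le> f z" using x(2) assms(5) by force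
qed

text \<open>The \<open>LEAST\<close> in \<open>cover_num\<close> is attained only if some finite
  cover exists; the given family is the witness for both conclusions.\<close>

lemma cover_num_cover:
  fixes U :: "'i \<Rightarrow> 'a::metric_space set"
  assumes "finite I" "A \<subseteq> (\<Union>i\<in>I. U i)" "\<And>i. i \<in> I \<Longrightarrow> bounded (U i) \<and> diameter (U i) \<le> \<delta>"
  shows "cover_num \<delta> A \<le> card I"
    and "\<exists>W :: nat \<Rightarrow> 'a set. A \<subseteq> (\<Union>j<cover_num \<delta> A. W j) \<and>
      (\<forall>j<cover_num \<delta> A. bounded (W j) \<and> diameter (W j) \<le> \<delta>)"
proof -
  obtain g where g: "bij_betw g {..<card I} I"
    using ex_bij_betw_nat_finite[OF assms(1)] by (auto simp: atLeast0LessThan)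
  have *: "\<exists>U :: nat \<Rightarrow> 'a set. A \<subseteq> (\<Union>j<card I. U j) \<and> (\<forall>j<card I. bounded (U j) \<and> diameter (U j) \<le> \<delta>)"
  proof (intro exI[of _ "\<lambda>j. U (g j)"] conjI allI impI)
    show "A \<subseteq> (\<Union>j<card I. U (g j))"
      using assms(2) g unfolding bij_betw_def by (metis image_image)
  qed (use assms(3) bij_betwE[OF g] in auto)
  show "cover_num \<delta> A \<le> card I" unfolding cover_num_def by (rule Least_le) (rule *)
  show "\<exists>W :: nat \<Rightarrow> 'a set. A \<subseteq> (\<Union>j<cover_num \<delta> A. W j) \<and>
      (\<forall>j<cover_num \<delta> A. bounded (W j) \<and> diameter (W j) \<le> \<delta>)"
    unfolding cover_num_def by (rule LeastI) (rule *)
qed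

locale carpet = digraph V E ini ter
  for V :: "'v set" and E :: "'e set" and ini ter :: "'e \<Rightarrow> 'v" +
  fixes n m :: nat and dx dy :: "'e \<Rightarrow> nat" and X :: "'v \<Rightarrow> (real \<times> real) set"
  assumes m2: "2 \<le> m" and mn: "m < n"
    and digits: "\<forall>e\<in>E. dx e < n \<and> dy e < m"
    and Xcpt: "\<forall>v\<in>V. X v \<noteq> {} \<and> compact (X v)"
    and Xeq: "\<forall>v\<in>V. X v = (\<Union>e\<in>{e\<in>E. ini e = v}. psi n m (dx e) (dy e) ` X (ter e))"
begin

definition XX :: "(real \<times> real) set" where "XX = (\<Union>v\<in>V. X v)"

fun psiw :: "'e list \<Rightarrow> real \<times> real \<Rightarrow> real \<times> real" where
  "psiw [] z = z"
| "psiw (e # w) z = psi n m (dx e) (dy e) (psiw w z)"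

text \<open>The closed rectangle of width \<open>n ^ - k\<close> and height \<open>m ^ - L\<close>
  with the coded corner, multiplied out to avoid division. It is an approximate square when
  \<open>n ^ k\<close> and \<open>m ^ L\<close> are comparable.\<close>

definition cell :: "nat \<Rightarrow> nat \<Rightarrow> nat list \<times> nat list \<Rightarrow> (real \<times> real) set" where
  "cell k L c = {z. real (num n (fst c)) \<le> fst z * real n ^ k \<and> fst z * real n ^ k \<le> real (num n (fst c)) + 1
     \<and> real (num m (snd c)) \<le> snd z * real m ^ L \<and> snd z * real m ^ L \<le> real (num m (snd c)) + 1}"

definition code :: "nat \<Rightarrow> nat \<Rightarrow> 'e list \<Rightarrow> nat list \<times> nat list" where
  "code k L w = (map dx (take k w), map dy (take L w))"

lemma npos: "real n > 0" "real m > 0" "n > 1" "m > 1" using m2 mn by auto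

lemma psiw_append: "psiw (u @ w) z = psiw u (psiw w z)" by (induction u) auto

lemma psiw_coords:
  "fst (psiw w z) * real n ^ length w = real (num n (map dx w)) + fst z"
  "snd (psiw w z) * real m ^ length w = real (num m (map dy w)) + snd z"
proof (induction w)
  case (Cons e w)
  {
    case 1
    have "fst (psiw (e # w) z) = (fst (psiw w z) + real (dx e)) / real n"
      by (simp add: psi_def case_prod_beta)
    then have "fst (psiw (e # w) z) * real n ^ length (e # w) = (fst (psiw w z) + real (dx e)) * real n ^ length w"
      using npos by simp
    also have "\<dots> = real (num n (map dx w)) + fst z + real (dx e) * real n ^ length w"
      using Cons.IH(1) by (simp add: algebra_simps)
    finally show ?case by simp
  next
    case 2
    have "snd (psiw (e # w) z) = (snd (psiw w z) + real (dy e)) / real m"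
      by (simp add: psi_def case_prod_beta)
    then have "snd (psiw (e # w) z) * real m ^ length (e # w) = (snd (psiw w z) + real (dy e)) * real m ^ length w"
      using npos by simp
    also have "\<dots> = real (num m (map dy w)) + snd z + real (dy e) * real m ^ length w"
      using Cons.IH(2) by (simp add: algebra_simps)
    finally show ?case by simp
  }
qed simp_all

lemma psiw_in_X: "pth ini ter E v w v' \<Longrightarrow> v \<in> V \<Longrightarrow> z \<in> X v' \<Longrightarrow> psiw w z \<in> X v"
proof (induction w arbitrary: v)
  case (Cons e w)
  then have e: "e \<in> E" "ini e = v" "pth ini ter E (ter e) w v'" by auto
  then have "psiw w z \<in> X (ter e)" using Cons ends by auto
  then have "psi n m (dx e) (dy e) (psiw w z) \<in> (\<Union>e\<in>{e\<in>E. ini e = v}. psi n m (dx e) (dy e) ` X (ter e))"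
    using e by blast
  then show ?case using Xeq Cons.prems(2) by simp
qed simp

lemma X_word: "z \<in> X v \<Longrightarrow> v \<in> V \<Longrightarrow> \<exists>w v' z'. v' \<in> V \<and> w \<in> wset ini ter E v v' k \<and> z' \<in> X v' \<and> z = psiw w z'"
proof (induction k arbitrary: z v)
  case 0
  then show ?case by (intro exI[of _ "[]"] exI[of _ v] exI[of _ z]) (simp add: wset_def)
next
  case (Suc k)
  then have "z \<in> (\<Union>e\<in>{e\<in>E. ini e = v}. psi n m (dx e) (dy e) ` X (ter e))" using Xeq by auto
  then obtain e z1 where e: "e \<in> E" "ini e = v" "z1 \<in> X (ter e)" "z = psi n m (dx e) (dy e) z1" by auto
  then obtain w v' z' where "v' \<in> V" "w \<in> wset ini ter E (ter e) v' k" "z' \<in> X v'" "z1 = psiw w z'"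
    using Suc.IH[of z1 "ter e"] ends by blast
  then show ?case using e by (intro exI[of _ "e # w"] exI[of _ v'] exI[of _ z']) (simp add: wset_def)
qed

lemma compact_XX: "compact XX" unfolding XX_def using finV Xcpt by (intro compact_UN) auto

lemma XX_step:
  assumes "z \<in> XX"
  shows "\<exists>z'\<in>XX. \<exists>e\<in>E. z = psi n m (dx e) (dy e) z'"
proof -
  obtain v where v: "v \<in> V" "z \<in> X v" using assms unfolding XX_def by auto
  then have "z \<in> (\<Union>e\<in>{e\<in>E. ini e = v}. psi n m (dx e) (dy e) ` X (ter e))" using Xeq by auto
  then obtain e z' where "e \<in> E" "z' \<in> X (ter e)" "z = psi n m (dx e) (dy e) z'" by auto
  then show ?thesis unfolding XX_def using ends by auto
qed

lemma XX_unit: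
  assumes "z \<in> XX"
  shows "0 \<le> fst z" "fst z \<le> 1" "0 \<le> snd z" "snd z \<le> 1"
proof -
  have 1: "\<exists>z'\<in>XX. \<exists>d<n. fst z = (fst z' + real d) / real n" if "z \<in> XX" for z
  proof -
    obtain z' e where "z' \<in> XX" "e \<in> E" "z = psi n m (dx e) (dy e) z'" using XX_step[OF \<open>z \<in> XX\<close>] by blast
    then show ?thesis using digits
      by (intro bexI[of _ z'] exI[of _ "dx e"]) (auto simp: psi_def case_prod_beta)
  qed
  have 2: "\<exists>z'\<in>XX. \<exists>d<m. snd z = (snd z' + real d) / real m" if "z \<in> XX" for z
  proof -
    obtain z' e where "z' \<in> XX" "e \<in> E" "z = psi n m (dx e) (dy e) z'" using XX_step[OF \<open>z \<in> XX\<close>] by blast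
    then show ?thesis using digits
      by (intro bexI[of _ z'] exI[of _ "dy e"]) (auto simp: psi_def case_prod_beta)
  qed
  have c: "continuous_on XX fst" "continuous_on XX snd" by (auto intro: continuous_intros)
  show "0 \<le> fst z" "fst z \<le> 1" using attractor_coordinate_bounds[OF compact_XX c(1) _ 1 assms] m2 mn by auto
  show "0 \<le> snd z" "snd z \<le> 1" using attractor_coordinate_bounds[OF compact_XX c(2) m2 2 assms] by auto
qed

text \<open>After \<open>j\<close> letters the remaining maps send \<open>z\<close> to a point of
  \<open>XX\<close>, hence of the unit square; so the first \<open>j\<close> digits locate a
  coordinate up to one unit of its grid. The two coordinates may use different prefixes.\<close>

lemma psiw_cell:
  assumes w: "w \<in> wset ini ter E v v' K" and v: "v \<in> V" and z: "z \<in> X v'" and "k \<le> K" "L \<le> K"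
  shows "psiw w z \<in> cell k L (code k L w)"
proof -
  have len: "length w = K" using w by (simp add: wset_def)
  have tail: "psiw (drop j w) z \<in> XX" if "j \<le> K" for j
  proof -
    have "w \<in> wset ini ter E v v' (j + (K - j))" using w that by simp
    then obtain x where x: "take j w \<in> wset ini ter E v x j" "drop j w \<in> wset ini ter E x v' (K - j)"
      by (rule wset_split)
    then have "x \<in> V" using pth_in_V v by (auto simp: wset_def)
    then show ?thesis using psiw_in_X[OF _ _ z] x(2) unfolding XX_def by (auto simp: wset_def)
  qed
  have split: "psiw w z = psiw (take j w) (psiw (drop j w) z)" for j
    using psiw_append[of "take j w" "drop j w" z] by simp
  have "fst (psiw w z) * real n ^ k = real (num n (map dx (take k w))) + fst (psiw (drop k w) z)"
    using psiw_coords(1)[of "take k w" "psiw (drop k w) z"] split[of k] len assms(4) by (simp add: min_absorb2)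
  moreover have "snd (psiw w z) * real m ^ L = real (num m (map dy (take L w))) + snd (psiw (drop L w) z)"
    using psiw_coords(2)[of "take L w" "psiw (drop L w) z"] split[of L] len assms(5) by (simp add: min_absorb2)
  ultimately show ?thesis using XX_unit[OF tail[OF assms(4)]] XX_unit[OF tail[OF assms(5)]]
    unfolding cell_def code_def by auto
qed

lemma XX_cell:
  assumes "z \<in> XX"
  obtains w where "w \<in> adm_words ini ter E K" "\<And>k L. k \<le> K \<Longrightarrow> L \<le> K \<Longrightarrow> z \<in> cell k L (code k L w)"
proof -
  obtain v where v: "v \<in> V" "z \<in> X v" using assms unfolding XX_def by auto
  obtain w v' z' where w: "w \<in> wset ini ter E v v' K" "z' \<in> X v'" "z = psiw w z'"
    using X_word[OF v(2,1)] by blast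
  have "z \<in> cell k L (code k L w)" if "k \<le> K" "L \<le> K" for k L
    using psiw_cell[OF w(1) v(1) w(2) that] w(3) by simp
  moreover have "w \<in> adm_words ini ter E K" using subsetD[OF wset_adm w(1)] .
  ultimately show ?thesis using that by blast
qed

lemma cell_diam:
  assumes "2 \<le> \<delta> * real n ^ k" "2 \<le> \<delta> * real m ^ L"
  shows "bounded (cell k L c) \<and> diameter (cell k L c) \<le> \<delta>"
proof -
  have d: "dist z z' \<le> \<delta>" if "z \<in> cell k L c" "z' \<in> cell k L c" for z z'
  proof -
    have n: "real n ^ k > 0" "real m ^ L > 0" using npos by auto
    have "\<bar>fst z - fst z'\<bar> * real n ^ k = \<bar>fst z * real n ^ k - fst z' * real n ^ k\<bar>"
      using n by (simp add: abs_mult flip: left_diff_distrib)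
    also have "\<dots> \<le> 1" using that unfolding cell_def by auto
    finally have "\<bar>fst z - fst z'\<bar> * real n ^ k \<le> \<delta> / 2 * real n ^ k" using assms by simp
    then have 1: "\<bar>fst z - fst z'\<bar> \<le> \<delta> / 2" using n by simp
    have "\<bar>snd z - snd z'\<bar> * real m ^ L = \<bar>snd z * real m ^ L - snd z' * real m ^ L\<bar>"
      using n by (simp add: abs_mult flip: left_diff_distrib)
    also have "\<dots> \<le> 1" using that unfolding cell_def by auto
    finally have "\<bar>snd z - snd z'\<bar> * real m ^ L \<le> \<delta> / 2 * real m ^ L" using assms by simp
    then have 2: "\<bar>snd z - snd z'\<bar> \<le> \<delta> / 2" using n by simp
    have "dist z z' \<le> dist (fst z) (fst z') + dist (snd z) (snd z')"
      unfolding dist_prod_def by (rule sqrt_sum_squares_le_sum) auto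
    then show ?thesis using 1 2 by (simp add: dist_real_def)
  qed
  have "0 \<le> \<delta>" using assms npos by (smt (verit) mult_nonpos_nonneg zero_le_power)
  then have "diameter (cell k L c) \<le> \<delta>" using d by (intro diameter_le) (auto simp: dist_norm)
  moreover have "bounded (cell k L c)"
  proof (cases "cell k L c = {}")
    case False
    then obtain z where "z \<in> cell k L c" by auto
    then show ?thesis using d unfolding bounded_def by blast
  qed simp
  ultimately show ?thesis by blast
qed

lemma finite_codes: "finite (code k L ` adm_words ini ter E K)"
  by (intro finite_imageI finite_adm_words finE)

lemma code_digits:
  assumes "w \<in> adm_words ini ter E K" "k \<le> K" "L \<le> K"
  shows "length (fst (code k L w)) = k" "\<forall>d\<in>set (fst (code k L w)). d < n"
    "length (snd (code k L w)) = L" "\<forall>d\<in>set (snd (code k L w)). d < m"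
proof -
  have w: "length w = K" "set w \<subseteq> E" using assms(1) unfolding adm_words_def by auto
  show "length (fst (code k L w)) = k" "length (snd (code k L w)) = L"
    using w assms unfolding code_def by auto
  show "\<forall>d\<in>set (fst (code k L w)). d < n" "\<forall>d\<in>set (snd (code k L w)). d < m"
    using w digits set_take_subset[of k w] set_take_subset[of L w] unfolding code_def by auto
qed

text \<open>Distinct codes have distinct integer corners. If two cells meet a set whose extent is at
  most 2 grid units, their corners differ by at most 2 + 1 in each coordinate, leaving 7 times 7
  possibilities.\<close>

lemma few_cells:
  assumes I: "I \<subseteq> code k L ` adm_words ini ter E K" "k \<le> K" "L \<le> K"
    and U: "\<And>z z'. z \<in> U \<Longrightarrow> z' \<in> U \<Longrightarrow> dist z z' * real n ^ k \<le> 2 \<and> dist z z' * real m ^ L \<le> 2"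
    and meet: "\<And>c. c \<in> I \<Longrightarrow> cell k L c \<inter> U \<noteq> {}"
  shows "card I \<le> 49"
proof (cases "I = {}")
  case False
  let ?f = "\<lambda>c. (int (num n (fst c)), int (num m (snd c)))"
  obtain c0 z0 where c0: "c0 \<in> I" "z0 \<in> cell k L c0" "z0 \<in> U" using False meet by blast
  have inj: "inj_on ?f I"
  proof (rule inj_onI)
    fix c c' assume c: "c \<in> I" "c' \<in> I" "?f c = ?f c'"
    then obtain w w' where w: "w \<in> adm_words ini ter E K" "w' \<in> adm_words ini ter E K"
      "c = code k L w" "c' = code k L w'" using I(1) by blast
    note d = code_digits[OF w(1) I(2,3)] code_digits[OF w(2) I(2,3)]
    have "fst c = fst c'" using num_inj[of "fst c" "fst c'" n] d c(3) w(3,4) by simp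
    moreover have "snd c = snd c'" using num_inj[of "snd c" "snd c'" m] d c(3) w(3,4) by simp
    ultimately show "c = c'" by (rule prod_eqI)
  qed
  let ?p = "int (num n (fst c0))" and ?q = "int (num m (snd c0))"
  have "?f ` I \<subseteq> {?p - 3..?p + 3} \<times> {?q - 3..?q + 3}"
  proof (rule image_subsetI)
    fix c assume c: "c \<in> I"
    then obtain z where z: "z \<in> cell k L c" "z \<in> U" using meet by blast
    have n: "real n ^ k > 0" "real m ^ L > 0" using npos by auto
    have "\<bar>fst z * real n ^ k - fst z0 * real n ^ k\<bar> = dist (fst z) (fst z0) * real n ^ k"
      using n by (simp add: abs_mult dist_real_def flip: left_diff_distrib)
    also have "\<dots> \<le> dist z z0 * real n ^ k" using n by (intro mult_right_mono dist_fst_le) auto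
    finally have 1: "\<bar>fst z * real n ^ k - fst z0 * real n ^ k\<bar> \<le> 2" using U[OF z(2) c0(3)] by linarith
    have "\<bar>snd z * real m ^ L - snd z0 * real m ^ L\<bar> = dist (snd z) (snd z0) * real m ^ L"
      using n by (simp add: abs_mult dist_real_def flip: left_diff_distrib)
    also have "\<dots> \<le> dist z z0 * real m ^ L" using n by (intro mult_right_mono dist_snd_le) auto
    finally have 2: "\<bar>snd z * real m ^ L - snd z0 * real m ^ L\<bar> \<le> 2" using U[OF z(2) c0(3)] by linarith
    have "real (num n (fst c)) \<le> real (num n (fst c0)) + 3" "real (num n (fst c0)) \<le> real (num n (fst c)) + 3"
      "real (num m (snd c)) \<le> real (num m (snd c0)) + 3" "real (num m (snd c0)) \<le> real (num m (snd c)) + 3"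
      using 1 2 z(1) c0(2) unfolding cell_def by auto
    then show "?f c \<in> {?p - 3..?p + 3} \<times> {?q - 3..?q + 3}" by auto
  qed
  then have "card (?f ` I) \<le> card ({?p - 3..?p + 3} \<times> {?q - 3..?q + 3})" by (intro card_mono) auto
  also have "\<dots> = 49" by (simp add: card_cartesian_product)
  finally show ?thesis using card_image[OF inj] by simp
qed simp

text \<open>Supplies the finite cover that makes the minimum in \<open>cover_num\<close> attained
  for every positive \<open>\<delta>\<close>.\<close>

lemma XX_cover:
  assumes "\<delta> > 0"
  obtains K where "XX \<subseteq> (\<Union>c\<in>code K K ` adm_words ini ter E K. cell K K c)"
    "\<And>c. bounded (cell K K c) \<and> diameter (cell K K c) \<le> \<delta>"
proof -
  obtain K where K: "2 / \<delta> < real m ^ K" using npos real_arch_pow[of "real m" "2 / \<delta>"] by auto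
  have "real m ^ K \<le> real n ^ K" using mn by (intro power_mono) auto
  then have "2 \<le> \<delta> * real n ^ K" "2 \<le> \<delta> * real m ^ K" using K assms
    by (auto simp: field_simps intro: order_trans[OF less_imp_le])
  then have d: "bounded (cell K K c) \<and> diameter (cell K K c) \<le> \<delta>" for c by (intro cell_diam)
  have "XX \<subseteq> (\<Union>c\<in>code K K ` adm_words ini ter E K. cell K K c)"
  proof
    fix z assume "z \<in> XX"
    then obtain w where "w \<in> adm_words ini ter E K" "z \<in> cell K K (code K K w)"
      using XX_cell[of z K] by (metis order_refl)
    then show "z \<in> (\<Union>c\<in>code K K ` adm_words ini ter E K. cell K K c)" by blast
  qed
  then show ?thesis using d that by blast
qed

text \<open>In an optimal cover each set meets at most 49 of the cells by \<open>few_cells\<close>,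
  and every cell of \<open>I\<close> meets \<open>A\<close>.\<close>

lemma cover_num_lower:
  assumes "A \<subseteq> XX" "\<delta> > 0" "\<delta> * real n ^ k \<le> 2" "\<delta> * real m ^ L \<le> 2"
    and I: "I \<subseteq> code k L ` adm_words ini ter E K" "k \<le> K" "L \<le> K"
    and meet: "\<And>c. c \<in> I \<Longrightarrow> cell k L c \<inter> A \<noteq> {}"
  shows "card I \<le> 49 * cover_num \<delta> A"
proof -
  obtain K' where K': "XX \<subseteq> (\<Union>c\<in>code K' K' ` adm_words ini ter E K'. cell K' K' c)"
    "\<And>c. bounded (cell K' K' c) \<and> diameter (cell K' K' c) \<le> \<delta>" using XX_cover[OF assms(2)] by blast
  obtain W where W: "A \<subseteq> (\<Union>j<cover_num \<delta> A. W j)"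
    "\<And>j. j < cover_num \<delta> A \<Longrightarrow> bounded (W j) \<and> diameter (W j) \<le> \<delta>"
    using cover_num_cover(2)[OF finite_codes order_trans[OF assms(1) K'(1)] K'(2)] by blast
  let ?I = "\<lambda>j. {c\<in>I. cell k L c \<inter> W j \<noteq> {}}"
  have "I \<subseteq> (\<Union>j<cover_num \<delta> A. ?I j)" using meet W(1) by blast
  moreover have "finite I" using I(1) finite_codes finite_subset by blast
  ultimately have "card I \<le> card (\<Union>j<cover_num \<delta> A. ?I j)" by (intro card_mono) auto
  also have "\<dots> \<le> (\<Sum>j<cover_num \<delta> A. card (?I j))" by (rule card_UN_le) simp
  also have "\<dots> \<le> (\<Sum>j<cover_num \<delta> A. 49)"
  proof (rule sum_mono)
    fix j assume "j \<in> {..<cover_num \<delta> A}"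
    then have j: "bounded (W j)" "diameter (W j) \<le> \<delta>" using W(2) by auto
    show "card (?I j) \<le> 49"
    proof (rule few_cells[where U = "W j", OF _ I(2,3)])
      fix z z' assume "z \<in> W j" "z' \<in> W j"
      then have d: "dist z z' \<le> \<delta>" using diameter_bounded_bound[OF j(1), of z z'] j(2) by simp
      have "dist z z' * real n ^ k \<le> \<delta> * real n ^ k" "dist z z' * real m ^ L \<le> \<delta> * real m ^ L"
        using d npos by (auto intro!: mult_right_mono)
      then show "dist z z' * real n ^ k \<le> 2 \<and> dist z z' * real m ^ L \<le> 2" using assms(3,4) by linarith
    qed (use I(1) in auto)
  qed
  finally show ?thesis by simp
qed

end

section \<open>Counting approximate squares\<close>

text \<open>Number of base-b digits at logarithmic scale \<open>t\<close>, rounded down for coarse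
  cells (\<open>b ^ lev_lo b t \<le> exp t\<close>) and, in \<open>lev_hi\<close>, up for fine
  ones.\<close>

definition lev_lo :: "nat \<Rightarrow> real \<Rightarrow> nat" where "lev_lo b t = nat \<lfloor>t / ln (real b)\<rfloor>"

definition lev_hi :: "nat \<Rightarrow> real \<Rightarrow> nat" where "lev_hi b t = nat \<lceil>t / ln (real b)\<rceil>"

lemma lev_lo_bounds:
  assumes "2 \<le> b" "0 \<le> t"
  shows "real (lev_lo b t) * ln (real b) \<le> t" "t - ln (real b) \<le> real (lev_lo b t) * ln (real b)"
    "real b ^ lev_lo b t \<le> exp t"
proof -
  have b: "ln (real b) > 0" using assms(1) by simp
  have nn: "0 \<le> t / ln (real b)" using assms b by simp
  have r: "real (lev_lo b t) = of_int \<lfloor>t / ln (real b)\<rfloor>" unfolding lev_lo_def using nn by simp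
  have "real (lev_lo b t) \<le> t / ln (real b)" "t / ln (real b) - 1 \<le> real (lev_lo b t)"
    unfolding r by linarith+
  then show 1: "real (lev_lo b t) * ln (real b) \<le> t" "t - ln (real b) \<le> real (lev_lo b t) * ln (real b)"
    using b by (simp_all add: field_simps)
  have "real b ^ lev_lo b t = exp (real (lev_lo b t) * ln (real b))"
    using assms(1) by (simp add: exp_of_nat_mult)
  then show "real b ^ lev_lo b t \<le> exp t" using 1(1) by simp
qed

lemma lev_hi_bounds:
  assumes "2 \<le> b" "0 \<le> t"
  shows "t \<le> real (lev_hi b t) * ln (real b)" "real (lev_hi b t) * ln (real b) \<le> t + ln (real b)"
    "exp t \<le> real b ^ lev_hi b t"
proof -
  have b: "ln (real b) > 0" using assms(1) by simp
  have nn: "0 \<le> t / ln (real b)" using assms b by simp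
  have r: "real (lev_hi b t) = of_int \<lceil>t / ln (real b)\<rceil>" unfolding lev_hi_def using nn by simp
  have "t / ln (real b) \<le> real (lev_hi b t)" "real (lev_hi b t) \<le> t / ln (real b) + 1"
    unfolding r by linarith+
  then show 1: "t \<le> real (lev_hi b t) * ln (real b)" "real (lev_hi b t) * ln (real b) \<le> t + ln (real b)"
    using b by (simp_all add: field_simps)
  have "real b ^ lev_hi b t = exp (real (lev_hi b t) * ln (real b))"
    using assms(1) by (simp add: exp_of_nat_mult)
  then show "exp t \<le> real b ^ lev_hi b t" using 1(1) by simp
qed

lemma lev_mono:
  assumes "2 \<le> b" "b \<le> b'" "0 \<le> t"
  shows "lev_lo b' t \<le> lev_lo b t" "lev_hi b' t \<le> lev_hi b t"
proof -
  have "t / ln (real b') \<le> t / ln (real b)"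
    using assms by (intro divide_left_mono mult_pos_pos) auto
  then show "lev_lo b' t \<le> lev_lo b t" "lev_hi b' t \<le> lev_hi b t"
    unfolding lev_lo_def lev_hi_def using floor_mono ceiling_mono nat_mono by blast+
qed

lemma lev_lo_le_hi:
  assumes "2 \<le> b" "0 \<le> t" "t \<le> t'"
  shows "lev_lo b t \<le> lev_hi b t'"
proof -
  have "t / ln (real b) \<le> t' / ln (real b)" using assms by (intro divide_right_mono) auto
  then have "\<lfloor>t / ln (real b)\<rfloor> \<le> \<lceil>t' / ln (real b)\<rceil>" by linarith
  then show ?thesis unfolding lev_lo_def lev_hi_def by (rule nat_mono)
qed

lemma card_triple_image_le:
  assumes "finite A" "finite B" "finite D"
  shows "card (G ` (A \<times> B \<times> D)) \<le> card A * (card B * card D)"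
proof -
  have "card (G ` (A \<times> B \<times> D)) \<le> card (A \<times> B \<times> D)" using assms by (intro card_image_le) auto
  then show ?thesis by (simp add: card_cartesian_product)
qed

section \<open>Entropies of classes and counts inside a fixed approximate square\<close>

context carpet
begin

abbreviation "cfib \<equiv> cnt dx dy"
abbreviation "cxy \<equiv> cnt (\<lambda>e. (dx e, dy e)) triv"
abbreviation "cy \<equiv> cnt dy triv"
abbreviation "W \<equiv> wset ini ter E"

text \<open>f, h and p stand for the fibre, pair and projected (y) entropies of the class of
  \<open>u\<close>.\<close>

definition fE :: "'v \<Rightarrow> real" where "fE u = grow ini ter dx dy (Eu u)"
definition hE :: "'v \<Rightarrow> real" where "hE u = grow ini ter (\<lambda>e. (dx e, dy e)) triv (Eu u)"
definition pE :: "'v \<Rightarrow> real" where "pE u = grow ini ter dy triv (Eu u)"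

lemma E_nonneg: "0 \<le> fE u" "0 \<le> hE u" "0 \<le> pE u"
  unfolding fE_def hE_def pE_def by (rule grow_nonneg[OF finite_Eu])+

lemma hE_le: "hE u \<le> pE u + fE u"
  unfolding fE_def hE_def pE_def by (rule grow_pair_le[OF finite_Eu])

lemma E_transient: "u \<in> V \<Longrightarrow> \<not> cyc u \<Longrightarrow> fE u = 0 \<and> hE u = 0 \<and> pE u = 0"
  unfolding fE_def hE_def pE_def cyc_def by auto

lemma lnmn: "0 < ln (real m)" "ln (real m) < ln (real n)" "0 < ln (real n)" "1 / ln (real n) < 1 / ln (real m)"
proof -
  show 1: "0 < ln (real m)" "ln (real m) < ln (real n)" using m2 mn by auto
  then show "0 < ln (real n)" by linarith
  show "1 / ln (real n) < 1 / ln (real m)" using 1 by (simp add: frac_less2)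
qed

text \<open>The approximate squares of level (l, M) inside a given approximate square c of level (k, L).\<close>
definition ext :: "nat \<Rightarrow> nat \<Rightarrow> nat \<Rightarrow> nat \<Rightarrow> nat list \<times> nat list \<Rightarrow> (nat list \<times> nat list) set" where
  "ext k L l M c = {code l M w | w. w \<in> adm_words ini ter E M \<and> code k L w = c}"

text \<open>The vertices of a path at four successive cut positions. The letters before the first
  cut contribute only digits already fixed, so their starting vertex is not recorded.\<close>

definition chains :: "('v \<times> 'v \<times> 'v \<times> 'v) set" where
  "chains = {(v0, v1, v2, v3). v0 \<in> V \<and> v1 \<in> V \<and> v2 \<in> V \<and> v3 \<in> V \<and> reach v0 v1 \<and> reach v1 v2 \<and> reach v2 v3}"

lemma finite_chains: "finite chains"
  by (rule finite_subset[of _ "V \<times> V \<times> V \<times> V"]) (use finV in \<open>auto simp: chains_def\<close>)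

lemma finite_W: "finite (W v v' k)" by (rule finite_wset[OF finE])

lemma W_reach: "w \<in> W v v' k \<Longrightarrow> reach v v'" unfolding wset_def using pth_reach by auto

lemma W_in_V: "w \<in> W v v' k \<Longrightarrow> v \<in> V \<Longrightarrow> v' \<in> V" unfolding wset_def using pth_in_V by auto

lemma chain_split:
  assumes "w \<in> adm_words ini ter E M" "k \<le> i" "i \<le> j" "j \<le> M"
  obtains v0 v1 v2 v3 w0 w1 w2 w3 where "(v0, v1, v2, v3) \<in> chains" "w = w0 @ w1 @ w2 @ w3" "length w0 = k"
    "w1 \<in> W v0 v1 (i - k)" "w2 \<in> W v1 v2 (j - i)" "w3 \<in> W v2 v3 (M - j)"
proof -
  have "w \<in> (\<Union>(v,v')\<in>V \<times> V. W v v' M)" using adm_cover[of V E ini ter M] V_ne ends assms(1) by blast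
  then obtain v v3 where v: "v \<in> V" "w \<in> W v v3 M" by auto
  have M: "M = k + ((i - k) + ((j - i) + (M - j)))" using assms by simp
  obtain v0 where 0: "take k w \<in> W v v0 k" "drop k w \<in> W v0 v3 ((i - k) + ((j - i) + (M - j)))"
    using v(2) by (subst (asm) (2) M) (erule wset_split)
  obtain v1 where 1: "take (i - k) (drop k w) \<in> W v0 v1 (i - k)" "drop (i - k) (drop k w) \<in> W v1 v3 ((j - i) + (M - j))"
    using 0(2) by (rule wset_split)
  obtain v2 where 2: "take (j - i) (drop (i - k) (drop k w)) \<in> W v1 v2 (j - i)"
    "drop (j - i) (drop (i - k) (drop k w)) \<in> W v2 v3 (M - j)"
    using 1(2) by (rule wset_split)
  have V: "v0 \<in> V" "v1 \<in> V" "v2 \<in> V" "v3 \<in> V" using W_in_V 0(1) 1(1) 2 v(1) by blast+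
  show ?thesis
  proof (rule that)
    show "(v0, v1, v2, v3) \<in> chains" unfolding chains_def using V W_reach 1(1) 2 by blast
    show "length (take k w) = k" using 0(1) by (simp add: wset_def)
    show "w = take k w @ take (i - k) (drop k w) @ take (j - i) (drop (i - k) (drop k w)) @ drop (j - i) (drop (i - k) (drop k w))"
      by (simp only: append_take_drop_id)
  qed (use 1(1) 2 in auto)
qed

lemma finite_ext: "finite (ext k L l M c)"
  unfolding ext_def by (rule finite_subset[OF _ finite_codes[of l M M]]) auto

text \<open>The positions between l and L carry pairs of digits if \<open>L \<le> l\<close> and nothing new otherwise.\<close>
definition mid :: "nat \<Rightarrow> nat \<Rightarrow> 'e \<Rightarrow> nat \<times> nat" where
  "mid L l e = (if L \<le> l then (dx e, dy e) else (0, 0))"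

text \<open>On positions from \<open>k\<close> to \<open>i\<close> the y-digit is known and the
  x-digit is new, so a fibre is counted. From \<open>i\<close> to \<open>j\<close> either both
  digits are new or neither is asked for. From \<open>j\<close> to \<open>M\<close> only the y-digit
  is new.\<close>

lemma card_ext_le:
  assumes le: "k \<le> L" "k \<le> l" "L \<le> M" "l \<le> M"
  defines "i \<equiv> min l L" and "j \<equiv> max l L"
  shows "card (ext k L l M c)
    \<le> (\<Sum>(v0,v1,v2,v3)\<in>chains. cfib (W v0 v1 (i - k)) * (cnt (mid L l) triv (W v1 v2 (j - i)) * cy (W v2 v3 (M - j))))"
    (is "_ \<le> (\<Sum>(v0,v1,v2,v3)\<in>_. ?S v0 v1 v2 v3)")
proof -
  have ij: "k \<le> i" "i \<le> j" "j \<le> M" unfolding i_def j_def using le by auto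
  \<comment> \<open>Rebuilds the finer code from \<open>c\<close> and the three words of new digits;
    when \<open>l < L\<close> the middle word carries no information and is discarded.\<close>
  let ?G = "\<lambda>(a, b, d). (fst c @ a @ (if L \<le> l then map fst b else []), snd c @ (if L \<le> l then map snd b else []) @ d)"
  let ?A = "\<lambda>v0 v1. map dx ` {w\<in>W v0 v1 (i - k). map dy w = take (i - k) (drop k (snd c))}"
  let ?B = "\<lambda>v1 v2. map (mid L l) ` W v1 v2 (j - i)"
  let ?D = "\<lambda>v2 v3. map dy ` W v2 v3 (M - j)"
  let ?P = "\<lambda>(v0,v1,v2,v3). ?G ` (?A v0 v1 \<times> ?B v1 v2 \<times> ?D v2 v3)"
  have "ext k L l M c \<subseteq> (\<Union>p\<in>chains. ?P p)"
  proof
    fix x assume "x \<in> ext k L l M c"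
    then obtain w where w: "w \<in> adm_words ini ter E M" "code k L w = c" "x = code l M w" unfolding ext_def by auto
    obtain v0 v1 v2 v3 w0 w1 w2 w3 where *: "(v0, v1, v2, v3) \<in> chains" "w = w0 @ w1 @ w2 @ w3" "length w0 = k"
      "w1 \<in> W v0 v1 (i - k)" "w2 \<in> W v1 v2 (j - i)" "w3 \<in> W v2 v3 (M - j)"
      using chain_split[OF w(1) ij] by metis
    have len: "length w1 = i - k" "length w2 = j - i" "length w3 = M - j" using * by (auto simp: wset_def)
    have w': "w = (w0 @ w1) @ (w2 @ w3)" "w = (w0 @ w1 @ w2) @ w3" using *(2) by simp_all
    have "length (w0 @ w1) = i" "length (w0 @ w1 @ w2) = j" using *(3) len(1,2) ij by simp_all
    then have ti: "take i w = w0 @ w1" and tj: "take j w = w0 @ w1 @ w2"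
      using w' by (metis append_eq_conv_conj)+
    have tk: "take k w = w0" using *(2,3) by simp
    have tM: "take M w = w" using adm_words_length[OF w(1)] by simp
    have cx: "fst c = map dx w0" "snd c = map dy (take L w)" "x = (map dx (take l w), map dy w)"
      using w(2,3) tk tM unfolding code_def by auto
    have "map dy w1 = take (i - k) (drop k (snd c)) \<and> x = ?G (map dx w1, map (mid L l) w2, map dy w3)"
    proof (cases "L \<le> l")
      case True
      then have e: "i = L" "j = l" unfolding i_def j_def by auto
      have "snd c = map dy (w0 @ w1)" "x = (map dx (w0 @ w1 @ w2), map dy w)"
        unfolding cx(2,3) ti[unfolded e] tj[unfolded e] by (rule refl)+
      then show ?thesis using cx(1) True *(2,3) len(1) e by (simp add: mid_def o_def)
    next
      case False
      then have e: "i = l" "j = L" unfolding i_def j_def by auto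
      have "snd c = map dy (w0 @ w1 @ w2)" "x = (map dx (w0 @ w1), map dy w)"
        unfolding cx(2,3) ti[unfolded e] tj[unfolded e] by (rule refl)+
      then show ?thesis using cx(1) False *(2,3) len(1) by simp
    qed
    then have "(map dx w1, map (mid L l) w2, map dy w3) \<in> ?A v0 v1 \<times> ?B v1 v2 \<times> ?D v2 v3"
      and "x = ?G (map dx w1, map (mid L l) w2, map dy w3)"
      using *(4-6) by blast+
    then have "x \<in> ?G ` (?A v0 v1 \<times> ?B v1 v2 \<times> ?D v2 v3)" by (rule rev_image_eqI)
    then have "x \<in> ?P (v0, v1, v2, v3)" by (simp only: prod.case)
    then show "x \<in> (\<Union>p\<in>chains. ?P p)" using *(1) by blast
  qed
  moreover have "finite (\<Union>p\<in>chains. ?P p)" using finite_chains finite_W by auto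
  ultimately have "card (ext k L l M c) \<le> card (\<Union>p\<in>chains. ?P p)" by (intro card_mono) auto
  also have "\<dots> \<le> (\<Sum>p\<in>chains. card (?P p))" by (rule card_UN_le[OF finite_chains])
  also have "\<dots> \<le> (\<Sum>(v0,v1,v2,v3)\<in>chains. ?S v0 v1 v2 v3)"
  proof (rule sum_mono, clarify)
    fix v0 v1 v2 v3
    have "card (?G ` (?A v0 v1 \<times> ?B v1 v2 \<times> ?D v2 v3)) \<le> card (?A v0 v1) * (card (?B v1 v2) * card (?D v2 v3))"
      using finite_W by (intro card_triple_image_le) auto
    also have "\<dots> \<le> ?S v0 v1 v2 v3"
    proof (intro mult_le_mono)
      show "card (?A v0 v1) \<le> cfib (W v0 v1 (i - k))" by (rule cnt_fibre_le[OF finite_W])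
      show "card (?B v1 v2) \<le> cnt (mid L l) triv (W v1 v2 (j - i))"
        by (subst cnt_triv[OF finite_W, where k="j - i"]) (auto simp: wset_def)
      show "card (?D v2 v3) \<le> cy (W v2 v3 (M - j))"
        by (subst cnt_triv[OF finite_W, where k="M - j"]) (auto simp: wset_def)
    qed
    finally show "card (?G ` (?A v0 v1 \<times> ?B v1 v2 \<times> ?D v2 v3)) \<le> ?S v0 v1 v2 v3" .
  qed
  finally show ?thesis .
qed

text \<open>\<open>T\<close> dominates segment lengths times entropies over all reachability-ordered
  triples. The truncated difference \<open>l - L\<close> is 0 when \<open>l < L\<close>, matching
  the empty information of \<open>mid\<close>.\<close>

definition exponent_le :: "nat \<Rightarrow> nat \<Rightarrow> nat \<Rightarrow> nat \<Rightarrow> real \<Rightarrow> bool" where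
  "exponent_le k L l M T \<longleftrightarrow> (\<forall>u1\<in>V. \<forall>u2\<in>V. \<forall>u3\<in>V. reach u1 u2 \<longrightarrow> reach u2 u3 \<longrightarrow>
     real (min l L - k) * fE u1 + real (l - L) * hE u2 + real (M - max l L) * pE u3 \<le> T)"

text \<open>The constant is independent of the levels and of the coarse cell \<open>c\<close>. This
  uniformity is what allows the same count to serve balls of every radius.\<close>

lemma card_ext_exp:
  assumes eps: "\<epsilon> > 0"
  obtains C where "C > 0" "\<And>k L l M c T. k \<le> L \<Longrightarrow> k \<le> l \<Longrightarrow> L \<le> M \<Longrightarrow> l \<le> M \<Longrightarrow> exponent_le k L l M T \<Longrightarrow>
      real (card (ext k L l M c)) \<le> C * exp (T + \<epsilon> * (real (l - k) + real (M - L)))"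
proof -
  obtain C1 where C1: "C1 > 0" "\<And>v v'. v \<in> V \<Longrightarrow> reach v v' \<Longrightarrow>
    \<exists>u\<in>V. reach v u \<and> reach u v' \<and> (\<forall>k. real (cfib (W v v' k)) \<le> C1 * exp (real k * (fE u + \<epsilon>)))"
    unfolding fE_def by (rule cnt_wset_uniform[OF eps]) blast
  obtain C2 where C2: "C2 > 0" "\<And>v v'. v \<in> V \<Longrightarrow> reach v v' \<Longrightarrow>
    \<exists>u\<in>V. reach v u \<and> reach u v' \<and> (\<forall>k. real (cxy (W v v' k)) \<le> C2 * exp (real k * (hE u + \<epsilon>)))"
    unfolding hE_def by (rule cnt_wset_uniform[OF eps]) blast
  obtain C3 where C3: "C3 > 0" "\<And>v v'. v \<in> V \<Longrightarrow> reach v v' \<Longrightarrow>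
    \<exists>u\<in>V. reach v u \<and> reach u v' \<and> (\<forall>k. real (cy (W v v' k)) \<le> C3 * exp (real k * (pE u + \<epsilon>)))"
    unfolding pE_def by (rule cnt_wset_uniform[OF eps]) blast
  \<comment> \<open>If \<open>l < L\<close> the middle segment yields at most one word and its
    exponent vanishes, so a constant at least 1 is needed: hence \<open>C2 + 1\<close>.\<close>
  have mid: "\<exists>u\<in>V. reach v u \<and> reach u v' \<and>
      real (cnt (mid L l) triv (W v v' (max l L - min l L))) \<le> (C2 + 1) * exp (real (l - L) * (hE u + \<epsilon>))"
    if v: "v \<in> V" "reach v v'" for v v' L l
  proof (cases "L \<le> l")
    case True
    then have e: "mid L l = (\<lambda>e. (dx e, dy e))" "max l L - min l L = l - L" by (auto simp: mid_def)
    obtain u where u: "u \<in> V" "reach v u" "reach u v'"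
      "real (cxy (W v v' (l - L))) \<le> C2 * exp (real (l - L) * (hE u + \<epsilon>))" using C2(2)[OF v] by blast
    have "C2 * exp (real (l - L) * (hE u + \<epsilon>)) \<le> (C2 + 1) * exp (real (l - L) * (hE u + \<epsilon>))" by simp
    from order_trans[OF u(4) this] show ?thesis unfolding e using u(1-3) by blast
  next
    case False
    let ?W = "W v v' (max l L - min l L)"
    have "map (mid L l) ` ?W \<subseteq> {replicate (max l L - min l L) (0, 0)}"
    proof -
      have "mid L l = (\<lambda>_. (0, 0))" using False by (auto simp: mid_def)
      then show ?thesis by (auto simp: wset_def map_replicate_const)
    qed
    then have "card (map (mid L l) ` ?W) \<le> 1" using card_mono[OF finite.insertI[OF finite.emptyI]] by fastforce
    moreover have "cnt (mid L l) triv ?W = card (map (mid L l) ` ?W)"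
      by (rule cnt_triv[OF finite_W, where k="max l L - min l L"]) (auto simp: wset_def)
    ultimately have "real (cnt (mid L l) triv ?W) \<le> (C2 + 1) * exp (real (l - L) * (hE v + \<epsilon>))"
      using False C2(1) by simp
    then show ?thesis using v reach_refl by blast
  qed
  define N where "N = real (card chains) + 1"
  have C: "N * (C1 * (C2 + 1) * C3) > 0" unfolding N_def using C1(1) C2(1) C3(1) by simp
  have "real (card (ext k L l M c)) \<le> N * (C1 * (C2 + 1) * C3) * exp (T + \<epsilon> * (real (l - k) + real (M - L)))"
    if le: "k \<le> L" "k \<le> l" "L \<le> M" "l \<le> M" and T: "exponent_le k L l M T" for k L l M c T
  proof -
    let ?X = "exp (T + \<epsilon> * (real (l - k) + real (M - L)))"
    define i j where "i = min l L" and "j = max l L"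
    \<comment> \<open>The total number of charged letters is bounded by new x-digits plus new
      y-digits; letters carrying both may be counted twice.\<close>
    have sums: "(i - k) + (l - L) + (M - j) \<le> (l - k) + (M - L)" unfolding i_def j_def using le by auto
    have "real (card (ext k L l M c)) \<le> real (\<Sum>(v0,v1,v2,v3)\<in>chains.
        cfib (W v0 v1 (i - k)) * (cnt (mid L l) triv (W v1 v2 (j - i)) * cy (W v2 v3 (M - j))))"
      unfolding i_def j_def by (rule of_nat_mono[OF card_ext_le[OF le]])
    also have "\<dots> = (\<Sum>(v0,v1,v2,v3)\<in>chains.
        real (cfib (W v0 v1 (i - k))) * (real (cnt (mid L l) triv (W v1 v2 (j - i))) * real (cy (W v2 v3 (M - j)))))"
      by (simp add: case_prod_beta)
    also have "\<dots> \<le> (\<Sum>p\<in>chains. C1 * (C2 + 1) * C3 * ?X)"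
    proof (rule sum_mono, clarify)
      fix v0 v1 v2 v3 assume "(v0, v1, v2, v3) \<in> chains"
      then have v: "v0 \<in> V" "v1 \<in> V" "v2 \<in> V" "v3 \<in> V" "reach v0 v1" "reach v1 v2" "reach v2 v3"
        unfolding chains_def by auto
      obtain u1 where u1: "u1 \<in> V" "reach u1 v1" "real (cfib (W v0 v1 (i - k))) \<le> C1 * exp (real (i - k) * (fE u1 + \<epsilon>))"
        using C1(2)[OF v(1,5)] by blast
      obtain u2 where u2: "u2 \<in> V" "reach v1 u2" "reach u2 v2"
        "real (cnt (mid L l) triv (W v1 v2 (j - i))) \<le> (C2 + 1) * exp (real (l - L) * (hE u2 + \<epsilon>))"
        using mid[OF v(2,6)] unfolding i_def j_def by blast
      obtain u3 where u3: "u3 \<in> V" "reach v2 u3" "real (cy (W v2 v3 (M - j))) \<le> C3 * exp (real (M - j) * (pE u3 + \<epsilon>))"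
        using C3(2)[OF v(3,7)] by blast
      \<comment> \<open>The vertices of the chain separate the three chosen ones: \<open>u1\<close>
        reaches \<open>v1\<close>, \<open>v1\<close> reaches \<open>u2\<close>, \<open>u2\<close>
        reaches \<open>v2\<close>, \<open>v2\<close> reaches \<open>u3\<close>.\<close>
      have r: "reach u1 u2" "reach u2 u3" using u1 u2 u3 reach_trans by blast+
      have T': "real (i - k) * fE u1 + real (l - L) * hE u2 + real (M - j) * pE u3 \<le> T"
        using T u1(1) u2(1) u3(1) r unfolding exponent_le_def i_def j_def by blast
      have "real (cfib (W v0 v1 (i - k))) * (real (cnt (mid L l) triv (W v1 v2 (j - i))) * real (cy (W v2 v3 (M - j))))
        \<le> (C1 * exp (real (i - k) * (fE u1 + \<epsilon>))) * (((C2 + 1) * exp (real (l - L) * (hE u2 + \<epsilon>))) * (C3 * exp (real (M - j) * (pE u3 + \<epsilon>))))"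
        using u1(3) u2(4) u3(3) C1(1) C2(1) C3(1) by (intro mult_mono) auto
      also have "\<dots> = C1 * (C2 + 1) * C3 * exp ((real (i - k) * fE u1 + real (l - L) * hE u2 + real (M - j) * pE u3)
          + \<epsilon> * (real (i - k) + real (l - L) + real (M - j)))"
        by (simp add: exp_add algebra_simps)
      also have "\<dots> \<le> C1 * (C2 + 1) * C3 * ?X"
      proof (rule mult_left_mono)
        have "\<epsilon> * (real (i - k) + real (l - L) + real (M - j)) \<le> \<epsilon> * (real (l - k) + real (M - L))"
          using sums eps unfolding of_nat_add[symmetric] by (intro mult_left_mono of_nat_mono) auto
        then show "exp ((real (i - k) * fE u1 + real (l - L) * hE u2 + real (M - j) * pE u3)
          + \<epsilon> * (real (i - k) + real (l - L) + real (M - j))) \<le> ?X" using T' by simp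
      qed (use C1(1) C2(1) C3(1) in simp)
      finally show "real (cfib (W v0 v1 (i - k))) * (real (cnt (mid L l) triv (W v1 v2 (j - i))) * real (cy (W v2 v3 (M - j))))
        \<le> C1 * (C2 + 1) * C3 * ?X" .
    qed
    also have "\<dots> = real (card chains) * (C1 * (C2 + 1) * C3 * ?X)" by simp
    also have "\<dots> \<le> N * (C1 * (C2 + 1) * C3 * ?X)"
      unfolding N_def using C1(1) C2(1) C3(1) by (intro mult_right_mono) auto
    finally show ?thesis by (simp add: mult.assoc)
  qed
  with C show ?thesis by (rule that)
qed

text \<open>At most 49 coarse cells meet \<open>A\<close>, and each is refined into at most
  \<open>B\<close> cells of diameter at most \<open>r\<close>.\<close>

lemma cover_num_ext:
  assumes A: "A \<subseteq> XX" "\<And>z z'. z \<in> A \<Longrightarrow> z' \<in> A \<Longrightarrow> dist z z' * real n ^ k \<le> 2 \<and> dist z z' * real m ^ L \<le> 2"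
    and r: "2 \<le> r * real n ^ l" "2 \<le> r * real m ^ M"
    and le: "k \<le> L" "k \<le> l" "L \<le> M" "l \<le> M"
    and B: "\<And>c. real (card (ext k L l M c)) \<le> B"
  shows "real (cover_num r A) \<le> 49 * B"
proof -
  define I where "I = {c \<in> code k L ` adm_words ini ter E M. cell k L c \<inter> A \<noteq> {}}"
  have kM: "k \<le> M" using le by simp
  have finI: "finite I" unfolding I_def using finite_codes by simp
  have "card I \<le> 49"
    by (rule few_cells[where U=A and K=M, OF _ kM le(3) A(2)]) (auto simp: I_def)
  have "A \<subseteq> (\<Union>c\<in>(\<Union>c\<in>I. ext k L l M c). cell l M c)"
  proof
    fix z assume z: "z \<in> A"
    obtain w where w: "w \<in> adm_words ini ter E M" "\<And>k L. k \<le> M \<Longrightarrow> L \<le> M \<Longrightarrow> z \<in> cell k L (code k L w)"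
      using XX_cell[of z M] A(1) z by blast
    have "code k L w \<in> I" unfolding I_def using w(1) w(2)[OF kM le(3)] z by blast
    moreover have "code l M w \<in> ext k L l M (code k L w)" unfolding ext_def using w(1) by blast
    moreover have "z \<in> cell l M (code l M w)" using w(2) le by blast
    ultimately show "z \<in> (\<Union>c\<in>(\<Union>c\<in>I. ext k L l M c). cell l M c)" by blast
  qed
  then have "cover_num r A \<le> card (\<Union>c\<in>I. ext k L l M c)"
    using finI finite_ext cell_diam[OF r] by (intro cover_num_cover(1)) auto
  also have "\<dots> \<le> (\<Sum>c\<in>I. card (ext k L l M c))" by (rule card_UN_le[OF finI])
  finally have "real (cover_num r A) \<le> real (\<Sum>c\<in>I. card (ext k L l M c))" by (rule of_nat_mono)
  also have "\<dots> \<le> (\<Sum>c\<in>I. B)" unfolding of_nat_sum by (rule sum_mono) (rule B)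
  also have "\<dots> = real (card I) * B" by simp
  also have "\<dots> \<le> 49 * B"
  proof (rule mult_right_mono)
    show "0 \<le> B" using B[of undefined] of_nat_0_le_iff order_trans by blast
  qed (use \<open>card I \<le> 49\<close> in simp)
  finally show ?thesis .
qed

lemma XX_dist: "z \<in> XX \<Longrightarrow> z' \<in> XX \<Longrightarrow> dist z z' \<le> 2"
proof -
  assume z: "z \<in> XX" "z' \<in> XX"
  have "dist z z' \<le> dist (fst z) (fst z') + dist (snd z) (snd z')"
    unfolding dist_prod_def by (rule sqrt_sum_squares_le_sum) auto
  also have "\<dots> \<le> 1 + 1" using XX_unit[OF z(1)] XX_unit[OF z(2)] by (intro add_mono) (auto simp: dist_real_def)
  finally show ?thesis by simp
qed

section \<open>The Assouad dimension\<close>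

text \<open>With \<open>D = ln (R / r) + c0\<close>, refinement from scale \<open>R\<close> to scale
  \<open>r\<close> adds at most \<open>D / ln n\<close> x-digits and \<open>D / ln m\<close>
  y-digits. In the middle segment \<open>hE_le\<close> splits pair entropy, so one best fibre class
  and one best y-class suffice.\<close>

lemma assouad_upper:
  assumes S: "\<And>u u'. u \<in> V \<Longrightarrow> u' \<in> V \<Longrightarrow> reach u u' \<Longrightarrow> fE u / ln n + pE u' / ln m \<le> S"
    and s: "S < s"
  shows "0 \<le> s \<and> (\<exists>C>0. \<forall>x\<in>XX. \<forall>r R. 0 < r \<and> r < R \<longrightarrow>
       real (cover_num r (cball x R \<inter> XX)) \<le> C * (R / r) powr s)"
proof -
  note ln = lnmn
  obtain v where v: "v \<in> V" using V_ne by auto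
  have S0: "0 \<le> S" using S[OF v v] E_nonneg ln by (smt (verit) divide_nonneg_pos reach_refl)
  define \<kappa> where "\<kappa> = 1 / ln (real n) + 1 / ln (real m)"
  have \<kappa>: "\<kappa> > 0" unfolding \<kappa>_def using ln by (simp add: add_pos_pos)
  \<comment> \<open>At most \<open>D * \<kappa>\<close> letters are charged, so this choice makes
    the resulting exponent \<open>D * (S + \<epsilon> * \<kappa>)\<close> equal to
    \<open>D * s\<close>.\<close>
  define \<epsilon> where "\<epsilon> = (s - S) / \<kappa>"
  have eps: "\<epsilon> > 0" "S + \<epsilon> * \<kappa> = s" unfolding \<epsilon>_def using \<kappa> s by auto
  obtain C where C: "C > 0" "\<And>k L l M c T. k \<le> L \<Longrightarrow> k \<le> l \<Longrightarrow> L \<le> M \<Longrightarrow> l \<le> M \<Longrightarrow> exponent_le k L l M T \<Longrightarrow>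
      real (card (ext k L l M c)) \<le> C * exp (T + \<epsilon> * (real (l - k) + real (M - L)))"
    using card_ext_exp[OF eps(1)] by blast
  \<comment> \<open>\<open>ln 2\<close> comes from using cells of half the size of \<open>r\<close>,
    and \<open>2 * ln n\<close> from rounding at the coarse and the fine level.\<close>
  define c0 where "c0 = ln 2 + 2 * ln (real n)"
  have "real (cover_num r (cball x R \<inter> XX)) \<le> (49 * C * exp (c0 * s)) * (R / r) powr s"
    if x: "x \<in> XX" and rR: "0 < r" "r < R" for x r R
  proof -
    \<comment> \<open>Scales larger than the carpet are cut off: for \<open>R > 1\<close> level 0 is
      used, where \<open>XX_dist\<close> bounds the whole carpet.\<close>
    define t where "t = max 0 (ln (1 / R))"
    define t' where "t' = max 0 (ln (2 / r))"
    define D where "D = ln (R / r) + c0"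
    have R: "R > 0" using rR by simp
    have tt: "0 \<le> t" "t \<le> t'"
      unfolding t_def t'_def using rR R by (auto simp: le_max_iff_disj divide_simps)
    have D0: "0 \<le> ln (R / r)" using rR by simp
    have tD: "t' - t \<le> ln (R / r) + ln 2"
    proof -
      have e: "ln (2 / r) - ln (1 / R) = ln (R / r) + ln 2" using rR R by (simp add: ln_div)
      have "0 \<le> ln (2::real)" by simp
      then have "0 \<le> ln (R / r) + ln 2" using D0 by (rule add_nonneg_nonneg[rotated])
      moreover have "ln (2 / r) - t \<le> ln (R / r) + ln 2" using e unfolding t_def by simp
      ultimately show ?thesis using tt(1) unfolding t'_def by (cases "0 \<le> ln (2 / r)") simp_all
    qed
    let ?k = "lev_lo n t" and ?L = "lev_lo m t" and ?l = "lev_hi n t'" and ?M = "lev_hi m t'"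
    have n2: "2 \<le> n" using m2 mn by simp
    have t'0: "0 \<le> t'" using tt by simp
    have le: "?k \<le> ?L" "?k \<le> ?l" "?L \<le> ?M" "?l \<le> ?M"
      using lev_mono[OF m2 less_imp_le[OF mn]] lev_lo_le_hi m2 n2 tt t'0 by auto
    have lk: "real (?l - ?k) * ln n \<le> D"
    proof -
      have "real (?l - ?k) * ln n = real ?l * ln n - real ?k * ln n" using le by (simp add: of_nat_diff algebra_simps)
      also have "\<dots> \<le> (t' + ln n) - (t - ln n)"
        using lev_hi_bounds(2)[OF n2 t'0] lev_lo_bounds(2)[OF n2 tt(1)] by linarith
      also have "\<dots> \<le> D" unfolding D_def c0_def using tD by simp
      finally show ?thesis .
    qed
    have mL: "real (?M - ?L) * ln m \<le> D"
    proof -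
      have "real (?M - ?L) * ln m = real ?M * ln m - real ?L * ln m" using le by (simp add: of_nat_diff algebra_simps)
      also have "\<dots> \<le> (t' + ln m) - (t - ln m)"
        using lev_hi_bounds(2)[OF m2 t'0] lev_lo_bounds(2)[OF m2 tt(1)] by linarith
      also have "\<dots> \<le> D" unfolding D_def c0_def using tD ln by simp
      finally show ?thesis .
    qed
    have DD: "0 \<le> D" unfolding D_def c0_def using D0 ln by simp
    have lk': "real (?l - ?k) \<le> D / ln n" and mL': "real (?M - ?L) \<le> D / ln m"
      using lk mL ln by (simp_all add: field_simps)
    have "real (min ?l ?L - ?k) * fE u1 + real (?l - ?L) * hE u2 + real (?M - max ?l ?L) * pE u3 \<le> D * S"
      if u: "u1 \<in> V" "u2 \<in> V" "u3 \<in> V" "reach u1 u2" "reach u2 u3" for u1 u2 u3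
    proof -
      define a b d where "a = real (min ?l ?L - ?k)" and "b = real (?l - ?L)" and "d = real (?M - max ?l ?L)"
      have ab: "a + b = real (?l - ?k)" "b + d = real (?M - ?L)" "0 \<le> a" "0 \<le> b" "0 \<le> d"
        unfolding a_def b_def d_def using le by (auto simp: min_def max_def)
      \<comment> \<open>\<open>x\<close> has the larger fibre entropy of the first two classes and
        \<open>y\<close> the larger y-entropy of the last two. Any such choice still satisfies
        \<open>reach x y\<close>, so the hypothesis on pairs applies.\<close>
      obtain x where x: "x \<in> {u1, u2}" "fE u1 \<le> fE x" "fE u2 \<le> fE x"
        by (metis insertCI linorder_le_cases order_refl)
      obtain y where y: "y \<in> {u2, u3}" "pE u2 \<le> pE y" "pE u3 \<le> pE y"
        by (metis insertCI linorder_le_cases order_refl)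
      have xy: "x \<in> V" "y \<in> V" "reach x y" using x(1) y(1) u reach_trans reach_refl by auto
      have "a * fE u1 + b * hE u2 + d * pE u3 \<le> a * fE x + b * (pE y + fE x) + d * pE y"
        using ab x y hE_le[of u2] by (intro add_mono mult_left_mono) auto
      also have "\<dots> = real (?l - ?k) * fE x + real (?M - ?L) * pE y"
        using ab(1,2)[symmetric] by (simp add: algebra_simps)
      also have "\<dots> \<le> D / ln n * fE x + D / ln m * pE y"
        using lk' mL' E_nonneg by (intro add_mono mult_right_mono) auto
      also have "\<dots> = D * (fE x / ln n + pE y / ln m)" by (simp add: field_simps)
      also have "\<dots> \<le> D * S" using S[OF xy] DD by (intro mult_left_mono) auto
      finally show ?thesis unfolding a_def b_def d_def .
    qed
    then have T: "exponent_le ?k ?L ?l ?M (D * S)" unfolding exponent_le_def by blast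
    have B: "real (card (ext ?k ?L ?l ?M c)) \<le> C * exp (D * s)" for c
    proof -
      have "real (card (ext ?k ?L ?l ?M c)) \<le> C * exp (D * S + \<epsilon> * (real (?l - ?k) + real (?M - ?L)))"
        by (rule C(2)[OF le T])
      also have "\<dots> \<le> C * exp (D * s)"
      proof -
        have "\<epsilon> * (real (?l - ?k) + real (?M - ?L)) \<le> \<epsilon> * (D / ln n + D / ln m)"
          using lk' mL' eps(1) by (intro mult_left_mono add_mono) auto
        also have "\<dots> = D * (\<epsilon> * \<kappa>)" unfolding \<kappa>_def by (simp add: field_simps)
        finally have "D * S + \<epsilon> * (real (?l - ?k) + real (?M - ?L)) \<le> D * (S + \<epsilon> * \<kappa>)"
          by (simp add: algebra_simps)
        then show ?thesis using C(1) eps(2) by simp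
      qed
      finally show ?thesis .
    qed
    have fine: "2 \<le> r * real b ^ lev_hi b t'" if "2 \<le> b" for b
    proof -
      have "2 / r = exp (ln (2 / r))" using rR by simp
      also have "\<dots> \<le> exp t'" unfolding t'_def by simp
      also have "\<dots> \<le> real b ^ lev_hi b t'" by (rule lev_hi_bounds(3)[OF that t'0])
      finally show ?thesis using rR by (simp add: field_simps)
    qed
    have coarse: "dist z z' * real b ^ lev_lo b t \<le> 2"
      if b: "2 \<le> b" and z: "z \<in> cball x R \<inter> XX" "z' \<in> cball x R \<inter> XX" for b z z'
    proof (cases "R \<le> 1")
      case True
      then have "t = ln (1 / R)" unfolding t_def using R by (simp add: max_def)
      then have "exp t = 1 / R" using R by simp
      then have 1: "real b ^ lev_lo b t \<le> 1 / R" using lev_lo_bounds(3)[OF b tt(1)] by simp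
      have "dist z z' \<le> 2 * R" using z dist_triangle3[of z z' x] by auto
      then have "dist z z' * real b ^ lev_lo b t \<le> 2 * R * (1 / R)" using 1 R by (intro mult_mono) auto
      then show ?thesis using R by simp
    next
      case False
      then have "ln (1 / R) < 0" using R by (simp add: ln_div)
      then have "t = 0" unfolding t_def by simp
      then have "lev_lo b t = 0" unfolding lev_lo_def by simp
      then show ?thesis using XX_dist z by simp
    qed
    have "real (cover_num r (cball x R \<inter> XX)) \<le> 49 * (C * exp (D * s))"
    proof (rule cover_num_ext[OF _ _ fine[OF n2] fine[OF m2] le B])
      fix z z' assume "z \<in> cball x R \<inter> XX" "z' \<in> cball x R \<inter> XX"
      then show "dist z z' * real n ^ lev_lo n t \<le> 2 \<and> dist z z' * real m ^ lev_lo m t \<le> 2"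
        using coarse n2 m2 by blast
    qed auto
    also have "exp (D * s) = exp (c0 * s) * (R / r) powr s"
      unfolding D_def powr_def using rR R by (simp add: algebra_simps exp_add)
    finally show ?thesis by (simp add: mult.assoc)
  qed
  moreover have "49 * C * exp (c0 * s) > 0" using C(1) by simp
  ultimately show ?thesis using S0 s by (intro conjI) (auto intro!: exI[of _ "49 * C * exp (c0 * s)"])
qed

section \<open>Lower bound for the Assouad dimension\<close>

definition froms :: "'v \<Rightarrow> nat \<Rightarrow> 'e list set" where
  "froms v q = (\<Union>x\<in>V. W v x q)"

lemma finite_from: "finite (froms v q)" unfolding froms_def using finV finite_W by auto

lemma from_length: "w \<in> froms v q \<Longrightarrow> length w = q" unfolding froms_def wset_def by auto

lemma from_ne: "v \<in> V \<Longrightarrow> froms v q \<noteq> {}" using pth_forward unfolding froms_def by blast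

text \<open>Enter the class of \<open>u\<close> within \<open>J\<close> letters, stay there for
  \<open>q - J\<close> letters, and pad so that the total length is exactly \<open>q\<close>. For
  \<open>q < J\<close> the exponent is not positive and the count is at least 1.\<close>

lemma many_from:
  obtains J where "\<And>v u q. v \<in> V \<Longrightarrow> cyc u \<Longrightarrow> reach v u \<Longrightarrow>
    exp ((real q - real J) * pE u) \<le> (real (card V))\<^sup>2 * real (card (map dy ` froms v q))"
proof -
  obtain J where J: "\<And>v v'. v \<in> V \<Longrightarrow> reach v v' \<Longrightarrow> \<exists>w. pth ini ter E v w v' \<and> length w \<le> J"
    using short_paths by blast
  show ?thesis
  proof (rule that)
    fix v u q assume v: "v \<in> V" and u: "cyc u" and r: "reach v u"
    have cy_from: "cy (froms v q) = card (map dy ` froms v q)"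
      by (rule cnt_triv[OF finite_from, where k=q]) (rule from_length)
    have c1: "1 \<le> card (map dy ` froms v q)"
      using from_ne[OF v] finite_from by (simp add: Suc_le_eq card_gt_0_iff)
    show "exp ((real q - real J) * pE u) \<le> (real (card V))\<^sup>2 * real (card (map dy ` froms v q))"
    proof (cases "J \<le> q")
      case False
      then have "(real q - real J) * pE u \<le> 0" using E_nonneg by (simp add: mult_nonpos_nonneg)
      then have "exp ((real q - real J) * pE u) \<le> 1" by simp
      also have "\<dots> \<le> (real (card V))\<^sup>2 * real (card (map dy ` froms v q))"
        using cardV_pos c1 by (intro mult_ge1_I) auto
      finally show ?thesis .
    next
      case True
      obtain x x' where x: "x \<in> scc u" "x' \<in> scc u"
        "exp (real (q - J) * grow ini ter dy triv (Eu u)) \<le> (real (card V))\<^sup>2 * real (cy (wset ini ter (Eu u) x x' (q - J)))"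
        by (rule many_words[OF u])
      have "reach v x" using reach_trans[OF r scc_reach[OF cyc_scc[OF u] x(1)]] .
      then obtain p where p: "pth ini ter E v p x" "length p \<le> J" using J[OF v] by blast
      have x'V: "x' \<in> V" using x scc_sub by blast
      obtain s y where s: "y \<in> V" "s \<in> W x' y (J - length p)" using pth_forward[OF x'V] by blast
      have "(\<lambda>w. p @ w @ s) ` wset ini ter (Eu u) x x' (q - J) \<subseteq> froms v q"
      proof clarify
        fix w assume "w \<in> wset ini ter (Eu u) x x' (q - J)"
        then have "w \<in> W x x' (q - J)" using wset_Eu by blast
        note w = this
        have "p \<in> W v x (length p)" using p by (simp add: wset_def)
        from wset_append[OF this wset_append[OF w s(2)]]
        have "p @ (w @ s) \<in> W v y (length p + ((q - J) + (J - length p)))" .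
        then have "p @ w @ s \<in> W v y q" using True p(2) by simp
        then show "p @ w @ s \<in> froms v q" unfolding froms_def using s(1) by blast
      qed
      from cnt_extend[OF finite_from this] have "cy (wset ini ter (Eu u) x x' (q - J)) \<le> card (map dy ` froms v q)"
        unfolding cy_from[symmetric] .
      then have "(real (card V))\<^sup>2 * real (cy (wset ini ter (Eu u) x x' (q - J))) \<le> (real (card V))\<^sup>2 * real (card (map dy ` froms v q))"
        by (intro mult_left_mono) auto
      then show ?thesis using x(3) True unfolding pE_def by (simp add: of_nat_diff)
    qed
  qed
qed

text \<open>A maximal fibre of length \<open>P\<close> in the class of \<open>u\<close> is put after
  depth \<open>k\<close>, with \<open>k\<close> so large that its y-digits are already fixed by the
  coarse square. Then comes a path into the class of \<open>u'\<close> up to level \<open>L\<close>,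
  then \<open>q\<close> free y-digits there. All these words share one coarse square, and
  \<open>P\<close> tends to infinity.\<close>

lemma assouad_lower:
  assumes u: "cyc u" "cyc u'" "reach u u'"
    and s: "0 \<le> s" "C > 0" "\<forall>x\<in>XX. \<forall>r R. 0 < r \<and> r < R \<longrightarrow>
       real (cover_num r (cball x R \<inter> XX)) \<le> C * (R / r) powr s"
  shows "fE u / ln n + pE u' / ln m \<le> s"
proof -
  note lnp = lnmn
  obtain J where J: "\<And>v v'. v \<in> V \<Longrightarrow> reach v v' \<Longrightarrow> \<exists>w. pth ini ter E v w v' \<and> length w \<le> J"
    using short_paths by blast
  obtain J' where J': "\<And>v u q. v \<in> V \<Longrightarrow> cyc u \<Longrightarrow> reach v u \<Longrightarrow>
    exp ((real q - real J') * pE u) \<le> (real (card V))\<^sup>2 * real (card (map dy ` froms v q))"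
    using many_from by blast
  have n2: "2 \<le> n" using m2 mn by simp
  \<comment> \<open>The logarithm collects two pigeonhole factors, 49 and \<open>C\<close>;
    \<open>s * ln m\<close> comes from \<open>R / r = m * n ^ P\<close>, and
    \<open>(1 + J') * pE u'\<close> from rounding \<open>q\<close> and entering the class of
    \<open>u'\<close>.\<close>
  define c where "c = ln ((real (card V))\<^sup>2 * (real (card V))\<^sup>2 * 49 * C) + s * ln m + (1 + real J') * pE u'"
  have "real P * (fE u + ln n / ln m * pE u') \<le> real P * (s * ln n) + c" for P :: nat
  proof -
    obtain v v' where v: "v \<in> scc u" "v' \<in> scc u"
      and many: "exp (real P * fE u) \<le> (real (card V))\<^sup>2 * real (cfib (wset ini ter (Eu u) v v' P))"
      unfolding fE_def by (rule many_words[OF u(1)])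
    let ?Wf = "wset ini ter (Eu u) v v' P"
    have finf: "finite ?Wf" by (rule finite_wset[OF finite_Eu])
    have "0 < (real (card V))\<^sup>2 * real (cfib ?Wf)" using many by (meson exp_gt_zero less_le_trans)
    then have "?Wf \<noteq> {}" by auto
    from cnt_attained[OF finf this] obtain ys where
      ys: "cfib ?Wf = card (map dx ` {w\<in>?Wf. map dy w = ys})" by blast
    let ?Fib = "{w\<in>?Wf. map dy w = ys}"
    have Fib: "\<And>w. w \<in> ?Fib \<Longrightarrow> w \<in> W v v' P \<and> map dy w = ys" using wset_Eu by blast
    have v'V: "v' \<in> V" using v scc_sub by blast
    have "reach v' u'" using reach_trans[OF scc_reach[OF v(2) cyc_scc[OF u(1)]] u(3)] .
    then obtain p where p: "pth ini ter E v' p u'" "length p \<le> J" using J[OF v'V] by blast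
    have gap: "ln (real n) / ln (real m) - 1 > 0" using lnp by simp
    \<comment> \<open>The coarse square has about \<open>k * ln n / ln m\<close> y-digits, and this
      \<open>k\<close> leaves room among them for the fibre and the connecting path. Here
      \<open>m < n\<close> makes the gap positive.\<close>
    obtain k :: nat where k: "real (P + J) < real k * (ln (real n) / ln (real m) - 1)"
      using reals_Archimedean3[OF gap] by blast
    define L where "L = lev_hi m (real k * ln n)"
    have kln: "0 \<le> real k * ln n" using lnp by simp
    have "real k * ln n \<le> real L * ln m" unfolding L_def by (rule lev_hi_bounds(1)[OF m2 kln])
    then have "real k * (ln n / ln m) \<le> real L" using lnp by (simp add: field_simps)
    then have "real (k + P + J) \<le> real L" using k by (simp add: algebra_simps)
    then have kL: "k + P + J \<le> L" by linarith
    define l where "l = k + P"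
    define q where "q = lev_lo m (real P * ln n)"
    define M where "M = L + q"
    have le: "k \<le> L" "l \<le> L" "L \<le> M" "l \<le> M" "k \<le> M" unfolding l_def M_def using kL by auto
    obtain w0 x where w0: "x \<in> scc u" "w0 \<in> wset ini ter (Eu u) x v k" using cyc_backward[OF u(1) v(1)] by blast
    have w0E: "w0 \<in> W x v k" using w0 wset_Eu by blast
    have xV: "x \<in> V" using w0 scc_sub by blast
    \<comment> \<open>Fills the positions up to \<open>L\<close> exactly, inside the class of
      \<open>u'\<close>, so the end vertex can still produce y-words at rate
      \<open>pE u'\<close>.\<close>
    obtain p' v3 where p': "v3 \<in> scc u'" "p' \<in> wset ini ter (Eu u') u' v3 (L - l - length p)"
      using cyc_forward[OF u(2) cyc_scc[OF u(2)]] by blast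
    have "p @ p' \<in> W v' v3 (length p + (L - l - length p))"
      using p(1) p'(2) wset_Eu by (intro wset_append) (auto simp: wset_def)
    moreover have "length p + (L - l - length p) = L - l" using p(2) kL unfolding l_def by simp
    ultimately have wm: "p @ p' \<in> W v' v3 (L - l)" by simp
    have v3: "v3 \<in> V" "reach v3 u'" using p' scc_sub scc_reach[OF p'(1) cyc_scc[OF u(2)]] by auto
    \<comment> \<open>The first \<open>L\<close> y-digits of every word considered: all fibre
      elements have the y-word \<open>ys\<close>, and everything else before \<open>L\<close> is the
      same.\<close>
    define yfix where "yfix = map dy w0 @ ys @ map dy (p @ p')"
    define I where "I = (\<lambda>(a, b). (map dx w0 @ a, yfix @ b)) ` (map dx ` ?Fib \<times> map dy ` froms v3 q)"
    have cardI: "card I = cfib ?Wf * card (map dy ` froms v3 q)"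
      unfolding I_def ys by (subst card_image) (auto simp: inj_on_def card_cartesian_product)
    have real_I: "\<exists>w. w \<in> adm_words ini ter E M \<and> c = code l M w \<and> code k L w = (map dx w0, yfix)
        \<and> (\<exists>z\<in>XX. z \<in> cell l M c \<inter> cell k L (map dx w0, yfix))" if "c \<in> I" for c
    proof -
      obtain w w3 where w: "w \<in> ?Fib" "w3 \<in> froms v3 q" "c = (map dx w0 @ map dx w, yfix @ map dy w3)"
        using \<open>c \<in> I\<close> unfolding I_def by auto
      obtain y where y: "y \<in> V" "w3 \<in> W v3 y q" using w(2) unfolding froms_def by blast
      let ?w = "w0 @ (w @ ((p @ p') @ w3))"
      have "?w \<in> W x y (k + (P + ((L - l) + q)))"
        by (rule wset_append[OF w0E wset_append[OF conjunct1[OF Fib[OF w(1)]] wset_append[OF wm y(2)]]])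
      then have wW: "?w \<in> W x y M" unfolding M_def l_def using kL by (simp add: algebra_simps)
      have len: "length w0 = k" "length w = P" "length (p @ p') = L - l" "length w3 = q"
        using w0E Fib[OF w(1)] wm y(2) unfolding wset_def by blast+
      have tk: "take k ?w = w0" using len by simp
      have tl: "take l ?w = w0 @ w"
      proof -
        have "?w = (w0 @ w) @ ((p @ p') @ w3)" "length (w0 @ w) = l" using len unfolding l_def by auto
        then show ?thesis by (metis append_eq_conv_conj)
      qed
      have tL: "take L ?w = w0 @ w @ (p @ p')"
      proof -
        have "?w = (w0 @ w @ (p @ p')) @ w3" by simp
        moreover have "length (w0 @ w @ (p @ p')) = L" using len(1-3) le(2) unfolding l_def by simp
        ultimately show ?thesis by (metis append_eq_conv_conj)
      qed
      have "length ?w = M" using wW unfolding wset_def by blast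
      then have tM: "take M ?w = ?w" by (intro take_all) (rule eq_refl)
      have c1: "c = code l M ?w" unfolding code_def tl tM w(3) yfix_def using Fib[OF w(1)] by simp
      have c2: "code k L ?w = (map dx w0, yfix)" unfolding code_def tk tL yfix_def using Fib[OF w(1)] by simp
      obtain z' where z': "z' \<in> X y" using Xcpt y(1) by blast
      have "psiw ?w z' \<in> cell l M (code l M ?w)" by (rule psiw_cell[OF wW xV z' le(4)]) simp
      moreover have "psiw ?w z' \<in> cell k L (code k L ?w)" by (rule psiw_cell[OF wW xV z' le(5) le(3)])
      moreover have "psiw ?w z' \<in> XX" using psiw_in_X[OF _ xV z', of ?w] wW xV unfolding XX_def wset_def by auto
      ultimately show ?thesis using c1 c2 subsetD[OF wset_adm wW] by (intro exI[of _ ?w]) auto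
    qed
    let ?c0 = "(map dx w0, yfix)"
    define R where "R = 2 / real n ^ k"
    \<comment> \<open>The factor \<open>m\<close> pays for rounding in \<open>L\<close>: from
      \<open>m ^ L \<le> m * n ^ k\<close> one gets \<open>m ^ M \<le> m * n ^ l\<close>, so
      \<open>r\<close> is at most twice either side of a fine cell.\<close>
    define r where "r = 2 / (real m * real n ^ l)"
    have npk: "real n ^ k > 0" "real n ^ l > 0" using npos by auto
    have exk: "exp (real k * ln n) = real n ^ k" using npos by (simp add: exp_of_nat_mult)
    have exP: "exp (real P * ln n) = real n ^ P" using npos by (simp add: exp_of_nat_mult)
    have mL: "real n ^ k \<le> real m ^ L"
      using lev_hi_bounds(3)[OF m2 kln] unfolding exk L_def .
    have mL': "real m ^ L \<le> real m * real n ^ k"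
    proof -
      have "real m ^ L = exp (real L * ln m)" using npos by (simp add: exp_of_nat_mult)
      also have "\<dots> \<le> exp (real k * ln n + ln m)"
        using lev_hi_bounds(2)[OF m2 kln] unfolding L_def by simp
      also have "\<dots> = real m * real n ^ k" using npos exk by (simp add: exp_add)
      finally show ?thesis .
    qed
    have mq: "real m ^ q \<le> real n ^ P" unfolding q_def exP[symmetric] using lnp by (intro lev_lo_bounds(3)[OF m2]) simp
    have R0: "bounded (cell k L ?c0) \<and> diameter (cell k L ?c0) \<le> R"
      unfolding R_def using npk mL by (intro cell_diam) (auto simp: field_simps)
    have r0: "0 < r" unfolding r_def using npos npk by simp
    have rR: "r < R"
    proof -
      have "real n ^ k * 1 \<le> real n ^ k * real n ^ P" using npos by (intro mult_left_mono) auto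
      then have "real n ^ k \<le> real n ^ l" unfolding l_def power_add by simp
      also have "\<dots> < real m * real n ^ l" using npos npk by simp
      finally show ?thesis unfolding r_def R_def using npk npos by (intro divide_strict_left_mono) auto
    qed
    have Rr: "R / r = real m * real n ^ P"
      unfolding R_def r_def l_def power_add using npk npos by (simp add: field_simps)
    have "card I > 0"
    proof -
      have "0 < cfib ?Wf" using \<open>0 < (real (card V))\<^sup>2 * real (cfib ?Wf)\<close> by (simp add: zero_less_mult_iff)
      moreover have "0 < card (map dy ` froms v3 q)" using from_ne[OF v3(1)] finite_from by (simp add: card_gt_0_iff)
      ultimately show ?thesis unfolding cardI by simp
    qed
    then obtain c1 where "c1 \<in> I" by (metis card.empty ex_in_conv less_irrefl)
    then obtain z0 where z0: "z0 \<in> XX" "z0 \<in> cell k L ?c0" using real_I by blast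
    have "card I \<le> 49 * cover_num r (cball z0 R \<inter> XX)"
    proof (rule cover_num_lower[where K=M and k=l and L=M, OF _ r0])
      show "r * real n ^ l \<le> 2" unfolding r_def using npk npos by (simp add: field_simps)
      have "real m ^ M \<le> (real m * real n ^ k) * real n ^ P"
        unfolding M_def power_add using mL' mq by (intro mult_mono) auto
      then have "real m ^ M \<le> real m * real n ^ l" unfolding l_def power_add by simp
      then show "r * real m ^ M \<le> 2" unfolding r_def using npk npos by (simp add: field_simps)
      show "I \<subseteq> code l M ` adm_words ini ter E M" using real_I by blast
      show "cell l M c \<inter> (cball z0 R \<inter> XX) \<noteq> {}" if "c \<in> I" for c
      proof -
        obtain z where z: "z \<in> XX" "z \<in> cell l M c" "z \<in> cell k L ?c0" using real_I[OF \<open>c \<in> I\<close>] by blast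
        have "dist z0 z \<le> R" using diameter_bounded_bound[OF conjunct1[OF R0] z0(2) z(3)] R0 by linarith
        then show ?thesis using z by auto
      qed
    qed (use le in auto)
    then have "real (card I) \<le> 49 * real (cover_num r (cball z0 R \<inter> XX))" by linarith
    also have "\<dots> \<le> 49 * (C * (R / r) powr s)" using s(3) z0(1) r0 rR by simp
    also have "(R / r) powr s = exp (s * ln m + s * (real P * ln n))"
      unfolding Rr powr_def using npos by (simp add: ln_mult ln_realpow algebra_simps)
    finally have I_le: "real (card I) \<le> 49 * C * exp (s * ln m + s * (real P * ln n))" by simp
    have "exp (real P * fE u + (real q - real J') * pE u')
        \<le> ((real (card V))\<^sup>2 * real (cfib ?Wf)) * ((real (card V))\<^sup>2 * real (card (map dy ` froms v3 q)))"
      unfolding exp_add using many J'[OF v3(1) u(2) v3(2), of q] by (intro mult_mono) auto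
    also have "\<dots> = (real (card V))\<^sup>2 * (real (card V))\<^sup>2 * real (card I)" unfolding cardI by simp
    also have "\<dots> \<le> (real (card V))\<^sup>2 * (real (card V))\<^sup>2 * (49 * C * exp (s * ln m + s * (real P * ln n)))"
      by (rule mult_left_mono[OF I_le]) simp
    also have "\<dots> = exp (ln ((real (card V))\<^sup>2 * (real (card V))\<^sup>2 * 49 * C) + (s * ln m + s * (real P * ln n)))"
      unfolding exp_add using s(2) cardV_pos by simp
    finally have main: "real P * fE u + (real q - real J') * pE u'
        \<le> ln ((real (card V))\<^sup>2 * (real (card V))\<^sup>2 * 49 * C) + (s * ln m + s * (real P * ln n))"
      by simp
    have "real P * ln n - ln m \<le> real q * ln m"
      unfolding q_def using lnp by (intro lev_lo_bounds(2)[OF m2]) simp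
    then have "real P * (ln n / ln m) - 1 \<le> real q" using lnp by (simp add: field_simps)
    then have "(real P * (ln n / ln m) - 1) * pE u' \<le> real q * pE u'"
      using E_nonneg by (intro mult_right_mono) auto
    then show ?thesis using main unfolding c_def by (simp add: algebra_simps)
  qed
  then have "fE u + ln n / ln m * pE u' \<le> s * ln n" by (rule linear_dominated)
  then have "(fE u + ln n / ln m * pE u') / ln n \<le> s" using lnp by (simp add: field_simps)
  moreover have "(fE u + ln n / ln m * pE u') / ln n = fE u / ln n + pE u' / ln m" using lnp by (simp add: field_simps)
  ultimately show ?thesis by simp
qed

text \<open>A vertex on no cycle contributes 0. It can be replaced by its partner in the pair, or by
  any vertex on a cycle if both are transient, without decreasing the value.\<close>

lemma transient_pairs:
  fixes g :: "'v \<Rightarrow> real" and a b :: real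
  assumes g: "\<And>u. u \<in> V \<Longrightarrow> \<not> cyc u \<Longrightarrow> g u = 0" "\<And>u. 0 \<le> g u" and ab: "0 \<le> a" "0 \<le> b"
    and S: "\<And>u u'. cyc u \<Longrightarrow> cyc u' \<Longrightarrow> reach u u' \<Longrightarrow> g u * a + pE u' * b \<le> S"
    and u: "u \<in> V" "u' \<in> V" "reach u u'"
  shows "g u * a + pE u' * b \<le> S"
proof -
  have nn: "0 \<le> g x * a" "0 \<le> pE x * b" for x using g(2) E_nonneg ab by simp_all
  consider "cyc u" "cyc u'" | "cyc u" "\<not> cyc u'" | "\<not> cyc u" "cyc u'" | "\<not> cyc u" "\<not> cyc u'" by blast
  then show ?thesis
  proof cases
    case 2
    then have "pE u' = 0" using E_transient u by blast
    then show ?thesis using S[OF 2(1) 2(1)] nn(2)[of u] by simp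
  next
    case 3
    then have "g u = 0" using g(1) u by blast
    then show ?thesis using S[OF 3(2) 3(2)] nn(1)[of u'] by simp
  next
    case 4
    then have 0: "g u = 0" "pE u' = 0" using g(1) E_transient u by blast+
    obtain x where x: "cyc x" using cyc_exists by blast
    then show ?thesis using S[OF x x] nn[of x] 0 by simp
  qed (use S u in simp)
qed

definition dimA :: real where
  "dimA = Max ((\<lambda>(u, u'). fE u / ln n + pE u' / ln m) ` {(u, u'). cyc u \<and> cyc u' \<and> reach u u'})"

text \<open>An approximate square of side \<open>exp (- D)\<close> has about \<open>D / ln n\<close>
  positions with both digits followed by \<open>D * (1 / ln m - 1 / ln n)\<close> positions with y
  alone; these are the two weights.\<close>

definition dimB :: real where
  "dimB = Max ((\<lambda>(u, u'). hE u / ln n + pE u' * (1 / ln m - 1 / ln n)) ` {(u, u'). cyc u \<and> cyc u' \<and> reach u u'})"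

lemma cyc_pairs: "finite {(u, u'). cyc u \<and> cyc u' \<and> reach u u'}" "{(u, u'). cyc u \<and> cyc u' \<and> reach u u'} \<noteq> {}"
proof -
  show "finite {(u, u'). cyc u \<and> cyc u' \<and> reach u u'}"
    by (rule finite_subset[of _ "V \<times> V"]) (use cyc_V finV in auto)
  show "{(u, u'). cyc u \<and> cyc u' \<and> reach u u'} \<noteq> {}" using cyc_exists reach_refl by blast
qed

lemma dimA_ge: "cyc u \<Longrightarrow> cyc u' \<Longrightarrow> reach u u' \<Longrightarrow> fE u / ln n + pE u' / ln m \<le> dimA"
  unfolding dimA_def using cyc_pairs by (intro Max_ge) auto

lemma dimA_attained: obtains u u' where "cyc u" "cyc u'" "reach u u'" "dimA = fE u / ln n + pE u' / ln m"
proof -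
  have "dimA \<in> (\<lambda>(u, u'). fE u / ln n + pE u' / ln m) ` {(u, u'). cyc u \<and> cyc u' \<and> reach u u'}"
    unfolding dimA_def using cyc_pairs by (intro Max_in) auto
  then show ?thesis using that by auto
qed

lemma dimB_ge: "cyc u \<Longrightarrow> cyc u' \<Longrightarrow> reach u u' \<Longrightarrow> hE u / ln n + pE u' * (1 / ln m - 1 / ln n) \<le> dimB"
  unfolding dimB_def using cyc_pairs by (intro Max_ge) auto

lemma dimB_attained: obtains u u' where "cyc u" "cyc u'" "reach u u'" "dimB = hE u / ln n + pE u' * (1 / ln m - 1 / ln n)"
proof -
  have "dimB \<in> (\<lambda>(u, u'). hE u / ln n + pE u' * (1 / ln m - 1 / ln n)) ` {(u, u'). cyc u \<and> cyc u' \<and> reach u u'}"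
    unfolding dimB_def using cyc_pairs by (intro Max_in) auto
  then show ?thesis using that by auto
qed

lemma dimA_ge_V: "u \<in> V \<Longrightarrow> u' \<in> V \<Longrightarrow> reach u u' \<Longrightarrow> fE u / ln n + pE u' / ln m \<le> dimA"
  using transient_pairs[of fE "1 / ln n" "1 / ln m" dimA u u'] dimA_ge E_transient E_nonneg lnmn by simp

lemma dimB_ge_V: "u \<in> V \<Longrightarrow> u' \<in> V \<Longrightarrow> reach u u' \<Longrightarrow> hE u / ln n + pE u' * (1 / ln m - 1 / ln n) \<le> dimB"
  using transient_pairs[of hE "1 / ln n" "1 / ln m - 1 / ln n" dimB u u'] dimB_ge E_transient E_nonneg lnmn by simp

theorem assouad_dim_XX: "assouad_dim XX = dimA"
proof -
  let ?S = "{s. 0 \<le> s \<and> (\<exists>C>0. \<forall>x\<in>XX. \<forall>r R. 0 < r \<and> r < R \<longrightarrow>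
       real (cover_num r (cball x R \<inter> XX)) \<le> C * (R / r) powr s)}"
  have in_S: "s \<in> ?S" if "s > dimA" for s
    using assouad_upper[OF dimA_ge_V that] by simp
  obtain u u' where u: "cyc u" "cyc u'" "reach u u'" "dimA = fE u / ln n + pE u' / ln m" by (rule dimA_attained)
  have lower: "dimA \<le> s" if "s \<in> ?S" for s
  proof -
    obtain C where "0 \<le> s" "C > 0" "\<forall>x\<in>XX. \<forall>r R. 0 < r \<and> r < R \<longrightarrow>
       real (cover_num r (cball x R \<inter> XX)) \<le> C * (R / r) powr s" using \<open>s \<in> ?S\<close> by blast
    from assouad_lower[OF u(1-3) this] show ?thesis using u(4) by simp
  qed
  have "Inf ?S = dimA"
  proof (rule antisym)
    have bdd: "bdd_below ?S" by (rule bdd_belowI[of _ dimA]) (rule lower)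
    show "Inf ?S \<le> dimA"
      by (rule dense_ge) (rule cInf_lower[OF in_S bdd])
    have "?S \<noteq> {}" using in_S[of "dimA + 1"] by force
    then show "dimA \<le> Inf ?S" by (rule cInf_greatest) (rule lower)
  qed
  then show ?thesis unfolding assouad_dim_def .
qed

section \<open>The box dimension\<close>

text \<open>Refinement starts from the coarse level \<open>k = L = 0\<close>, where the fibre
  segment is empty; only pairs and then single y-digits remain.\<close>

lemma box_upper:
  assumes "\<epsilon> > 0"
  obtains c where "\<And>\<delta>. 0 < \<delta> \<Longrightarrow> \<delta> < 1 \<Longrightarrow> real (cover_num \<delta> XX) \<le> exp ((dimB + \<epsilon>) * (- ln \<delta>) + c)"
proof -
  note lnp = lnmn
  define \<kappa> where "\<kappa> = 1 / ln (real n) + 1 / ln (real m)"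
  have \<kappa>: "\<kappa> > 0" unfolding \<kappa>_def using lnp by (simp add: add_pos_pos)
  define \<epsilon>' where "\<epsilon>' = \<epsilon> / \<kappa>"
  have eps: "\<epsilon>' > 0" "\<epsilon>' * \<kappa> = \<epsilon>" unfolding \<epsilon>'_def using \<kappa> assms by auto
  obtain C where C: "C > 0" "\<And>k L l M c T. k \<le> L \<Longrightarrow> k \<le> l \<Longrightarrow> L \<le> M \<Longrightarrow> l \<le> M \<Longrightarrow> exponent_le k L l M T \<Longrightarrow>
      real (card (ext k L l M c)) \<le> C * exp (T + \<epsilon>' * (real (l - k) + real (M - L)))"
    using card_ext_exp[OF eps(1)] by blast
  \<comment> \<open>Bounds the excess from halving the scale and rounding up, for base
    \<open>n\<close> and, since \<open>m < n\<close>, also for base \<open>m\<close>.\<close>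
  define a where "a = ln 2 + ln (real n)"
  have a0: "0 \<le> a" unfolding a_def using lnp by simp
  \<comment> \<open>Entropy charged to the excess letters. Sums over \<open>V\<close> make it
    independent of which classes are visited.\<close>
  define Q where "Q = a / ln n * (\<Sum>u\<in>V. hE u) + a / ln m * (\<Sum>u\<in>V. pE u)"
  define c where "c = ln (49 * C) + Q + \<epsilon>' * (a / ln n + a / ln m)"
  have "real (cover_num \<delta> XX) \<le> exp ((dimB + \<epsilon>) * (- ln \<delta>) + c)" if d: "0 < \<delta>" "\<delta> < 1" for \<delta>
  proof -
    define D where "D = - ln \<delta>"
    have D: "D > 0" unfolding D_def using d by simp
    define t where "t = D + ln 2"
    have t0: "0 \<le> t" unfolding t_def using D by (simp add: add_nonneg_nonneg)
    have expt: "exp t = 2 / \<delta>" unfolding t_def D_def exp_add using d by (simp add: exp_minus field_simps)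
    let ?l = "lev_hi n t" and ?M = "lev_hi m t"
    have n2: "2 \<le> n" using m2 mn by simp
    have le: "?l \<le> ?M" using lev_mono(2)[OF m2 less_imp_le[OF mn] t0] .
    have fine: "2 \<le> \<delta> * real b ^ lev_hi b t" if "2 \<le> b" for b
      using lev_hi_bounds(3)[OF that t0] d unfolding expt by (simp add: field_simps)
    have l: "D \<le> real ?l * ln n" "real ?l * ln n \<le> D + a"
      using lev_hi_bounds(1,2)[OF n2 t0] unfolding a_def t_def by (auto intro: order_trans[rotated])
    have M: "D \<le> real ?M * ln m" "real ?M * ln m \<le> D + a"
      using lev_hi_bounds(1,2)[OF m2 t0] lnp unfolding a_def t_def by (auto intro: order_trans[rotated])
    have l': "D / ln n \<le> real ?l" "real ?l \<le> D / ln n + a / ln n" using l lnp by (simp_all add: field_simps)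
    have M': "D / ln m \<le> real ?M" "real ?M \<le> D / ln m + a / ln m" using M lnp by (simp_all add: field_simps)
    have "real (min ?l 0 - 0) * fE u1 + real (?l - 0) * hE u2 + real (?M - max ?l 0) * pE u3 \<le> D * dimB + Q"
      if u: "u1 \<in> V" "u2 \<in> V" "u3 \<in> V" "reach u1 u2" "reach u2 u3" for u1 u2 u3
    proof -
      have "real ?l * hE u2 \<le> (D / ln n + a / ln n) * hE u2" using l' E_nonneg by (intro mult_right_mono) auto
      moreover have "(real ?M - real ?l) * pE u3 \<le> (D / ln m + a / ln m - D / ln n) * pE u3"
        using l' M' E_nonneg by (intro mult_right_mono) auto
      ultimately have "real ?l * hE u2 + (real ?M - real ?l) * pE u3 \<le>
        D * (hE u2 / ln n + pE u3 * (1 / ln m - 1 / ln n)) + (a / ln n * hE u2 + a / ln m * pE u3)"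
        by (simp add: algebra_simps)
      also have "\<dots> \<le> D * dimB + Q"
      proof (rule add_mono)
        show "D * (hE u2 / ln n + pE u3 * (1 / ln m - 1 / ln n)) \<le> D * dimB"
          using dimB_ge_V[OF u(2,3,5)] D by (intro mult_left_mono) auto
        have "hE u2 \<le> (\<Sum>u\<in>V. hE u)" "pE u3 \<le> (\<Sum>u\<in>V. pE u)"
          using u finV E_nonneg by (auto intro!: member_le_sum)
        then show "a / ln n * hE u2 + a / ln m * pE u3 \<le> Q"
          unfolding Q_def using a0 lnp by (intro add_mono mult_left_mono) auto
      qed
      finally show ?thesis using le by (simp add: of_nat_diff)
    qed
    then have T: "exponent_le 0 0 ?l ?M (D * dimB + Q)" unfolding exponent_le_def by blast
    have B: "real (card (ext 0 0 ?l ?M c)) \<le> C * exp (D * dimB + Q + \<epsilon>' * (real (?l - 0) + real (?M - 0)))" for c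
      by (rule C(2)[OF _ _ _ le T]) auto
    have "real (cover_num \<delta> XX) \<le> 49 * (C * exp (D * dimB + Q + \<epsilon>' * (real (?l - 0) + real (?M - 0))))"
    proof (rule cover_num_ext[OF _ _ fine[OF n2] fine[OF m2] _ _ _ le B])
      fix z z' assume "z \<in> XX" "z' \<in> XX"
      then show "dist z z' * real n ^ 0 \<le> 2 \<and> dist z z' * real m ^ 0 \<le> 2" using XX_dist by simp
    qed auto
    also have "\<dots> = exp (ln (49 * C) + (D * dimB + Q + \<epsilon>' * (real ?l + real ?M)))"
      unfolding exp_add[of "ln (49 * C)"] using C(1) by simp
    also have "\<dots> \<le> exp ((dimB + \<epsilon>) * D + c)"
    proof -
      have "\<epsilon>' * (real ?l + real ?M) \<le> \<epsilon>' * ((D / ln n + a / ln n) + (D / ln m + a / ln m))"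
        using l' M' eps(1) by (intro mult_left_mono add_mono) auto
      also have "\<dots> = D * (\<epsilon>' * \<kappa>) + \<epsilon>' * (a / ln n + a / ln m)"
        unfolding \<kappa>_def by (simp add: algebra_simps)
      finally show ?thesis unfolding c_def eps(2) by (simp add: algebra_simps)
    qed
    finally show ?thesis unfolding D_def .
  qed
  then show ?thesis using that by blast
qed

text \<open>Pair words of length \<open>k\<close> in the class of \<open>u\<close> are continued by
  y-words of length \<open>L - k\<close> growing at the rate of \<open>u'\<close>. Distinct choices
  give distinct cells of the carpet at scale \<open>\<delta>\<close>.\<close>

lemma box_lower:
  obtains c where "\<And>\<delta>. 0 < \<delta> \<Longrightarrow> \<delta> < 1 \<Longrightarrow> exp (dimB * (- ln \<delta>) - c) \<le> real (cover_num \<delta> XX)"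
proof -
  note lnp = lnmn
  obtain u u' where u: "cyc u" "cyc u'" "reach u u'" "dimB = hE u / ln n + pE u' * (1 / ln m - 1 / ln n)"
    by (rule dimB_attained)
  obtain J where J: "\<And>v u q. v \<in> V \<Longrightarrow> cyc u \<Longrightarrow> reach v u \<Longrightarrow>
    exp ((real q - real J) * pE u) \<le> (real (card V))\<^sup>2 * real (card (map dy ` froms v q))"
    using many_from by blast
  have n2: "2 \<le> n" using m2 mn by simp
  \<comment> \<open>\<open>hE u\<close> pays for rounding \<open>k\<close> down, and
    \<open>(1 + real J) * pE u'\<close> for rounding \<open>L\<close> down and for the path into the
    class of \<open>u'\<close>.\<close>
  define c where "c = ln ((real (card V))\<^sup>2 * (real (card V))\<^sup>2 * 49) + hE u + (1 + real J) * pE u'"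
  have "exp (dimB * (- ln \<delta>) - c) \<le> real (cover_num \<delta> XX)" if d: "0 < \<delta>" "\<delta> < 1" for \<delta>
  proof -
    define D where "D = - ln \<delta>"
    have D: "D > 0" unfolding D_def using d by simp
    then have D0: "0 \<le> D" by simp
    have expD: "exp D = 1 / \<delta>" unfolding D_def using d by (simp add: exp_minus field_simps)
    define k where "k = lev_lo n D"
    define L where "L = lev_lo m D"
    have kL: "k \<le> L" unfolding k_def L_def using lev_mono(1)[OF m2 less_imp_le[OF mn] D0] .
    have k: "D - ln n \<le> real k * ln n" "real k * ln n \<le> D" unfolding k_def using lev_lo_bounds[OF n2 D0] by auto
    have L: "D - ln m \<le> real L * ln m" unfolding L_def using lev_lo_bounds[OF m2 D0] by auto
    have k': "D / ln n - 1 \<le> real k" "real k \<le> D / ln n" using k lnp by (simp_all add: field_simps)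
    have L': "D / ln m - 1 \<le> real L" using L lnp by (simp add: field_simps)
    have coarse: "\<delta> * real b ^ lev_lo b D \<le> 2" if "2 \<le> b" for b
    proof -
      have "\<delta> * real b ^ lev_lo b D \<le> \<delta> * (1 / \<delta>)"
        using lev_lo_bounds(3)[OF that D0] d unfolding expD by (intro mult_left_mono) auto
      then show ?thesis using d by simp
    qed
    obtain v v' where v: "v \<in> scc u" "v' \<in> scc u"
      and many: "exp (real k * hE u) \<le> (real (card V))\<^sup>2 * real (cxy (wset ini ter (Eu u) v v' k))"
      unfolding hE_def by (rule many_words[OF u(1)])
    let ?Wf = "wset ini ter (Eu u) v v' k"
    have finf: "finite ?Wf" by (rule finite_wset[OF finite_Eu])
    have Wf: "\<And>w. w \<in> ?Wf \<Longrightarrow> w \<in> W v v' k" using wset_Eu by blast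
    have vV: "v \<in> V" "v' \<in> V" using v scc_sub by blast+
    have r: "reach v' u'" using reach_trans[OF scc_reach[OF v(2) cyc_scc[OF u(1)]] u(3)] .
    let ?xy = "map (\<lambda>e. (dx e, dy e))"
    define I where "I = (\<lambda>(a, b). (map fst a, map snd a @ b)) ` (?xy ` ?Wf \<times> map dy ` froms v' (L - k))"
    have cxyW: "cxy ?Wf = card (?xy ` ?Wf)"
      by (rule cnt_triv[OF finf, where k=k]) (auto simp: wset_def)
    have "inj_on (\<lambda>(a, b). (map fst a, map snd a @ b)) (?xy ` ?Wf \<times> map dy ` froms v' (L - k))"
    proof (rule inj_onI, clarify)
      fix w w1 w' w1' assume w: "w \<in> ?Wf" "w' \<in> ?Wf"
        and e: "map fst (?xy w) = map fst (?xy w')" "map snd (?xy w) @ map dy w1 = map snd (?xy w') @ map dy w1'"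
      have len: "length w = length w'" using w by (simp add: wset_def)
      have "map snd (?xy w) = map snd (?xy w')" "map dy w1 = map dy w1'" using e(2) len by auto
      then show "?xy w = ?xy w' \<and> map dy w1 = map dy w1'" using e(1) by (metis zip_map_fst_snd)
    qed
    then have cardI: "card I = cxy ?Wf * card (map dy ` froms v' (L - k))"
      unfolding I_def cxyW by (simp add: card_image card_cartesian_product)
    have real_I: "\<exists>w z. w \<in> adm_words ini ter E L \<and> c = code k L w \<and> z \<in> XX \<and> z \<in> cell k L c" if "c \<in> I" for c
    proof -
      obtain w w1 where w: "w \<in> ?Wf" "w1 \<in> froms v' (L - k)" "c = (map fst (?xy w), map snd (?xy w) @ map dy w1)"
        using \<open>c \<in> I\<close> unfolding I_def by auto
      obtain y where y: "y \<in> V" "w1 \<in> W v' y (L - k)" using w(2) unfolding froms_def by blast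
      have "w @ w1 \<in> W v y (k + (L - k))" by (rule wset_append[OF Wf[OF w(1)] y(2)])
      then have wW: "w @ w1 \<in> W v y L" using kL by simp
      have "length w = k" "length (w @ w1) = L" using Wf[OF w(1)] wW unfolding wset_def by blast+
      then have c: "c = code k L (w @ w1)" unfolding code_def w(3) by (simp add: o_def)
      obtain z' where z': "z' \<in> X y" using Xcpt y(1) by blast
      have "psiw (w @ w1) z' \<in> cell k L (code k L (w @ w1))" by (rule psiw_cell[OF wW vV(1) z' kL order_refl])
      moreover have "psiw (w @ w1) z' \<in> XX" using psiw_in_X[OF _ vV(1) z', of "w @ w1"] wW vV unfolding XX_def wset_def by auto
      ultimately show ?thesis using c subsetD[OF wset_adm wW] by blast
    qed
    have "card I \<le> 49 * cover_num \<delta> XX"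
    proof (rule cover_num_lower[where K=L and k=k and L=L, OF order_refl d(1)])
      show "\<delta> * real n ^ k \<le> 2" "\<delta> * real m ^ L \<le> 2" unfolding k_def L_def using coarse n2 m2 by auto
      show "I \<subseteq> code k L ` adm_words ini ter E L" using real_I by blast
      show "cell k L c \<inter> XX \<noteq> {}" if "c \<in> I" for c using real_I[OF that] by blast
    qed (use kL in auto)
    then have I_le: "real (card I) \<le> 49 * real (cover_num \<delta> XX)" by linarith
    have "exp (real k * hE u + (real (L - k) - real J) * pE u')
        \<le> ((real (card V))\<^sup>2 * real (cxy ?Wf)) * ((real (card V))\<^sup>2 * real (card (map dy ` froms v' (L - k))))"
      unfolding exp_add using many J[OF vV(2) u(2) r, of "L - k"] by (intro mult_mono) auto
    also have "\<dots> = (real (card V))\<^sup>2 * (real (card V))\<^sup>2 * real (card I)" unfolding cardI by simp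
    also have "\<dots> \<le> (real (card V))\<^sup>2 * (real (card V))\<^sup>2 * (49 * real (cover_num \<delta> XX))"
      by (rule mult_left_mono[OF I_le]) simp
    also have "\<dots> = exp (ln ((real (card V))\<^sup>2 * (real (card V))\<^sup>2 * 49)) * real (cover_num \<delta> XX)"
      using cardV_pos by simp
    finally have "exp (real k * hE u + (real (L - k) - real J) * pE u')
      \<le> exp (ln ((real (card V))\<^sup>2 * (real (card V))\<^sup>2 * 49)) * real (cover_num \<delta> XX)" .
    then have main: "exp (real k * hE u + (real (L - k) - real J) * pE u' - ln ((real (card V))\<^sup>2 * (real (card V))\<^sup>2 * 49)) \<le> real (cover_num \<delta> XX)"
      unfolding exp_diff by (subst pos_divide_le_eq) (auto simp only: exp_gt_zero mult.commute)
    have "(D / ln n - 1) * hE u \<le> real k * hE u" using k' E_nonneg by (intro mult_right_mono) auto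
    moreover have "(D / ln m - 1 - D / ln n - real J) * pE u' \<le> (real (L - k) - real J) * pE u'"
      using k' L' kL E_nonneg by (intro mult_right_mono) (auto simp: of_nat_diff)
    ultimately have "dimB * D - c \<le> real k * hE u + (real (L - k) - real J) * pE u' - ln ((real (card V))\<^sup>2 * (real (card V))\<^sup>2 * 49)"
      unfolding c_def u(4) by (simp add: algebra_simps)
    then show ?thesis using main unfolding D_def by (smt (verit) exp_le_cancel_iff)
  qed
  then show ?thesis using that by blast
qed

text \<open>\<open>Lim\<close> is meaningful only after convergence is shown. The additive constants
  in the two exponential bounds vanish on division by \<open>- ln \<delta>\<close>.\<close>

theorem box_dim_XX: "box_dim XX = dimB"
proof -
  let ?f = "\<lambda>\<delta>. ln (real (cover_num \<delta> XX)) / (- ln \<delta>)"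
  obtain c where lower: "\<And>\<delta>. 0 < \<delta> \<Longrightarrow> \<delta> < 1 \<Longrightarrow> exp (dimB * (- ln \<delta>) - c) \<le> real (cover_num \<delta> XX)"
    using box_lower by blast
  have pos: "real (cover_num \<delta> XX) > 0" if "0 < \<delta>" "\<delta> < 1" for \<delta>
    using lower[OF that] by (meson exp_gt_zero less_le_trans)
  have lim: "LIM \<delta> at_right (0::real). - ln \<delta> :> at_top"
    using ln_at_0 by (simp add: filterlim_uminus_at_top)
  have large: "eventually (\<lambda>\<delta>::real. 0 < \<delta> \<and> \<delta> < 1 \<and> - ln \<delta> > K) (at_right 0)" for K
  proof -
    have "eventually (\<lambda>\<delta>::real. - ln \<delta> > K) (at_right 0)" using lim by (simp add: filterlim_at_top_dense)
    moreover have "eventually (\<lambda>\<delta>::real. \<delta> \<in> {0<..<1}) (at_right 0)" by (rule eventually_at_right_real) simp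
    ultimately show ?thesis by eventually_elim auto
  qed
  have "(?f \<longlongrightarrow> dimB) (at_right 0)"
  proof (rule order_tendstoI)
    fix a assume a: "a < dimB"
    show "eventually (\<lambda>\<delta>. a < ?f \<delta>) (at_right 0)"
      using large[of "\<bar>c\<bar> / (dimB - a)"]
    proof eventually_elim
      case (elim \<delta>)
      then have d: "0 < \<delta>" "\<delta> < 1" and D: "- ln \<delta> > 0" "\<bar>c\<bar> < - ln \<delta> * (dimB - a)" using a by (auto simp: field_simps)
      have "dimB * (- ln \<delta>) - c \<le> ln (real (cover_num \<delta> XX))"
        using lower[OF d] pos[OF d] by (simp add: ln_ge_iff)
      then have "a * (- ln \<delta>) < ln (real (cover_num \<delta> XX))" using D(2) by (simp add: algebra_simps)
      then show ?case using D(1) by (simp only: pos_less_divide_eq)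
    qed
  next
    fix b assume b: "dimB < b"
    then have "(b - dimB) / 2 > 0" by simp
    then obtain c' where upper: "\<And>\<delta>. 0 < \<delta> \<Longrightarrow> \<delta> < 1 \<Longrightarrow> real (cover_num \<delta> XX) \<le> exp ((dimB + (b - dimB) / 2) * (- ln \<delta>) + c')"
      using box_upper by metis
    show "eventually (\<lambda>\<delta>. ?f \<delta> < b) (at_right 0)"
      using large[of "\<bar>c'\<bar> / ((b - dimB) / 2)"]
    proof eventually_elim
      case (elim \<delta>)
      then have d: "0 < \<delta>" "\<delta> < 1" and D: "- ln \<delta> > 0" "\<bar>c'\<bar> < - ln \<delta> * ((b - dimB) / 2)" using b by (auto simp: field_simps)
      have "ln (real (cover_num \<delta> XX)) \<le> (dimB + (b - dimB) / 2) * (- ln \<delta>) + c'"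
        using upper[OF d] pos[OF d] by (metis exp_le_cancel_iff exp_ln)
      also have "\<dots> < (dimB + (b - dimB) / 2) * (- ln \<delta>) + - ln \<delta> * ((b - dimB) / 2)" using D(2) by linarith
      also have "\<dots> = b * (- ln \<delta>)" by (simp add: field_simps)
      finally show ?case using D(1) by (simp only: pos_divide_less_eq)
    qed
  qed
  then show ?thesis unfolding box_dim_def by (intro tendsto_Lim) auto
qed

section \<open>The Hausdorff dimension\<close>

text \<open>An optimal cover at scale \<open>\<delta>\<close> has Hausdorff sum at most
  \<open>cover_num \<delta> XX * \<delta> powr s\<close>, which tends to 0 because \<open>s\<close>
  exceeds the box exponent.\<close>

lemma hausdorff_upper_zero:
  assumes "dimB < s" "0 < s"
  shows "hausdorff_measure s XX = 0"
proof -
  define \<epsilon> where "\<epsilon> = (s - dimB) / 2"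
  have eps: "\<epsilon> > 0" "dimB + \<epsilon> = s - \<epsilon>" unfolding \<epsilon>_def using assms by (auto simp: field_simps)
  obtain c where c: "\<And>\<delta>. 0 < \<delta> \<Longrightarrow> \<delta> < 1 \<Longrightarrow> real (cover_num \<delta> XX) \<le> exp ((dimB + \<epsilon>) * (- ln \<delta>) + c)"
    using box_upper[OF eps(1)] by blast
  have "hausdorff_pre s \<eta> XX \<le> ennreal e" if "\<eta> > 0" "e > 0" for \<eta> e
  proof -
    \<comment> \<open>The last term ensures \<open>\<epsilon> * ln \<delta> + c \<le> ln e\<close>;
      the others keep \<open>\<delta>\<close> below 1 and below the permitted diameter.\<close>
    define \<delta> where "\<delta> = min (min \<eta> (1/2)) (exp ((ln e - c) / \<epsilon>))"
    have d: "0 < \<delta>" "\<delta> < 1" "\<delta> \<le> \<eta>" unfolding \<delta>_def using that by auto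
    have "ln \<delta> \<le> ln (exp ((ln e - c) / \<epsilon>))" using d(1) unfolding \<delta>_def by (intro ln_mono) auto
    then have lnd: "\<epsilon> * ln \<delta> + c \<le> ln e" using eps(1) by (simp add: field_simps)
    let ?N = "cover_num \<delta> XX"
    obtain K where K: "XX \<subseteq> (\<Union>c\<in>code K K ` adm_words ini ter E K. cell K K c)"
      "\<And>c. bounded (cell K K c) \<and> diameter (cell K K c) \<le> \<delta>" using XX_cover[OF d(1)] by blast
    obtain U where U: "XX \<subseteq> (\<Union>j<?N. U j)" "\<And>j. j < ?N \<Longrightarrow> bounded (U j) \<and> diameter (U j) \<le> \<delta>"
      using cover_num_cover(2)[OF finite_codes K] by blast
    \<comment> \<open>The finite cover is continued by empty sets, which contribute 0 by the
      convention in \<open>d_pow\<close>.\<close>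
    define U' where "U' j = (if j < ?N then U j else {})" for j
    have "hausdorff_pre s \<eta> XX \<le> (\<Sum>j. ennreal (d_pow s (U' j)))"
      unfolding hausdorff_pre_def
    proof (rule INF_lower, safe)
      fix a b assume "(a, b) \<in> XX"
      then obtain j where "j < ?N" "(a, b) \<in> U j" using U(1) by blast
      then show "(a, b) \<in> (\<Union>j. U' j)" unfolding U'_def by (intro UN_I[of j]) auto
    next
      fix j show "bounded (U' j)" "diameter (U' j) \<le> \<eta>" unfolding U'_def using U(2)[of j] d by auto
    qed
    also have "\<dots> = (\<Sum>j<?N. ennreal (d_pow s (U' j)))"
      by (rule suminf_finite) (auto simp: U'_def d_pow_def)
    also have "\<dots> \<le> (\<Sum>j<?N. ennreal (\<delta> powr s))"
    proof (rule sum_mono)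
      fix j assume "j \<in> {..<?N}"
      then have j: "bounded (U j)" "diameter (U j) \<le> \<delta>" "U' j = U j" using U(2)[of j] by (auto simp: U'_def)
      have "diameter (U j) powr s \<le> \<delta> powr s"
        using j assms(2) diameter_ge_0[OF j(1)] by (intro powr_mono2) auto
      then show "ennreal (d_pow s (U' j)) \<le> ennreal (\<delta> powr s)"
        using assms(2) unfolding j(3) d_pow_def by (auto intro: ennreal_leI)
    qed
    also have "\<dots> = ennreal (real ?N * \<delta> powr s)" by (simp add: ennreal_mult ennreal_of_nat_eq_real_of_nat)
    also have "\<dots> \<le> ennreal e"
    proof (rule ennreal_leI)
      have "real ?N * \<delta> powr s \<le> exp ((dimB + \<epsilon>) * (- ln \<delta>) + c) * \<delta> powr s"
        by (rule mult_right_mono[OF c[OF d(1,2)]]) simp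
      also have "\<dots> = exp (\<epsilon> * ln \<delta> + c)"
        unfolding powr_def eps(2) using d(1) by (simp add: algebra_simps flip: exp_add)
      also have "\<dots> \<le> exp (ln e)" using lnd by simp
      finally show "real ?N * \<delta> powr s \<le> e" using that by simp
    qed
    finally show ?thesis .
  qed
  then have "hausdorff_pre s \<eta> XX = 0" if "\<eta> > 0" for \<eta>
    using that ennreal_le_epsilon[of 0 "hausdorff_pre s \<eta> XX"] by (simp add: le_zero_eq[symmetric] del: le_zero_eq)
  then show ?thesis unfolding hausdorff_measure_def by (simp add: image_constant_conv cong: SUP_cong_simp)
qed

lemma hausdorff_dim_le: "hausdorff_dim XX \<le> dimB"
proof -
  obtain u u' where "dimB = hE u / ln n + pE u' * (1 / ln m - 1 / ln n)" by (rule dimB_attained)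
  then have B0: "0 \<le> dimB" using E_nonneg lnmn by simp
  have bdd: "bdd_below {s. 0 \<le> s \<and> hausdorff_measure s XX = 0}" by (rule bdd_belowI[of _ 0]) auto
  have "hausdorff_dim XX \<le> s" if "dimB < s" for s
    unfolding hausdorff_dim_def using hausdorff_upper_zero[OF that] that B0 bdd by (intro cInf_lower) auto
  then show ?thesis by (rule dense_ge)
qed

section \<open>Loop blocks, the points they code, and Bernoulli measures\<close>

definition blocks :: "(nat \<Rightarrow> 'e list) \<Rightarrow> nat \<Rightarrow> 'e list" where
  "blocks \<omega> j = concat (map \<omega> [0..<j])"

lemma concat_W:
  assumes "\<And>i. \<omega> i \<in> W v v N"
  shows "concat (map \<omega> is) \<in> W v v (N * length is)"
proof (induction "is")
  case Nil
  then show ?case by (simp add: wset_def)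
next
  case (Cons i "is")
  from wset_append[OF assms Cons, of i] show ?case by simp
qed

lemma blocks_W: "(\<And>i. \<omega> i \<in> W v v N) \<Longrightarrow> blocks \<omega> j \<in> W v v (N * j)"
  unfolding blocks_def using concat_W[of \<omega> v N "[0..<j]"] by simp

lemma blocks_add: "i \<le> j \<Longrightarrow> blocks \<omega> j = blocks \<omega> i @ concat (map \<omega> [i..<j])"
  unfolding blocks_def by (metis concat_append le_add_diff_inverse map_append upt_add_eq_append zero_le)

lemma continuous_psiw: "continuous_on S (psiw w)"
proof (induction w)
  case (Cons e w)
  have "psiw (e # w) = (\<lambda>z. ((fst (psiw w z) + real (dx e)) / real n, (snd (psiw w z) + real (dy e)) / real m))"
    by (auto simp: psi_def case_prod_beta)
  moreover have "continuous_on S (\<lambda>z. ((fst (psiw w z) + real (dx e)) / real n, (snd (psiw w z) + real (dy e)) / real m))"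
    using Cons npos by (intro continuous_intros) auto
  ultimately show ?case by simp
next
  case Nil
  have "psiw [] = (\<lambda>z. z)" by auto
  then show ?case by simp
qed

text \<open>All blocks are loops at \<open>v\<close>, so the images of \<open>X v\<close> under
  longer concatenations are nested nonempty compact sets. A point of their intersection lies in the
  cells of all prefixes simultaneously.\<close>

lemma block_point:
  assumes \<omega>: "\<And>i. \<omega> i \<in> W v v N" and v: "v \<in> V"
  shows "\<exists>z\<in>XX. \<forall>k L. k \<le> L \<longrightarrow> z \<in> cell (N * k) (N * L) (code (N * k) (N * L) (blocks \<omega> L))"
proof -
  let ?F = "\<lambda>j. psiw (blocks \<omega> j) ` X v"
  have "\<Inter>(range ?F) \<noteq> {}"
  proof (rule compact_nest)
    show "compact (?F j)" for j using Xcpt v by (intro compact_continuous_image continuous_psiw) auto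
    show "?F j \<noteq> {}" for j using Xcpt v by auto
    show "?F j \<subseteq> ?F i" if "i \<le> j" for i j
    proof
      fix z assume "z \<in> ?F j"
      then obtain x where x: "x \<in> X v" "z = psiw (blocks \<omega> j) x" by auto
      have "concat (map \<omega> [i..<j]) \<in> W v v (N * length [i..<j])" by (rule concat_W[OF \<omega>])
      then have "psiw (concat (map \<omega> [i..<j])) x \<in> X v" using psiw_in_X[OF _ v x(1)] by (auto simp: wset_def)
      then show "z \<in> ?F i" unfolding x(2) blocks_add[OF that] psiw_append by blast
    qed
  qed
  then obtain z where z: "\<And>j. z \<in> ?F j" by blast
  have "z \<in> cell (N * k) (N * L) (code (N * k) (N * L) (blocks \<omega> L))" if "k \<le> L" for k L
  proof -
    obtain x where x: "x \<in> X v" "z = psiw (blocks \<omega> L) x" using z[of L] by auto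
    show ?thesis unfolding x(2) using that
      by (intro psiw_cell[OF blocks_W[OF \<omega>] v x(1)]) auto
  qed
  moreover have "z \<in> XX"
  proof -
    have "z \<in> X v" using z[of 0] by (simp add: blocks_def)
    then show ?thesis unfolding XX_def using v by blast
  qed
  ultimately show ?thesis by blast
qed

text \<open>Blocks have the common length \<open>N\<close>, so digits of block \<open>i\<close> sit
  at positions \<open>N * i\<close> onward. A cell thus fixes both digit words of the first
  \<open>k\<close> blocks and the y-words of the first \<open>L\<close>.\<close>

lemma block_of_code:
  assumes \<omega>: "\<And>i. \<omega> i \<in> W v v N" and "k \<le> L" "i < L"
  shows "map dy (\<omega> i) = take N (drop (N * i) (snd (code (N * k) (N * L) (blocks \<omega> L))))"
    and "i < k \<Longrightarrow> map dx (\<omega> i) = take N (drop (N * i) (fst (code (N * k) (N * L) (blocks \<omega> L))))"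
proof -
  have len: "length (blocks \<omega> i) = N * i" "length (\<omega> i) = N" for i
    using blocks_W[OF \<omega>, where j=i] \<omega>[of i] by (auto simp: wset_def)
  have "blocks \<omega> L = blocks \<omega> i @ \<omega> i @ concat (map \<omega> [Suc i..<L])"
    using blocks_add[OF less_imp_le[OF assms(3)]] assms(3) by (simp add: upt_conv_Cons)
  then have blk: "take N (drop (N * i) (blocks \<omega> L)) = \<omega> i" using len by simp
  have "take (N * L) (blocks \<omega> L) = blocks \<omega> L" using len by simp
  then show "map dy (\<omega> i) = take N (drop (N * i) (snd (code (N * k) (N * L) (blocks \<omega> L))))"
    unfolding code_def using blk by (simp add: drop_map take_map)
  show "map dx (\<omega> i) = take N (drop (N * i) (fst (code (N * k) (N * L) (blocks \<omega> L))))" if "i < k"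
  proof -
    have "N * i + N \<le> N * k" using that by (metis Suc_leI mult_Suc_right mult_le_mono2 add.commute)
    then have "take N (drop (N * i) (take (N * k) (blocks \<omega> L))) = take N (drop (N * i) (blocks \<omega> L))"
      by (simp add: drop_take min_absorb1)
    then show ?thesis unfolding code_def using blk by (simp add: drop_map take_map)
  qed
qed

text \<open>Under the uniform Bernoulli measure on sequences of digit blocks, the set of sequences coding a
  point of U is covered by at most 49 cylinders, one for each approximate square meeting U.\<close>
lemma bernoulli_mass:
  fixes Wd :: "'e list set" and Mx \<beta> D :: real
  assumes v: "v \<in> V" and N: "0 < N" and Wd: "Wd \<subseteq> W v v N" "Wd \<noteq> {}"
    and inj: "inj_on (map (\<lambda>e. (dx e, dy e))) Wd"
    and Mx: "\<And>ys. real (card {w\<in>Wd. map dy w = ys}) \<le> Mx"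
    and z: "\<And>\<omega>. (\<And>i. \<omega> i \<in> Wd) \<Longrightarrow> z \<omega> \<in> XX \<and> (\<forall>k L. k \<le> L \<longrightarrow> z \<omega> \<in> cell (N * k) (N * L) (code (N * k) (N * L) (blocks \<omega> L)))"
    and D: "0 \<le> D" "\<And>x y. x \<in> U \<Longrightarrow> y \<in> U \<Longrightarrow> dist x y * exp D \<le> 2"
    and \<beta>: "\<beta> = real (card Wd)"
  defines "P \<equiv> PiM UNIV (\<lambda>_::nat. uniform_count_measure Wd)"
    and "k \<equiv> lev_lo (n ^ N) D" and "L \<equiv> lev_lo (m ^ N) D"
  shows "\<exists>Z\<in>sets P. {\<omega>\<in>space P. z \<omega> \<in> U} \<subseteq> Z \<and> emeasure P Z \<le> ennreal (49 * ((1 / \<beta>) ^ k * (Mx / \<beta>) ^ (L - k)))"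
proof -
  have finWd: "finite Wd" using Wd(1) finite_W finite_subset by blast
  interpret PP: product_prob_space "\<lambda>_::nat. uniform_count_measure Wd" UNIV
    by (rule product_prob_spaceI) (rule prob_space_uniform_count_measure[OF finWd Wd(2)])
  have \<beta>0: "\<beta> > 0" unfolding \<beta> using finWd Wd(2) by (simp add: card_gt_0_iff)
  have spP: "\<omega> i \<in> Wd" if "\<omega> \<in> space P" for \<omega> i
    using that unfolding P_def by (auto simp: space_PiM space_uniform_count_measure)
  \<comment> \<open>One block acts as a single digit in base \<open>n ^ N\<close> or
    \<open>m ^ N\<close>; accordingly \<open>k\<close> and \<open>L\<close> count blocks.\<close>
  have b2: "2 \<le> m ^ N" "m ^ N \<le> n ^ N" "2 \<le> n ^ N"
  proof -
    have "m ^ 1 \<le> m ^ N" using npos N by (intro power_increasing) auto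
    then show 1: "2 \<le> m ^ N" using m2 by simp
    show 2: "m ^ N \<le> n ^ N" using mn by (intro power_mono) auto
    show "2 \<le> n ^ N" using 1 2 by linarith
  qed
  have kL: "k \<le> L" unfolding k_def L_def using lev_mono(1)[OF b2(1,2) D(1)] .
  have lev: "real n ^ (N * k) \<le> exp D" "real m ^ (N * L) \<le> exp D"
    using lev_lo_bounds(3)[OF b2(3) D(1)] lev_lo_bounds(3)[OF b2(1) D(1)]
    unfolding k_def L_def by (simp_all add: power_mult)
  define I where "I = {c \<in> code (N * k) (N * L) ` adm_words ini ter E (N * L). cell (N * k) (N * L) c \<inter> U \<noteq> {}}"
  have finI: "finite I" unfolding I_def using finite_codes by simp
  have cardI: "card I \<le> 49"
  proof (rule few_cells[where U=U and k="N * k" and L="N * L" and K="N * L"])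
    fix x y assume xy: "x \<in> U" "y \<in> U"
    have "dist x y * real n ^ (N * k) \<le> dist x y * exp D" "dist x y * real m ^ (N * L) \<le> dist x y * exp D"
      using lev by (auto intro!: mult_left_mono)
    then show "dist x y * real n ^ (N * k) \<le> 2 \<and> dist x y * real m ^ (N * L) \<le> 2" using D(2)[OF xy] by linarith
  qed (use kL in \<open>auto simp: I_def\<close>)
  \<comment> \<open>Below \<open>k\<close> both digit words are prescribed, which leaves at most one
    block by injectivity; from \<open>k\<close> to \<open>L\<close> only the y-word is, which leaves
    at most \<open>Mx\<close>. These are the two factors in the mass bound.\<close>
  define A where "A c i = (if i < k then {w\<in>Wd. map dx w = take N (drop (N * i) (fst c)) \<and> map dy w = take N (drop (N * i) (snd c))}
      else {w\<in>Wd. map dy w = take N (drop (N * i) (snd c))})" for c :: "nat list \<times> nat list" and i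
  have A_sub: "A c i \<subseteq> Wd" for c i unfolding A_def by auto
  define Cyl where "Cyl c = {\<omega>\<in>space P. \<forall>i\<in>{..<L}. \<omega> i \<in> A c i}" for c
  have meas: "Cyl c \<in> sets P" for c
    unfolding Cyl_def
  proof (rule sets.sets_Collect_finite_All)
    fix i
    have "(\<lambda>\<omega>. \<omega> i) \<in> measurable P (uniform_count_measure Wd)"
      unfolding P_def by (rule measurable_component_singleton) simp
    then have "(\<lambda>\<omega>. \<omega> i) -` A c i \<inter> space P \<in> sets P"
      by (rule measurable_sets) (simp add: sets_uniform_count_measure A_sub)
    then show "{\<omega>\<in>space P. \<omega> i \<in> A c i} \<in> sets P" by (simp add: vimage_def Int_def conj_commute)
  qed simp
  let ?q = "(1 / \<beta>) ^ k * (Mx / \<beta>) ^ (L - k)"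
  have Mx0: "0 \<le> Mx" using Mx[of undefined] by (meson of_nat_0_le_iff order_trans)
  have mass: "emeasure P (Cyl c) \<le> ennreal ?q" for c
  proof -
    have "emeasure P (Cyl c) = (\<Prod>i\<in>{..<L}. emeasure (uniform_count_measure Wd) (A c i))"
      unfolding Cyl_def P_def by (rule PP.emeasure_PiM_Collect) (auto simp: sets_uniform_count_measure A_sub)
    also have "\<dots> = (\<Prod>i\<in>{..<L}. ennreal (real (card (A c i)) / \<beta>))"
      unfolding \<beta> using emeasure_uniform_count_measure[OF finWd A_sub] by simp
    also have "\<dots> = ennreal (\<Prod>i\<in>{..<L}. real (card (A c i)) / \<beta>)"
      using \<beta>0 by (intro prod_ennreal) auto
    also have "\<dots> \<le> ennreal ?q"
    proof (rule ennreal_leI)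
      have "(\<Prod>i\<in>{..<L}. real (card (A c i)) / \<beta>) \<le> (\<Prod>i\<in>{..<L}. if i < k then 1 / \<beta> else Mx / \<beta>)"
      proof (rule prod_mono, safe)
        fix i
        show "0 \<le> real (card (A c i)) / \<beta>" using \<beta>0 by simp
        show "real (card (A c i)) / \<beta> \<le> (if i < k then 1 / \<beta> else Mx / \<beta>)"
        proof (cases "i < k")
          case True
          have "w = w'" if "w \<in> A c i" "w' \<in> A c i" for w w'
          proof (rule inj_onD[OF inj])
            have "map dx w = map dx w'" "map dy w = map dy w'" using that True unfolding A_def by auto
            moreover have "map (\<lambda>e. (dx e, dy e)) u = zip (map dx u) (map dy u)" for u by (induction u) auto
            ultimately show "map (\<lambda>e. (dx e, dy e)) w = map (\<lambda>e. (dx e, dy e)) w'" by simp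
          qed (use that subsetD[OF A_sub] in blast)+
          then have "card (A c i) \<le> 1"
            by (metis card_le_Suc0_iff_eq card.infinite One_nat_def le0)
          then show ?thesis using True \<beta>0 by (simp add: divide_right_mono)
        next
          case False
          then show ?thesis using Mx \<beta>0 unfolding A_def by (simp add: divide_right_mono)
        qed
      qed
      also have "\<dots> = (\<Prod>i\<in>{..<k} \<union> {k..<L}. if i < k then 1 / \<beta> else Mx / \<beta>)"
        using kL by (intro prod.cong) auto
      also have "(\<Prod>i\<in>{..<k} \<union> {k..<L}. if i < k then 1 / \<beta> else Mx / \<beta>)
          = (\<Prod>i\<in>{..<k}. if i < k then 1 / \<beta> else Mx / \<beta>) * (\<Prod>i\<in>{k..<L}. if i < k then 1 / \<beta> else Mx / \<beta>)"
        by (rule prod.union_disjoint) auto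
      also have "(\<Prod>i\<in>{..<k}. if i < k then 1 / \<beta> else Mx / \<beta>) = (1 / \<beta>) ^ k" by simp
      also have "(\<Prod>i\<in>{k..<L}. if i < k then 1 / \<beta> else Mx / \<beta>) = (Mx / \<beta>) ^ (L - k)" by simp
      finally show "(\<Prod>i\<in>{..<L}. real (card (A c i)) / \<beta>) \<le> ?q" .
    qed
    finally show ?thesis .
  qed
  have q0: "0 \<le> ?q" using \<beta>0 Mx0 by simp
  show ?thesis
  proof (intro bexI conjI)
    \<comment> \<open>A measurable superset is returned because \<open>z\<close> is only a chosen
      coding map, and preimages of \<open>U\<close> under it may fail to be measurable.\<close>
    show "(\<Union>c\<in>I. Cyl c) \<in> sets P" using finI meas by auto
    show "{\<omega>\<in>space P. z \<omega> \<in> U} \<subseteq> (\<Union>c\<in>I. Cyl c)"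
    proof safe
      fix \<omega> assume \<omega>: "\<omega> \<in> space P" "z \<omega> \<in> U"
      have \<omega>W: "\<omega> i \<in> W v v N" for i using spP[OF \<omega>(1)] Wd(1) by blast
      let ?c = "code (N * k) (N * L) (blocks \<omega> L)"
      have "blocks \<omega> L \<in> adm_words ini ter E (N * L)" using subsetD[OF wset_adm blocks_W[OF \<omega>W]] .
      moreover have "z \<omega> \<in> cell (N * k) (N * L) ?c" using z spP[OF \<omega>(1)] kL by blast
      ultimately have "?c \<in> I" unfolding I_def using \<omega>(2) by blast
      moreover have "\<omega> \<in> Cyl ?c"
        unfolding Cyl_def A_def using \<omega>(1) spP[OF \<omega>(1)] block_of_code[OF \<omega>W kL] by auto
      ultimately show "\<omega> \<in> (\<Union>c\<in>I. Cyl c)" by blast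
    qed
    have "emeasure P (\<Union>c\<in>I. Cyl c) \<le> (\<Sum>c\<in>I. emeasure P (Cyl c))"
      using finI meas by (intro emeasure_subadditive_finite) auto
    also have "\<dots> \<le> (\<Sum>c\<in>I. ennreal ?q)" by (rule sum_mono) (rule mass)
    also have "\<dots> = ennreal (real (card I) * ?q)"
      using q0 by (simp add: ennreal_mult ennreal_of_nat_eq_real_of_nat)
    also have "\<dots> \<le> ennreal (49 * ?q)"
      using cardI q0 by (intro ennreal_leI mult_right_mono) auto
    finally show "emeasure P (\<Union>c\<in>I. Cyl c) \<le> ennreal (49 * ?q)" .
  qed
qed

text \<open>One path is kept for each pair word between two fixed vertices, and all are closed by
  the same return path. Taking them long absorbs every constant into \<open>\<epsilon>\<close>, so
  single-block bounds hold with no factor in front.\<close>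

lemma loop_blocks:
  assumes u: "cyc u" and eps: "\<epsilon> > 0"
  obtains v N Wd where "v \<in> V" "0 < N" "Wd \<subseteq> W v v N" "Wd \<noteq> {}"
    "inj_on (map (\<lambda>e. (dx e, dy e))) Wd"
    "exp (real N * (hE u - \<epsilon>)) \<le> real (card Wd)"
    "\<And>ys. real (card {w\<in>Wd. map dy w = ys}) \<le> exp (real N * (fE u + \<epsilon>))"
proof -
  let ?xy = "map (\<lambda>e. (dx e, dy e))"
  obtain J where J: "\<And>v v'. v \<in> V \<Longrightarrow> reach v v' \<Longrightarrow> \<exists>w. pth ini ter E v w v' \<and> length w \<le> J"
    using short_paths by blast
  obtain C where C: "C > 0" "\<And>k. real (cfib (adm_words ini ter (Eu u) k)) \<le> C * exp (real k * (fE u + \<epsilon> / 2))"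
    using grow_upper[OF finite_Eu, of "\<epsilon> / 2"] eps unfolding fE_def by (metis half_gt_zero)
  define a where "a = ln ((real (card V))\<^sup>2)"
  \<comment> \<open>Large enough to swallow the fibre constant \<open>C\<close>, the pigeonhole loss
    \<open>a\<close> and the entropy \<open>real J * hE u\<close> missed on the return path; the 1
    forces \<open>k > 0\<close>.\<close>
  obtain k :: nat where k: "real k * (\<epsilon> / 2) > 1 + \<bar>ln C\<bar> + a + real J * hE u"
    using reals_Archimedean3[of "\<epsilon> / 2"] eps by (metis half_gt_zero)
  have a0: "0 \<le> a" unfolding a_def using cardV_pos by (simp add: one_le_power)
  have J0: "0 \<le> real J * hE u" using E_nonneg by simp
  have k0: "k > 0" using k a0 J0 by (cases k) auto
  obtain v v' where v: "v \<in> scc u" "v' \<in> scc u"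
    and many: "exp (real k * hE u) \<le> (real (card V))\<^sup>2 * real (cxy (wset ini ter (Eu u) v v' k))"
    unfolding hE_def by (rule many_words[OF u])
  let ?Wf = "wset ini ter (Eu u) v v' k"
  have finf: "finite ?Wf" by (rule finite_wset[OF finite_Eu])
  have vV: "v \<in> V" "v' \<in> V" using v scc_sub by blast+
  obtain p where p: "pth ini ter E v' p v" "length p \<le> J" using J[OF vV(2) scc_reach[OF v(2,1)]] by blast
  have p': "p \<in> wset ini ter (Eu u) v' v (length p)" using pth_scc[OF p(1) v(2,1)] by (simp add: wset_def)
  define N where "N = k + length p"
  \<comment> \<open>A set of representatives, one path per pair word. Without separation several
    paths may have the same digits, and keeping all would spoil injectivity.\<close>
  obtain W0 where W0: "W0 \<subseteq> ?Wf" "inj_on ?xy W0" "?xy ` ?Wf = ?xy ` W0"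
    using iffD1[OF subset_image_inj subset_refl[of "?xy ` ?Wf"]] by blast
  define Wd where "Wd = (\<lambda>w. w @ p) ` W0"
  have Wd_Eu: "Wd \<subseteq> wset ini ter (Eu u) v v N"
    unfolding Wd_def N_def using W0(1) wset_append[OF _ p'] by blast
  have injW: "inj_on (?xy) Wd"
    unfolding Wd_def using W0(2) by (auto simp: inj_on_def)
  have fin0: "finite W0" using W0(1) finf finite_subset by blast
  have "card Wd = card W0" unfolding Wd_def by (rule card_image) (auto simp: inj_on_def)
  also have "\<dots> = card (?xy ` W0)" by (rule card_image[OF W0(2), symmetric])
  also have "\<dots> = cxy ?Wf" unfolding W0(3)[symmetric] by (rule cnt_triv[OF finf, where k=k, symmetric]) (auto simp: wset_def)
  finally have card: "card Wd = cxy ?Wf" .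
  have lower: "exp (real N * (hE u - \<epsilon>)) \<le> real (card Wd)"
  proof -
    have "exp (real k * hE u) \<le> exp a * real (card Wd)"
      using many cardV_pos unfolding card a_def by simp
    then have 1: "exp (real k * hE u - a) \<le> real (card Wd)"
      unfolding exp_diff by (subst pos_divide_le_eq) (auto simp only: exp_gt_zero mult.commute)
    have "real (length p) * hE u \<le> real J * hE u" using p(2) E_nonneg by (intro mult_right_mono) auto
    moreover have "real k * (\<epsilon> / 2) \<le> real N * \<epsilon>" unfolding N_def using eps
      by (intro mult_mono) auto
    ultimately have "real N * (hE u - \<epsilon>) \<le> real k * hE u - a"
      using k unfolding N_def by (simp add: algebra_simps)
    then show ?thesis using 1 by (meson exp_le_cancel_iff order_trans)
  qed
  have upper: "real (card {w\<in>Wd. map dy w = ys}) \<le> exp (real N * (fE u + \<epsilon>))" for ys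
  proof -
    have "inj_on (map dx) {w\<in>Wd. map dy w = ys}"
    proof (rule inj_onI)
      fix w w' assume w: "w \<in> {w\<in>Wd. map dy w = ys}" "w' \<in> {w\<in>Wd. map dy w = ys}" "map dx w = map dx w'"
      have "?xy u = zip (map dx u) (map dy u)" for u by (induction u) auto
      then have "?xy w = ?xy w'" using w by simp
      then show "w = w'" using inj_onD[OF injW] w by blast
    qed
    then have "card {w\<in>Wd. map dy w = ys} = card (map dx ` {w\<in>Wd. map dy w = ys})"
      by (rule card_image[symmetric])
    also have "\<dots> \<le> card (map dx ` {w\<in>adm_words ini ter (Eu u) N. map dy w = ys})"
    proof (rule card_mono)
      show "finite (map dx ` {w \<in> adm_words ini ter (Eu u) N. map dy w = ys})"
        by (intro finite_imageI finite_subset[OF _ finite_adm_words[OF finite_Eu]]) auto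
      show "map dx ` {w\<in>Wd. map dy w = ys} \<subseteq> map dx ` {w\<in>adm_words ini ter (Eu u) N. map dy w = ys}"
        using Wd_Eu wset_adm[of ini ter "Eu u" v v N] by blast
    qed
    also have "\<dots> \<le> cfib (adm_words ini ter (Eu u) N)"
      by (rule cnt_fibre_le[OF finite_adm_words[OF finite_Eu]])
    finally have "real (card {w\<in>Wd. map dy w = ys}) \<le> C * exp (real N * (fE u + \<epsilon> / 2))"
      using C(2)[of N] by linarith
    also have "\<dots> = exp (ln C + real N * (fE u + \<epsilon> / 2))" using C(1) by (simp add: exp_add)
    also have "\<dots> \<le> exp (real N * (fE u + \<epsilon>))"
    proof -
      have "real k * (\<epsilon> / 2) \<le> real N * (\<epsilon> / 2)" unfolding N_def using eps by (intro mult_right_mono) auto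
      then have "ln C \<le> real N * (\<epsilon> / 2)" using k a0 J0 by linarith
      then show ?thesis by (simp add: algebra_simps)
    qed
    finally show ?thesis .
  qed
  show ?thesis
  proof (rule that)
    show "v \<in> V" by (rule vV(1))
    show "0 < N" unfolding N_def using k0 by simp
    show "Wd \<subseteq> W v v N" using Wd_Eu wset_Eu by blast
    have "0 < real (card Wd)" using lower by (meson exp_gt_zero less_le_trans)
    then show "Wd \<noteq> {}" by auto
  qed (use injW lower upper in auto)
qed

text \<open>The mass distribution principle. Block counts are near \<open>exp (N * hE u)\<close> and
  fibres near \<open>exp (N * fE u)\<close>, so a square of side \<open>exp (- D)\<close> has
  log-mass about \<open>- (K * hE u + (Q - K) * pE u)\<close>. By \<open>eq\<close> this is
  \<open>- (K * fE u + Q * pE u)\<close>, that is \<open>- D * t\<close>.\<close>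

lemma hausdorff_lower:
  assumes u: "cyc u" and eq: "hE u = fE u + pE u"
    and s: "0 \<le> s" "hausdorff_measure s XX = 0"
  shows "fE u / ln n + pE u / ln m \<le> s"
proof (rule ccontr)
  define t where "t = fE u / ln n + pE u / ln m"
  assume "\<not> fE u / ln n + pE u / ln m \<le> s"
  then have st: "s < t" unfolding t_def by simp
  note lnp = lnmn
  \<comment> \<open>The fibre bound and the count bound together lose \<open>2 * \<epsilon>\<close>
    per y-digit; this choice leaves exactly the midpoint \<open>s'\<close> of \<open>s\<close> and
    \<open>t\<close>.\<close>
  define \<epsilon> where "\<epsilon> = (t - s) * ln m / 4"
  have eps: "\<epsilon> > 0" unfolding \<epsilon>_def using st lnp by simp
  define s' where "s' = (s + t) / 2"
  have s': "s < s'" "0 < s'" "t - 2 * \<epsilon> / ln m = s'" unfolding s'_def \<epsilon>_def using st s(1) lnp by (auto simp: field_simps)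
  obtain v N Wd where W: "v \<in> V" "0 < N" "Wd \<subseteq> W v v N" "Wd \<noteq> {}"
    "inj_on (map (\<lambda>e. (dx e, dy e))) Wd"
    and lower: "exp (real N * (hE u - \<epsilon>)) \<le> real (card Wd)"
    and upper: "\<And>ys. real (card {w\<in>Wd. map dy w = ys}) \<le> exp (real N * (fE u + \<epsilon>))"
    by (rule loop_blocks[OF u eps]) blast
  define \<beta> where "\<beta> = real (card Wd)"
  define Mx where "Mx = exp (real N * (fE u + \<epsilon>))"
  have \<beta>0: "0 < \<beta>" unfolding \<beta>_def using lower by (meson exp_gt_zero less_le_trans)
  have finWd: "finite Wd" using W(3) finite_W finite_subset by blast
  have "\<exists>z. \<forall>\<omega>. (\<forall>i. \<omega> i \<in> Wd) \<longrightarrow> z \<omega> \<in> XX \<and> (\<forall>k L. k \<le> L \<longrightarrow> z \<omega> \<in> cell (N * k) (N * L) (code (N * k) (N * L) (blocks \<omega> L)))"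
  proof (rule choice, rule allI)
    fix \<omega>
    show "\<exists>z. (\<forall>i. \<omega> i \<in> Wd) \<longrightarrow> z \<in> XX \<and> (\<forall>k L. k \<le> L \<longrightarrow> z \<in> cell (N * k) (N * L) (code (N * k) (N * L) (blocks \<omega> L)))"
      using block_point[of \<omega> v N] W(1,3) by blast
  qed
  then obtain z where z: "\<And>\<omega>. (\<And>i. \<omega> i \<in> Wd) \<Longrightarrow> z \<omega> \<in> XX \<and> (\<forall>k L. k \<le> L \<longrightarrow> z \<omega> \<in> cell (N * k) (N * L) (code (N * k) (N * L) (blocks \<omega> L)))"
    by blast
  define P where "P = PiM UNIV (\<lambda>_::nat. uniform_count_measure Wd)"
  interpret PP: product_prob_space "\<lambda>_::nat. uniform_count_measure Wd" UNIV
    by (rule product_prob_spaceI) (rule prob_space_uniform_count_measure[OF finWd W(4)])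
  have spP: "\<omega> i \<in> Wd" if "\<omega> \<in> space P" for \<omega> i
    using that unfolding P_def by (auto simp: space_PiM space_uniform_count_measure)
  \<comment> \<open>49 cells per set, times the loss of at most one block in each of the roundings
    \<open>K\<close> and \<open>Q\<close>.\<close>
  define C where "C = 49 * exp (real N * (fE u + \<epsilon> + pE u))"
  have C0: "C > 0" unfolding C_def by simp
  have mass: "\<exists>Z\<in>sets P. {\<omega>\<in>space P. z \<omega> \<in> U} \<subseteq> Z \<and> emeasure P Z \<le> ennreal (C * exp (- D * s'))"
    if D: "0 \<le> D" "\<And>x y. x \<in> U \<Longrightarrow> y \<in> U \<Longrightarrow> dist x y * exp D \<le> 2" for D U
  proof -
    let ?k = "lev_lo (n ^ N) D" and ?L = "lev_lo (m ^ N) D"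
    obtain Z where Z: "Z \<in> sets P" "{\<omega>\<in>space P. z \<omega> \<in> U} \<subseteq> Z"
      "emeasure P Z \<le> ennreal (49 * ((1 / \<beta>) ^ ?k * (Mx / \<beta>) ^ (?L - ?k)))"
      using bernoulli_mass[OF W upper[folded Mx_def] z D \<beta>_def, folded P_def] by blast
    have b2: "2 \<le> m ^ N" "m ^ N \<le> n ^ N" "2 \<le> n ^ N"
    proof -
      have "m ^ 1 \<le> m ^ N" using npos W(2) by (intro power_increasing) auto
      then show 1: "2 \<le> m ^ N" using m2 by simp
      show 2: "m ^ N \<le> n ^ N" using mn by (intro power_mono) auto
      show "2 \<le> n ^ N" using 1 2 by linarith
    qed
    have kL: "?k \<le> ?L" using lev_mono(1)[OF b2(1,2) D(1)] .
    have lnN: "ln (real (n ^ N)) = real N * ln n" "ln (real (m ^ N)) = real N * ln m"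
      using npos by (simp_all add: ln_realpow)
    define K where "K = real N * real ?k"
    define Q where "Q = real N * real ?L"
    have "D - real N * ln n \<le> real ?k * (real N * ln n)" "D - real N * ln m \<le> real ?L * (real N * ln m)"
      "real ?L * (real N * ln m) \<le> D"
      using lev_lo_bounds(2)[OF b2(3) D(1)] lev_lo_bounds(1,2)[OF b2(1) D(1)] unfolding lnN by auto
    then have KQ: "D / ln n - real N \<le> K" "D / ln m - real N \<le> Q" "Q \<le> D / ln m"
      unfolding K_def Q_def using lnp by (simp_all add: field_simps)
    have 1: "1 / \<beta> \<le> exp (- (real N * (hE u - \<epsilon>)))"
    proof -
      have "1 / \<beta> \<le> 1 / exp (real N * (hE u - \<epsilon>))"
        using lower \<beta>0 unfolding \<beta>_def[symmetric] by (intro divide_left_mono) auto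
      then show ?thesis by (simp only: exp_minus inverse_eq_divide)
    qed
    have 2: "Mx / \<beta> \<le> exp (- (real N * (pE u - 2 * \<epsilon>)))"
    proof -
      have "Mx * (1 / \<beta>) \<le> Mx * exp (- (real N * (hE u - \<epsilon>)))"
        using 1 unfolding Mx_def by (intro mult_left_mono) auto
      also have "\<dots> = exp (- (real N * (pE u - 2 * \<epsilon>)))"
        unfolding Mx_def eq exp_add[symmetric] by (simp add: algebra_simps)
      finally show ?thesis by simp
    qed
    have "(1 / \<beta>) ^ ?k * (Mx / \<beta>) ^ (?L - ?k)
        \<le> exp (- (real N * (hE u - \<epsilon>))) ^ ?k * exp (- (real N * (pE u - 2 * \<epsilon>))) ^ (?L - ?k)"
      using 1 2 \<beta>0 unfolding Mx_def by (intro mult_mono power_mono) auto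
    also have "\<dots> = exp (- (K * (hE u - \<epsilon>) + (Q - K) * (pE u - 2 * \<epsilon>)))"
      unfolding exp_of_nat_mult[symmetric] exp_add[symmetric] K_def Q_def using kL
      by (simp add: of_nat_diff algebra_simps)
    also have "\<dots> \<le> exp (real N * (fE u + \<epsilon> + pE u) - D * s')"
    proof -
      \<comment> \<open>The only place where \<open>eq\<close> turns the pair exponent into separate
        fibre and y exponents: the terms \<open>K * pE u\<close> cancel.\<close>
      have "K * (hE u - \<epsilon>) + (Q - K) * (pE u - 2 * \<epsilon>) = K * (fE u + \<epsilon>) + Q * pE u - 2 * \<epsilon> * Q"
        unfolding eq by (simp add: algebra_simps)
      moreover have "(D / ln n - real N) * (fE u + \<epsilon>) \<le> K * (fE u + \<epsilon>)"
        using KQ E_nonneg eps by (intro mult_right_mono add_nonneg_nonneg) auto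
      moreover have "(D / ln m - real N) * pE u \<le> Q * pE u"
        using KQ E_nonneg by (intro mult_right_mono) auto
      moreover have "2 * \<epsilon> * Q \<le> 2 * \<epsilon> * (D / ln m)"
        using KQ eps by (intro mult_left_mono) auto
      moreover have "(D / ln n - real N) * (fE u + \<epsilon>) + (D / ln m - real N) * pE u - 2 * \<epsilon> * (D / ln m)
          = D * s' + D / ln n * \<epsilon> - real N * (fE u + \<epsilon> + pE u)"
        unfolding s'(3)[symmetric] t_def by (simp add: algebra_simps)
      moreover have "0 \<le> D / ln n * \<epsilon>" using D(1) lnp eps by simp
      ultimately show ?thesis by simp
    qed
    finally have "49 * ((1 / \<beta>) ^ ?k * (Mx / \<beta>) ^ (?L - ?k)) \<le> C * exp (- D * s')"
      unfolding C_def by (simp add: exp_diff exp_minus inverse_eq_divide)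
    then show ?thesis using Z by (meson ennreal_leI order_trans)
  qed
  have "hausdorff_pre s 1 XX \<le> hausdorff_measure s XX"
    unfolding hausdorff_measure_def by (rule SUP_upper) simp
  then have pre0: "hausdorff_pre s 1 XX = 0" using s(2) by simp
  have "ennreal (1 / (2 * C)) \<le> hausdorff_pre s 1 XX"
    unfolding hausdorff_pre_def
  proof (rule INF_greatest, safe)
    fix U :: "nat \<Rightarrow> (real \<times> real) set"
    assume cov: "XX \<subseteq> (\<Union>j. U j)" and U: "\<forall>j. bounded (U j) \<and> diameter (U j) \<le> 1"
    have "\<exists>Z\<in>sets P. {\<omega>\<in>space P. z \<omega> \<in> U j} \<subseteq> Z \<and>
        emeasure P Z \<le> ennreal C * ennreal (d_pow s (U j)) + ennreal ((1/2) * (1/2) ^ Suc j)" for j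
    proof (cases "diameter (U j) = 0")
      case True
      \<comment> \<open>A set of diameter 0 has \<open>d_pow\<close> equal to 0 for
        \<open>s > 0\<close>, so its mass is bounded at an arbitrarily fine scale instead. The
        allowances \<open>e\<close> sum to 1/2 over \<open>j\<close>, leaving mass at least 1/2 for
        the Hausdorff sum.\<close>
      define e where "e = (1/2) * (1/2::real) ^ Suc j"
      have e: "e > 0" unfolding e_def by simp
      define D where "D = max 0 (ln (C / e) / s')"
      have "dist x y * exp D \<le> 2" if "x \<in> U j" "y \<in> U j" for x y
        using diameter_bounded_bound[of "U j" x y] U that True by simp
      then obtain Z where Z: "Z \<in> sets P" "{\<omega>\<in>space P. z \<omega> \<in> U j} \<subseteq> Z" "emeasure P Z \<le> ennreal (C * exp (- D * s'))"
        using mass[of D "U j"] unfolding D_def by auto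
      have "ln (C / e) \<le> D * s'" unfolding D_def using s'(2) by (simp add: max_def field_simps)
      then have "exp (- D * s') \<le> exp (- ln (C / e))" by simp
      also have "\<dots> = e / C" using C0 e by (simp add: exp_minus)
      finally have "C * exp (- D * s') \<le> e" using C0 by (simp add: field_simps)
      then have "emeasure P Z \<le> ennreal e" using Z(3) by (meson ennreal_leI order_trans)
      also have "\<dots> \<le> ennreal C * ennreal (d_pow s (U j)) + ennreal e" by simp
      finally show ?thesis using Z unfolding e_def by blast
    next
      case False
      let ?d = "diameter (U j)"
      have d: "0 < ?d" "?d \<le> 1" using U False diameter_ge_0[of "U j"] by (auto simp: less_le)
      define D where "D = - ln ?d"
      have "dist x y * exp D \<le> 2" if "x \<in> U j" "y \<in> U j" for x y
      proof -
        have "dist x y \<le> ?d" using diameter_bounded_bound[of "U j" x y] U that by simp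
        then have "dist x y * exp D \<le> ?d * exp D" by (rule mult_right_mono) simp
        also have "\<dots> = 1" unfolding D_def using d by (simp add: exp_minus)
        finally show ?thesis by simp
      qed
      moreover have "0 \<le> D" unfolding D_def using d by simp
      ultimately obtain Z where Z: "Z \<in> sets P" "{\<omega>\<in>space P. z \<omega> \<in> U j} \<subseteq> Z" "emeasure P Z \<le> ennreal (C * exp (- D * s'))"
        using mass[of D "U j"] by blast
      have "exp (- D * s') = ?d powr s'" unfolding D_def powr_def using d by (simp add: mult.commute)
      also have "\<dots> \<le> ?d powr s" using d s'(1) by (intro powr_mono') auto
      also have "\<dots> = d_pow s (U j)" unfolding d_pow_def using d by auto
      finally have "C * exp (- D * s') \<le> C * d_pow s (U j)" using C0 by simp
      then have "emeasure P Z \<le> ennreal (C * d_pow s (U j))" using Z(3) by (meson ennreal_leI order_trans)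
      also have "\<dots> = ennreal C * ennreal (d_pow s (U j))" using C0 by (simp add: ennreal_mult')
      also have "\<dots> \<le> ennreal C * ennreal (d_pow s (U j)) + ennreal ((1/2) * (1/2) ^ Suc j)" by simp
      finally show ?thesis using Z by blast
    qed
    then have "\<forall>j. \<exists>Z. Z \<in> sets P \<and> ({\<omega>\<in>space P. z \<omega> \<in> U j} \<subseteq> Z \<and>
        emeasure P Z \<le> ennreal C * ennreal (d_pow s (U j)) + ennreal ((1/2) * (1/2) ^ Suc j))"
      unfolding Bex_def by (rule allI)
    from choice[OF this] obtain Z where Z: "\<And>j. Z j \<in> sets P" "\<And>j. {\<omega>\<in>space P. z \<omega> \<in> U j} \<subseteq> Z j"
      "\<And>j. emeasure P (Z j) \<le> ennreal C * ennreal (d_pow s (U j)) + ennreal ((1/2) * (1/2) ^ Suc j)" by blast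
    have sub: "space P \<subseteq> (\<Union>j. Z j)"
    proof
      fix \<omega> assume \<omega>: "\<omega> \<in> space P"
      then have "z \<omega> \<in> XX" using z spP by blast
      then obtain j where "z \<omega> \<in> U j" using cov by blast
      then show "\<omega> \<in> (\<Union>j. Z j)" using Z(2)[of j] \<omega> by blast
    qed
    have "1 = emeasure P (space P)" unfolding P_def by (rule PP.P.emeasure_space_1[symmetric])
    also have "\<dots> \<le> emeasure P (\<Union>j. Z j)" using sub Z(1) by (intro emeasure_mono) auto
    also have "\<dots> \<le> (\<Sum>j. emeasure P (Z j))" using Z(1) by (intro emeasure_subadditive_countably) auto
    also have "\<dots> \<le> (\<Sum>j. ennreal C * ennreal (d_pow s (U j)) + ennreal ((1/2) * (1/2) ^ Suc j))"
      by (intro suminf_le Z(3)) auto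
    also have "\<dots> = (\<Sum>j. ennreal C * ennreal (d_pow s (U j))) + (\<Sum>j. ennreal ((1/2) * (1/2) ^ Suc j))"
      by (rule suminf_add[symmetric]) auto
    also have "(\<Sum>j. ennreal C * ennreal (d_pow s (U j))) = ennreal C * (\<Sum>j. ennreal (d_pow s (U j)))"
      by (rule ennreal_suminf_cmult)
    also have "(\<Sum>j. ennreal ((1/2) * (1/2) ^ Suc j)) = ennreal (1/2)"
    proof (rule suminf_ennreal_eq)
      show "(\<lambda>j. (1/2) * (1/2::real) ^ Suc j) sums (1/2)"
        using sums_mult[OF power_half_series, of "1/2"] by simp
    qed simp
    finally have ge: "1 \<le> ennreal C * (\<Sum>j. ennreal (d_pow s (U j))) + ennreal (1/2)" .
    show "ennreal (1 / (2 * C)) \<le> (\<Sum>j. ennreal (d_pow s (U j)))"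
    proof (cases "(\<Sum>j. ennreal (d_pow s (U j)))" rule: ennreal_cases)
      case (real r)
      have "ennreal 1 \<le> ennreal (C * r + 1/2)" using ge real C0 by (simp add: ennreal_mult' ennreal_plus)
      then have "1 \<le> C * r + 1/2" using C0 real by (subst (asm) ennreal_le_iff) auto
      then have "1 / (2 * C) \<le> r" using C0 by (simp add: field_simps)
      then show ?thesis unfolding real(2) by (rule ennreal_leI)
    qed simp
  qed
  then show False using pre0 C0 by simp
qed

section \<open>Comparison of the dimensions\<close>

lemma hausdorff_dim_ge:
  assumes "cyc u" "hE u = fE u + pE u"
  shows "fE u / ln n + pE u / ln m \<le> hausdorff_dim XX"
proof -
  obtain u1 u2 where "dimB = hE u1 / ln n + pE u2 * (1 / ln m - 1 / ln n)" by (rule dimB_attained)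
  then have B0: "0 \<le> dimB" using E_nonneg lnmn by simp
  have "{s. 0 \<le> s \<and> hausdorff_measure s XX = 0} \<noteq> {}"
    using hausdorff_upper_zero[of "dimB + 1"] B0 by force
  then show ?thesis unfolding hausdorff_dim_def
    using hausdorff_lower[OF assms] by (intro cInf_greatest) auto
qed

text \<open>Let (u, u') maximize the box formula. Comparison with (u, u) gives
  \<open>pE u \<le> pE u'\<close>, and with \<open>hE_le\<close> the box value is at most the
  Assouad value of (u, u'). Equality of dimensions makes both estimates sharp, so \<open>u'\<close>
  may be replaced by \<open>u\<close>. The converse is an algebraic identity.\<close>

lemma dim_equality_iff:
  "dimB = dimA \<longleftrightarrow> (\<exists>u. cyc u \<and> dimB = hE u / ln n + pE u * (1 / ln m - 1 / ln n) \<and>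
     dimA = fE u / ln n + pE u / ln m \<and> hE u = fE u + pE u)"
proof
  assume eq: "dimB = dimA"
  obtain u u' where u: "cyc u" "cyc u'" "reach u u'" "dimB = hE u / ln n + pE u' * (1 / ln m - 1 / ln n)"
    by (rule dimB_attained)
  have gap: "0 < 1 / ln (real m) - 1 / ln (real n)" using lnmn by simp
  have "hE u / ln n + pE u * (1 / ln m - 1 / ln n) \<le> dimB" by (rule dimB_ge[OF u(1,1)]) simp
  then have p_le: "pE u \<le> pE u'" using u(4) gap by simp
  have A: "fE u / ln n + pE u' / ln m \<le> dimA" by (rule dimA_ge[OF u(1-3)])
  have "hE u / ln n \<le> fE u / ln n + pE u / ln n"
    using hE_le[of u] lnmn by (simp add: divide_right_mono flip: add_divide_distrib)
  moreover have "pE u / ln n \<le> pE u' / ln n" using p_le lnmn by (simp add: divide_right_mono)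
  moreover have "dimB = hE u / ln n + pE u' / ln m - pE u' / ln n" unfolding u(4) by (simp add: algebra_simps)
  ultimately have "pE u / ln n = pE u' / ln n" "hE u / ln n = fE u / ln n + pE u / ln n"
    and dA: "dimA = fE u / ln n + pE u' / ln m"
    using A eq by linarith+
  then have "pE u = pE u'" "hE u = fE u + pE u" using lnmn by (simp_all flip: add_divide_distrib)
  then show "\<exists>u. cyc u \<and> dimB = hE u / ln n + pE u * (1 / ln m - 1 / ln n) \<and>
     dimA = fE u / ln n + pE u / ln m \<and> hE u = fE u + pE u" using u dA by auto
next
  assume "\<exists>u. cyc u \<and> dimB = hE u / ln n + pE u * (1 / ln m - 1 / ln n) \<and>
     dimA = fE u / ln n + pE u / ln m \<and> hE u = fE u + pE u"
  then obtain u where "dimB = hE u / ln n + pE u * (1 / ln m - 1 / ln n)"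
    "dimA = fE u / ln n + pE u / ln m" "hE u = fE u + pE u" by blast
  then show "dimB = dimA" by (simp add: algebra_simps add_divide_distrib)
qed

lemma hausdorff_eq:
  assumes "dimB = dimA"
  shows "hausdorff_dim XX = dimB"
proof -
  obtain u where "cyc u" "dimA = fE u / ln n + pE u / ln m" "hE u = fE u + pE u"
    using assms dim_equality_iff by blast
  then show ?thesis using hausdorff_dim_le hausdorff_dim_ge[of u] assms by simp
qed

definition comps :: "('v set \<times> 'e set) set" where
  "comps = {(VH, EH). irr_component V E ini ter VH EH}"

lemma comps_eq: "comps = (\<lambda>u. (scc u, Eu u)) ` {u. cyc u}"
  unfolding comps_def irr_component_iff by auto

lemma finite_cyc: "finite {u. cyc u}"
  by (rule finite_subset[OF _ finV]) (use cyc_V in auto)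

text \<open>The nested maxima over components are flattened to one maximum over ordered pairs of
  vertices; several vertices represent the same component, which does not affect a maximum.\<close>

lemma dimA_components:
  "dimA = Max ((\<lambda>(VH, EH). sup_fib ini ter dx dy EH / ln n
     + Max ((\<lambda>(VH', EH'). h_top_piI ini ter dy EH' / ln m) ` {(VH', EH') \<in> comps. reaches E ini ter VH VH'})) ` comps)"
proof -
  define inner where "inner u = Max ((\<lambda>u'. pE u' / ln m) ` {u'. cyc u' \<and> reach u u'})" for u
  have fin: "finite {u'. cyc u' \<and> reach u u'}" for u by (rule finite_subset[OF _ finite_cyc]) auto
  have val: "sup_fib ini ter dx dy (Eu u) / ln n
     + Max ((\<lambda>(VH', EH'). h_top_piI ini ter dy EH' / ln m) ` {(VH', EH') \<in> comps. reaches E ini ter (scc u) VH'})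
     = fE u / ln n + inner u" if u: "cyc u" for u
  proof -
    have "{(VH', EH') \<in> comps. reaches E ini ter (scc u) VH'} = (\<lambda>u'. (scc u', Eu u')) ` {u'. cyc u' \<and> reach u u'}"
      unfolding comps_eq using reaches_iff[OF u] by auto
    then show ?thesis
      unfolding inner_def fE_def pE_def sup_fib_eq_grow[OF u] by (simp add: image_image h_top_pi_eq_grow finite_Eu)
  qed
  have inner_in: "\<exists>u'. cyc u' \<and> reach u u' \<and> inner u = pE u' / ln m" if "cyc u" for u
  proof -
    have "inner u \<in> (\<lambda>u'. pE u' / ln m) ` {u'. cyc u' \<and> reach u u'}"
      unfolding inner_def using fin that by (intro Max_in) auto
    then show ?thesis by auto
  qed
  have inner_ge: "pE u' / ln m \<le> inner u" if "cyc u'" "reach u u'" for u u'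
    unfolding inner_def using fin that by (intro Max_ge) auto
  have "Max ((\<lambda>u. fE u / ln n + inner u) ` {u. cyc u}) = dimA"
  proof (rule Max_eqI)
    show "finite ((\<lambda>u. fE u / ln n + inner u) ` {u. cyc u})" using finite_cyc by simp
    show "y \<le> dimA" if "y \<in> (\<lambda>u. fE u / ln n + inner u) ` {u. cyc u}" for y
      using that inner_in dimA_ge by force
    obtain u u' where u: "cyc u" "cyc u'" "reach u u'" "dimA = fE u / ln n + pE u' / ln m" by (rule dimA_attained)
    obtain x where x: "cyc x" "reach u x" "inner u = pE x / ln m" using inner_in[OF u(1)] by blast
    have "fE u / ln n + inner u \<le> dimA" using dimA_ge[OF u(1) x(1,2)] x(3) by simp
    then have "dimA = fE u / ln n + inner u" using inner_ge[OF u(2,3)] u(4) by linarith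
    then show "dimA \<in> (\<lambda>u. fE u / ln n + inner u) ` {u. cyc u}" using u(1) by blast
  qed
  moreover have "(\<lambda>(VH, EH). sup_fib ini ter dx dy EH / ln n
     + Max ((\<lambda>(VH', EH'). h_top_piI ini ter dy EH' / ln m) ` {(VH', EH') \<in> comps. reaches E ini ter VH VH'})) ` comps
     = (\<lambda>u. fE u / ln n + inner u) ` {u. cyc u}"
  proof -
    have "g ` comps = (\<lambda>u. g (scc u, Eu u)) ` {u. cyc u}" for g :: "_ \<Rightarrow> real"
      unfolding comps_eq by (simp add: image_image)
    then show ?thesis by (simp only: prod.case) (rule image_cong, auto simp: val)
  qed
  ultimately show ?thesis by simp
qed

end

theorem theorem2:
  fixes V :: "'v set" and E :: "'e set" and ini ter :: "'e \<Rightarrow> 'v" and n m :: nat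
    and dx dy :: "'e \<Rightarrow> nat" and X :: "'v \<Rightarrow> (real \<times> real) set"
  assumes finV: "finite V" and V_ne: "V \<noteq> {}" and finE: "finite E"
    and ends: "\<forall>e\<in>E. ini e \<in> V \<and> ter e \<in> V"
    and out: "\<forall>v\<in>V. \<exists>e\<in>E. ini e = v"
    and m2: "2 \<le> m" and mn: "m < n"
    and digits: "\<forall>e\<in>E. dx e < n \<and> dy e < m"
    and Xcpt: "\<forall>v\<in>V. X v \<noteq> {} \<and> compact (X v)"
    and Xeq: "\<forall>v\<in>V. X v = (\<Union>e\<in>{e\<in>E. ini e = v}. psi n m (dx e) (dy e) ` X (ter e))"
  defines "XX \<equiv> \<Union>v\<in>V. X v"
    and "Comps \<equiv> {(VH, EH). irr_component V E ini ter VH EH}"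
  shows "assouad_dim XX =
           Max ((\<lambda>(VH, EH). sup_fib ini ter dx dy EH / ln n
                 + Max ((\<lambda>(VH', EH'). h_top_piI ini ter dy EH' / ln m)
                          ` {(VH', EH') \<in> Comps. reaches E ini ter VH VH'})) ` Comps)
       \<and> (box_dim XX = assouad_dim XX \<longleftrightarrow>
           (\<exists>(VH, EH) \<in> Comps.
              box_dim XX = h_top_I ini ter dx dy EH / ln n
                           + h_top_piI ini ter dy EH * (1 / ln m - 1 / ln n)
            \<and> assouad_dim XX = sup_fib ini ter dx dy EH / ln n + h_top_piI ini ter dy EH / ln m
            \<and> h_top_I ini ter dx dy EH = sup_fib ini ter dx dy EH + h_top_piI ini ter dy EH))
       \<and> (box_dim XX = assouad_dim XX \<longrightarrow>
           hausdorff_dim XX = box_dim XX \<and> box_dim XX = assouad_dim XX)"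
proof -
  interpret C: carpet V E ini ter n m dx dy X
    by unfold_locales (fact assms)+
  have XX: "XX = C.XX" unfolding XX_def C.XX_def ..
  have Comps: "Comps = C.comps" unfolding Comps_def C.comps_def ..
  have A: "assouad_dim XX = C.dimA" unfolding XX by (rule C.assouad_dim_XX)
  have B: "box_dim XX = C.dimB" unfolding XX by (rule C.box_dim_XX)
  have ex: "(\<exists>(VH, EH) \<in> Comps. Q EH) \<longleftrightarrow> (\<exists>u. C.cyc u \<and> Q (C.Eu u))" for Q
    unfolding Comps C.comps_eq by auto
  have vals: "h_top_I ini ter dx dy (C.Eu u) = C.hE u" "h_top_piI ini ter dy (C.Eu u) = C.pE u" for u
    unfolding C.hE_def C.pE_def by (simp_all add: C.h_top_eq_grow C.h_top_pi_eq_grow C.finite_Eu)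
  have fib: "sup_fib ini ter dx dy (C.Eu u) = C.fE u" if "C.cyc u" for u
    unfolding C.fE_def by (rule C.sup_fib_eq_grow[OF that])
  have 1: "assouad_dim XX =
           Max ((\<lambda>(VH, EH). sup_fib ini ter dx dy EH / ln n
                 + Max ((\<lambda>(VH', EH'). h_top_piI ini ter dy EH' / ln m)
                          ` {(VH', EH') \<in> Comps. reaches E ini ter VH VH'})) ` Comps)"
    unfolding A Comps by (rule C.dimA_components)
  have 2: "box_dim XX = assouad_dim XX \<longleftrightarrow>
           (\<exists>(VH, EH) \<in> Comps.
              box_dim XX = h_top_I ini ter dx dy EH / ln n
                           + h_top_piI ini ter dy EH * (1 / ln m - 1 / ln n)
            \<and> assouad_dim XX = sup_fib ini ter dx dy EH / ln n + h_top_piI ini ter dy EH / ln m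
            \<and> h_top_I ini ter dx dy EH = sup_fib ini ter dx dy EH + h_top_piI ini ter dy EH)"
    unfolding ex A B C.dim_equality_iff vals using fib by auto
  have 3: "hausdorff_dim XX = box_dim XX" if "box_dim XX = assouad_dim XX"
    using C.hausdorff_eq that unfolding A B unfolding XX by simp
  show ?thesis using 1 2 3 by blast
qed

end
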